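(* Let $G$ be a finite group and let $\alpha$ be a unitary multiplier on $G$. Let $e$ be the exponent of $\alpha$ and let $\zeta$ be a primitive $e$th root of unity in $\mathbb{C}$. Let $p>2\sqrt{|G|}$ be a prime such that $e$ divides $p-1$, and let $z\in\mathbb{Z}_p$ be such that $z^e=1$ and $z^n\ne 1$ for all $0<n<e$ (such $p$ and $z$ exist). Let $$\theta:\mathbb{Z}[\zeta]\to\mathbb{Z}_p,\qquad f(\zeta)\mapsto f(z)\bmod p\quad\text{for all polynomials } f(x)\in\mathbb{Z}[x].$$ Then: (1) $\theta$ is a well-defined ring homomorphism from $\mathbb{Z}[\zeta]$ to $\mathbb{Z}_p$. (2) Let $(\pi,V,\alpha)$ be a projective representation of $G$ with multiplier $\alpha$. Then for all $g\in G$ the eigenvalues of $\pi(g)$ are $e$th roots of unity. In particular, the values $\chi(g)$ of the character $\chi$ of $\pi$ belong to $\mathbb{Z}[\zeta]$. (3) Let $C^{(1)},\dots,C^{(m)}$ be the $\alpha$-regular conjugacy classes of $G$ and fix a representative $c^{(i)}_0\in C^{(i)}$ for each $i$. For each $\alpha$-regular class $A$ define the $m\times m$ matrix $\tilde M_A$ over $\mathbb{Z}_p$, with rows and columns indexed by the $\alpha$-regular classes $B,C$ (in the order $C^{(1)},\dots,C^{(m)}$), by $$(\tilde M_A)_{BC}=\sum_{\substack{a\in A\\ ab_0\in C}}\frac{\theta(\beta(c_0,ab_0))}{\theta(\beta(a_0,a))}\,\theta(\alpha(a,b_0)),$$ where $a_0,b_0,c_0$ are the chosen representatives of $A,B,C$.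 Let $\chi$ be the character of an irreducible projective representation of $G$ of degree $d$ with multiplier $\alpha$, and let $w_\chi=\big(\theta(\chi(c^{(1)}_0)),\dots,\theta(\chi(c^{(m)}_0))\big)^T\in\mathbb{Z}_p^m$. Then for each $\alpha$-regular class $A$ the eigenvalue equation $$\tilde M_A\,w_\chi=|A|\,\theta(\chi(a_0))\,d^{-1}\,w_\chi$$ holds in $\mathbb{Z}_p$. In other words, $w_\chi$ is a joint eigenvector of all the matrices $\tilde M_A$. (4) The matrices $\tilde M_A$ are jointly diagonalisable in $\mathbb{Z}_p$. Their $m$ joint eigenvectors are uniquely defined up to a scalar factor and correspond, via $\chi\mapsto w_\chi$ and the eigenvalue equation in (3), to the distinct characters $\chi$ of irreducible projective representations of $G$ with multiplier $\alpha$. (5) Let $\chi$ be the character of a projective representation $(\pi,V,\alpha)$ of $G$. For all $g\in G$ and $0\le k<e$ let $m_k(g)\ge 0$ be the multiplicity of the eigenvalue $\zeta^k$ in $\pi(g)$. Then (a) $\chi(g^n)=\Big[\prod_{i=1}^{n-1}\alpha(g^i,g)\Big]\Big[\sum_{k=0}^{e-1}m_k(g)\,\zeta^{kn}\Big]$ for all $g\in G$ and $n\ge 0$. (b) For all $g\in G$ and $0\le k<e$, $$m_k(g)=e^{-1}\sum_{n=0}^{e-1}z^{-nk}\,\theta(\chi(g^n))\prod_{i=1}^{n-1}\theta(\alpha(g^i,g))^{-1}\pmod p.$$ In particular, if $\pi$ is irreducible, $m_k(g)$ is the smallest such nonnegative integer, i.e. the smallest nonnegative integer satisfying this congruence.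
   Context: A multiplier on $G$ is a function $\alpha:G\times G\to\mathbb{C}^\times$ with $\alpha(x,y)\alpha(xy,z)=\alpha(x,yz)\alpha(y,z)$ for all $x,y,z\in G$ and $\alpha(x,1)=\alpha(1,x)=1$ for all $x\in G$. It is unitary if there is a positive integer $N$ with $\alpha(x,y)^N=1$ for all $x,y\in G$; the smallest such $N$ is the order of $\alpha$. For a unitary multiplier $\alpha$ and $g\in G$ of order $n$, let $A_g=\prod_{i=1}^{n-1}\alpha(g^i,g)$ and let $n^*$ be the smallest positive integer with $A_g^{n^*}=1$; the order of $g$ in $\alpha$ is $o_\alpha(g)=nn^*$. The exponent of $\alpha$ is the least common multiple of the order of $\alpha$ and of all the $o_\alpha(g)$, $g\in G$. A projective representation $(\pi,V,\alpha)$ of $G$ over a finite-dimensional complex vector space $V$ with multiplier $\alpha$ is a function $\pi:G\to\mathrm{GL}(V)$ with $\pi(x)\pi(y)=\alpha(x,y)\pi(xy)$ for all $x,y\in G$. Its degree is $\dim V$ and its character is $\chi(g)=\mathrm{tr}(\pi(g))$. It is irreducible if no nontrivial proper subspace of $V$ is invariant under all $\pi(g)$, $g\in G$. For $g,h\in G$ put $$\beta_h(g)=\frac{\alpha(h,h^{-1})}{\alpha(h,gh^{-1})\alpha(g,h^{-1})}=\frac{\alpha(h,h^{-1})}{\alpha(h,g)\alpha(hg,h^{-1})}$$ (the two expressions agree). An element $g\in G$ is $\alpha$-regular if $\beta_h(g)=1$ for all $h\in G$ with $gh=hg$. Conjugates of an $\alpha$-regular element are $\alpha$-regular, and a conjugacy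 class consisting of such elements is called $\alpha$-regular. If $g$ is $\alpha$-regular and $g'$ is conjugate to $g$, then $\beta(g,g'):=\beta_h(g)$ for any $h\in G$ with $g'=hgh^{-1}$; this does not depend on the choice of $h$. $\mathbb{Z}_p$ denotes the field $\mathbb{Z}/p\mathbb{Z}$; $d^{-1}$ and $e^{-1}$ denote inverses in $\mathbb{Z}_p$ (these exist). Empty products equal $1$. A joint eigenvector of a family of matrices is a nonzero vector that is an eigenvector of every matrix in the family.
   Formalization: In (5) the product of the α(g^i,g) is inverted in (a) and not inverted in (b); as printed (5) is false, e.g. for G=C_2, α(g,g)=i, π(g)=ζ with e=8, where (a) at n=2 would give χ(1)=-1. *)

theory Defs
  imports
    Complex_Main
    "HOL-Number_Theory.Cong"
    "HOL-Algebra.Multiplicative_Group"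
    "HOL-Algebra.Algebraic_Closure_Type"
    "Jordan_Normal_Form.Char_Poly"
    "Jordan_Normal_Form.VS_Connect"
    "Berlekamp_Zassenhaus.Finite_Field"
begin

section \<open>Multipliers\<close>

text \<open>Groups are given by their carriers; only the values of a multiplier on the carrier matter.\<close>

definition multiplier :: "('g, 'more) monoid_scheme \<Rightarrow> ('g \<Rightarrow> 'g \<Rightarrow> complex) \<Rightarrow> bool" where
  "multiplier G \<alpha> \<longleftrightarrow>
     (\<forall>x\<in>carrier G. \<forall>y\<in>carrier G. \<alpha> x y \<noteq> 0) \<and>
     (\<forall>x\<in>carrier G. \<forall>y\<in>carrier G. \<forall>z\<in>carrier G.
        \<alpha> x y * \<alpha> (x \<otimes>\<^bsub>G\<^esub> y) z = \<alpha> x (y \<otimes>\<^bsub>G\<^esub> z) * \<alpha> y z) \<and>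
     (\<forall>x\<in>carrier G. \<alpha> x \<one>\<^bsub>G\<^esub> = 1 \<and> \<alpha> \<one>\<^bsub>G\<^esub> x = 1)"

definition unitary_multiplier :: "('g, 'more) monoid_scheme \<Rightarrow> ('g \<Rightarrow> 'g \<Rightarrow> complex) \<Rightarrow> bool" where
  "unitary_multiplier G \<alpha> \<longleftrightarrow> multiplier G \<alpha> \<and>
     (\<exists>N>0. \<forall>x\<in>carrier G. \<forall>y\<in>carrier G. \<alpha> x y ^ N = 1)"

definition multiplier_order :: "('g, 'more) monoid_scheme \<Rightarrow> ('g \<Rightarrow> 'g \<Rightarrow> complex) \<Rightarrow> nat" where
  "multiplier_order G \<alpha> =
     (LEAST N. N > 0 \<and> (\<forall>x\<in>carrier G. \<forall>y\<in>carrier G. \<alpha> x y ^ N = 1))"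

text \<open>The order \<open>o\<^sub>\<alpha>(g) = n n\<^sup>*\<close> of a group element in \<open>\<alpha>\<close>.\<close>

definition order_in_multiplier ::
    "('g, 'more) monoid_scheme \<Rightarrow> ('g \<Rightarrow> 'g \<Rightarrow> complex) \<Rightarrow> 'g \<Rightarrow> nat" where
  "order_in_multiplier G \<alpha> g =
     (let n = group.ord G g; A = (\<Prod>i=1..<n. \<alpha> (g [^]\<^bsub>G\<^esub> i) g)
      in n * (LEAST k. k > 0 \<and> A ^ k = 1))"

definition multiplier_exponent ::
    "('g, 'more) monoid_scheme \<Rightarrow> ('g \<Rightarrow> 'g \<Rightarrow> complex) \<Rightarrow> nat" where
  "multiplier_exponent G \<alpha> =
     lcm (multiplier_order G \<alpha>) (Lcm (order_in_multiplier G \<alpha> ` carrier G))"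

section \<open>Regular conjugacy classes\<close>

text \<open>\<open>beta G \<alpha> h g\<close> is \<open>\<beta>\<^sub>h(g)\<close>.\<close>

definition beta ::
    "('g, 'more) monoid_scheme \<Rightarrow> ('g \<Rightarrow> 'g \<Rightarrow> complex) \<Rightarrow> 'g \<Rightarrow> 'g \<Rightarrow> complex" where
  "beta G \<alpha> h g =
     \<alpha> h (inv\<^bsub>G\<^esub> h) / (\<alpha> h (g \<otimes>\<^bsub>G\<^esub> inv\<^bsub>G\<^esub> h) * \<alpha> g (inv\<^bsub>G\<^esub> h))"

definition regular_element ::
    "('g, 'more) monoid_scheme \<Rightarrow> ('g \<Rightarrow> 'g \<Rightarrow> complex) \<Rightarrow> 'g \<Rightarrow> bool" where
  "regular_element G \<alpha> g \<longleftrightarrow> g \<in> carrier G \<and>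
     (\<forall>h\<in>carrier G. g \<otimes>\<^bsub>G\<^esub> h = h \<otimes>\<^bsub>G\<^esub> g \<longrightarrow> beta G \<alpha> h g = 1)"

definition conjugacy_class :: "('g, 'more) monoid_scheme \<Rightarrow> 'g \<Rightarrow> 'g set" where
  "conjugacy_class G g = (\<lambda>h. h \<otimes>\<^bsub>G\<^esub> g \<otimes>\<^bsub>G\<^esub> inv\<^bsub>G\<^esub> h) ` carrier G"

definition regular_classes ::
    "('g, 'more) monoid_scheme \<Rightarrow> ('g \<Rightarrow> 'g \<Rightarrow> complex) \<Rightarrow> 'g set set" where
  "regular_classes G \<alpha> =
     {A. (\<exists>g\<in>carrier G. A = conjugacy_class G g) \<and> (\<forall>a\<in>A. regular_element G \<alpha> a)}"

text \<open>\<open>beta_conj G \<alpha> g g'\<close> is \<open>\<beta>(g, g')\<close>. It is only meaningful if \<open>g\<close> is \<open>\<alpha>\<close>-regular and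
  \<open>g'\<close> is conjugate to \<open>g\<close>; the value is then independent of the chosen conjugating element.\<close>

definition beta_conj ::
    "('g, 'more) monoid_scheme \<Rightarrow> ('g \<Rightarrow> 'g \<Rightarrow> complex) \<Rightarrow> 'g \<Rightarrow> 'g \<Rightarrow> complex" where
  "beta_conj G \<alpha> g g' =
     beta G \<alpha> (SOME h. h \<in> carrier G \<and> g' = h \<otimes>\<^bsub>G\<^esub> g \<otimes>\<^bsub>G\<^esub> inv\<^bsub>G\<^esub> h) g"

section \<open>Projective representations\<close>

text \<open>A representation space of dimension \<open>d\<close> is identified with the column space of dimension \<open>d\<close>
  over the complex numbers by the choice of a basis, so that \<open>GL(V)\<close> becomes the set of
  invertible \<open>d \<times> d\<close> matrices.\<close>

definition proj_rep ::
    "('g, 'more) monoid_scheme \<Rightarrow> ('g \<Rightarrow> 'g \<Rightarrow> complex) \<Rightarrow> nat \<Rightarrow> ('g \<Rightarrow> complex mat) \<Rightarrow> bool" where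
  "proj_rep G \<alpha> d \<pi> \<longleftrightarrow>
     (\<forall>g\<in>carrier G. \<pi> g \<in> carrier_mat d d \<and> invertible_mat (\<pi> g)) \<and>
     (\<forall>x\<in>carrier G. \<forall>y\<in>carrier G. \<pi> x * \<pi> y = \<alpha> x y \<cdot>\<^sub>m \<pi> (x \<otimes>\<^bsub>G\<^esub> y))"

text \<open>As usual, the zero space is not irreducible.\<close>

definition irreducible_proj_rep ::
    "('g, 'more) monoid_scheme \<Rightarrow> ('g \<Rightarrow> 'g \<Rightarrow> complex) \<Rightarrow> nat \<Rightarrow> ('g \<Rightarrow> complex mat) \<Rightarrow> bool" where
  "irreducible_proj_rep G \<alpha> d \<pi> \<longleftrightarrow> proj_rep G \<alpha> d \<pi> \<and> d > 0 \<and>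
     (\<forall>W. VectorSpace.subspace class_ring W (module_vec TYPE(complex) d) \<longrightarrow>
          (\<forall>g\<in>carrier G. \<forall>w\<in>W. \<pi> g *\<^sub>v w \<in> W) \<longrightarrow>
          W = {0\<^sub>v d} \<or> W = carrier_vec d)"

definition mat_trace :: "'a :: comm_monoid_add mat \<Rightarrow> 'a" where
  "mat_trace A = (\<Sum>i<dim_row A. A $$ (i, i))"

text \<open>Characters are made extensional outside the carrier, so that equality of characters is
  equality on the group and the irreducible characters can be counted.\<close>

definition proj_character ::
    "('g, 'more) monoid_scheme \<Rightarrow> ('g \<Rightarrow> complex mat) \<Rightarrow> 'g \<Rightarrow> complex" where
  "proj_character G \<pi> = restrict (\<lambda>g. mat_trace (\<pi> g)) (carrier G)"

definition irreducible_characters ::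
    "('g, 'more) monoid_scheme \<Rightarrow> ('g \<Rightarrow> 'g \<Rightarrow> complex) \<Rightarrow> ('g \<Rightarrow> complex) set" where
  "irreducible_characters G \<alpha> = {proj_character G \<pi> | d \<pi>. irreducible_proj_rep G \<alpha> d \<pi>}"

text \<open>Algebraic multiplicity; it is \<open>0\<close> if \<open>a\<close> is not an eigenvalue.\<close>

definition eigenvalue_multiplicity :: "'a :: field mat \<Rightarrow> 'a \<Rightarrow> nat" where
  "eigenvalue_multiplicity A a = Polynomial.order a (char_poly A)"

definition joint_eigenvector :: "'a :: comm_ring_1 mat set \<Rightarrow> 'a vec \<Rightarrow> bool" where
  "joint_eigenvector S v \<longleftrightarrow> (\<forall>A\<in>S. \<exists>k. eigenvector A v k)"

definition jointly_diagonalisable :: "'a :: comm_ring_1 mat set \<Rightarrow> bool" where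
  "jointly_diagonalisable S \<longleftrightarrow>
     (\<exists>P Q. \<forall>A\<in>S. \<exists>D. diagonal_mat D \<and> similar_mat_wit A D P Q)"

section \<open>Reduction to the prime field\<close>

definition primitive_root_of_unity :: "nat \<Rightarrow> 'a :: monoid_mult \<Rightarrow> bool" where
  "primitive_root_of_unity e x \<longleftrightarrow> x ^ e = 1 \<and> (\<forall>n. 0 < n \<and> n < e \<longrightarrow> x ^ n \<noteq> 1)"

abbreviation eval_int_poly :: "int poly \<Rightarrow> 'a :: comm_ring_1 \<Rightarrow> 'a" where
  "eval_int_poly f x \<equiv> poly (map_poly of_int f) x"

text \<open>\<open>int_adjoin \<zeta>\<close> is the ring obtained from the integers by adjoining \<open>\<zeta>\<close>.\<close>

definition int_adjoin :: "complex \<Rightarrow> complex set" where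
  "int_adjoin \<zeta> = range (\<lambda>f. eval_int_poly f \<zeta>)"

text \<open>The map \<open>\<theta>\<close>. The definite description denotes an actual value exactly where the
  assignment \<open>f(\<zeta>) \<mapsto> f(z)\<close> is unambiguous.\<close>

definition theta :: "complex \<Rightarrow> 'k :: comm_ring_1 \<Rightarrow> complex \<Rightarrow> 'k" where
  "theta \<zeta> z x = (THE y. \<exists>f. x = eval_int_poly f \<zeta> \<and> y = eval_int_poly f z)"

text \<open>The matrix for the class \<open>A = C k\<close>. Row \<open>i\<close> is the class \<open>B = C i\<close> and column \<open>j\<close> the
  class \<open>C j\<close>, with representatives \<open>c0 k\<close>, \<open>c0 i\<close> and \<open>c0 j\<close>.\<close>

definition class_matrix ::
    "('g, 'more) monoid_scheme \<Rightarrow> ('g \<Rightarrow> 'g \<Rightarrow> complex) \<Rightarrow> (complex \<Rightarrow> 'k :: field) \<Rightarrow>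
     nat \<Rightarrow> (nat \<Rightarrow> 'g set) \<Rightarrow> (nat \<Rightarrow> 'g) \<Rightarrow> nat \<Rightarrow> 'k mat" where
  "class_matrix G \<alpha> \<theta> m C c0 k = mat m m (\<lambda>(i, j).
     \<Sum>a | a \<in> C k \<and> a \<otimes>\<^bsub>G\<^esub> c0 i \<in> C j.
       \<theta> (beta_conj G \<alpha> (c0 j) (a \<otimes>\<^bsub>G\<^esub> c0 i)) / \<theta> (beta_conj G \<alpha> (c0 k) a) * \<theta> (\<alpha> a (c0 i)))"

definition character_vec ::
    "(complex \<Rightarrow> 'k) \<Rightarrow> nat \<Rightarrow> (nat \<Rightarrow> 'g) \<Rightarrow> ('g \<Rightarrow> complex) \<Rightarrow> 'k vec" where
  "character_vec \<theta> m c0 \<chi> = vec m (\<lambda>i. \<theta> (\<chi> (c0 i)))"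

end

theory Submission
  imports
    Defs
    "HOL-Number_Theory.Residue_Primitive_Roots"
    "HOL-Algebra.Sylow"
    "Jordan_Normal_Form.Jordan_Normal_Form_Existence"
begin

text \<open>The theorem is Dixon's way of computing characters modulo a prime, carried over to projective
representations with a multiplier \<open>\<alpha>\<close>. The proof has three parts.

\<^bold>\<open>Arithmetic.\<close> The map \<open>\<theta>\<close> is well defined because every integer polynomial that vanishes at \<open>\<zeta>\<close>
is a multiple of the monic minimal polynomial \<open>\<mu>\<close> of \<open>\<zeta>\<close>, and \<open>\<mu>\<close> vanishes at each primitive \<open>e\<close>-th root
of unity of a field in which \<open>e\<close> is invertible. Some primitive root \<open>z\<^sub>0\<close> of the field is a zero of \<open>\<mu>\<close>
because \<open>\<mu>\<close> divides \<open>X\<^sup>e - 1\<close>, and \<open>z = z\<^sub>0\<^sup>j\<close> for some \<open>j\<close> prime to \<open>e\<close>; it remains to see that \<open>f(\<zeta>) = 0\<close>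
implies \<open>f(\<zeta>\<^sup>j) = 0\<close>, which is Dedekind's argument for the irreducibility of cyclotomic polynomials
(\<open>conjugate_root\<close>, \<open>eval_int_poly_reduction\<close>). The values of \<open>\<mu>\<close> also supply the primes congruent to
\<open>1\<close> modulo \<open>e\<close> (\<open>exists_prime_cong_1\<close>).

\<^bold>\<open>Complex characters.\<close> For a regular class \<open>A\<close> the weighted sum of the \<open>\<pi>(a)/\<beta>(a\<^sub>0,a)\<close> over \<open>a \<in> A\<close> commutes
with all of \<open>\<pi>\<close>, so by Schur's lemma it is a scalar on an irreducible \<open>\<pi>\<close>; multiplying it by
\<open>\<pi>(b\<^sub>0)\<close> and taking traces gives the eigenvalue equation over the complex numbers
(\<open>class_equation\<close>). Averaging over the group gives the orthogonality relations. They bound the number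
of irreducible characters by the number \<open>m\<close> of regular classes and the degrees by the square root of
the group order. That there are \<open>m\<close> characters (\<open>class_fun_complete\<close>) is seen in the twisted regular
representation: a nonzero class function orthogonal to all characters would give a central operator
that is not nilpotent, but that acts as zero on each irreducible representation inside its
eigenspaces.

\<^bold>\<open>Reduction.\<close> The exponent \<open>e\<close> is chosen such that \<open>\<pi>(g)\<^sup>e = 1\<close>, so all numbers above lie in the domain of
\<open>\<theta>\<close>. As \<open>e\<close> is a multiple of every element order, \<open>p\<close> does not divide the group order, and the degrees
are less than \<open>p\<close>. So the orthogonality relations survive the reduction. They show that the
vectors \<open>w\<^sub>\<chi>\<close> form a basis, with the reduced dual characters as dual basis, and that the \<open>w\<^sub>\<chi>\<close> have
pairwise distinct systems of eigenvalues; this is joint diagonalisability and the description of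
the joint eigenvectors. The multiplicities of eigenvalues come from \<open>\<pi>(g)\<^sup>n\<close>, which is a product of
multiplier values times \<open>\<pi>(g\<^sup>n)\<close>, by Fourier inversion on the cyclic group of \<open>e\<close>-th roots of unity, and
they are at most the degree, hence less than \<open>p\<close>.\<close>

section \<open>Cyclotomic integers modulo a prime\<close>

declare poly_monom [simp]

lemma eval_int_poly_simps [simp]:
  fixes x :: "'a::comm_ring_1"
  shows "eval_int_poly (f + g) x = eval_int_poly f x + eval_int_poly g x"
    and "eval_int_poly (f - g) x = eval_int_poly f x - eval_int_poly g x"
    and "eval_int_poly (- f) x = - eval_int_poly f x"
    and "eval_int_poly (f * g) x = eval_int_poly f x * eval_int_poly g x"
    and "eval_int_poly (smult c f) x = of_int c * eval_int_poly f x"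
    and "eval_int_poly (f ^ n) x = eval_int_poly f x ^ n"
    and "eval_int_poly (pCons c f) x = of_int c + x * eval_int_poly f x"
    and "eval_int_poly (monom c n) x = of_int c * x ^ n"
    and "eval_int_poly 1 x = 1"
    and "eval_int_poly 0 x = 0"
  by (simp_all add: of_int_poly_hom.hom_add of_int_poly_hom.hom_minus of_int_poly_hom.hom_mult
      of_int_poly_hom.hom_power of_int_poly_hom.hom_uminus of_int_hom.map_poly_hom_smult of_int_hom.map_poly_pCons_hom
      of_int_hom.map_poly_hom_monom poly_monom)

lemma eval_int_poly_pcompose [simp]:
  fixes x :: "'a::comm_ring_1"
  shows "eval_int_poly (f \<circ>\<^sub>p g) x = eval_int_poly f (eval_int_poly g x)"
  by (induction f) (simp_all add: pcompose_pCons)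

text \<open>Gauss's lemma: contents are multiplicative, so the constant \<open>c\<close> divides the cofactor.\<close>

lemma primitive_dvd_smult_imp_dvd:
  fixes m f :: "int poly"
  assumes "content m = 1" "c \<noteq> 0" "m dvd smult c f"
  shows "m dvd f"
proof -
  obtain q where q: "smult c f = m * q" using assms(3) by (auto elim: dvdE)
  have "content q = content (m * q)" using assms(1) by (simp add: content_mult)
  also have "\<dots> = normalize c * content f" unfolding q[symmetric] by simp
  finally have "c dvd content q" by simp
  then have "[:c:] dvd q" by (simp add: const_poly_dvd_iff_dvd_content)
  then obtain r where r: "q = smult c r" by (auto elim: dvdE)
  have "smult c f = smult c (m * r)" using q r by simp
  then have "f = m * r" using assms(2) by (simp add: smult_cancel)
  then show ?thesis by simp
qed

text \<open>A polynomial of least degree with root \<open>\<zeta>\<close>, made primitive, divides all others up to a constant by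
pseudo-division, hence outright by Gauss's lemma. That it divides the monic \<open>g\<close> makes its leading
coefficient a unit.\<close>

lemma monic_minimal_int_poly:
  fixes \<zeta> :: "'a::field_char_0"
  assumes "monic g" "eval_int_poly g \<zeta> = 0"
  obtains \<mu> :: "int poly" where "monic \<mu>" "degree \<mu> > 0"
    "\<And>f. eval_int_poly f \<zeta> = 0 \<longleftrightarrow> \<mu> dvd f"
proof -
  define P where "P = (\<lambda>f::int poly. f \<noteq> 0 \<and> eval_int_poly f \<zeta> = 0)"
  have "P g" using assms by (auto simp: P_def)
  define m where "m = arg_min degree P"
  have Pm: "P m" and min: "\<And>f. P f \<Longrightarrow> degree m \<le> degree f"
    using arg_min_nat_lemma[of P g degree] \<open>P g\<close> unfolding m_def by auto
  define \<mu>0 where "\<mu>0 = primitive_part m"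
  have m: "m = smult (content m) \<mu>0" by (simp add: \<mu>0_def)
  have "content m \<noteq> 0" using Pm by (simp add: P_def)
  have "eval_int_poly m \<zeta> = of_int (content m) * eval_int_poly \<mu>0 \<zeta>"
    by (subst m) (rule eval_int_poly_simps)
  then have root0: "eval_int_poly \<mu>0 \<zeta> = 0" using Pm \<open>content m \<noteq> 0\<close> by (auto simp: P_def)
  have \<mu>0: "\<mu>0 \<noteq> 0" "content \<mu>0 = 1" "degree \<mu>0 = degree m"
    using Pm by (auto simp: \<mu>0_def P_def)
  have dvd0: "\<mu>0 dvd f" if "eval_int_poly f \<zeta> = 0" for f
  proof -
    define r where "r = pseudo_mod f \<mu>0"
    obtain a q where a: "a \<noteq> 0" "smult a f = \<mu>0 * q + r" and r: "r = 0 \<or> degree r < degree \<mu>0"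
      using pseudo_mod[OF \<mu>0(1), of f] unfolding r_def by blast
    have "eval_int_poly (smult a f) \<zeta> = 0" using that by simp
    then have "eval_int_poly r \<zeta> = 0" unfolding a using root0 by simp
    with r min[of r] \<mu>0 have "r = 0" by (auto simp: P_def)
    then show ?thesis using primitive_dvd_smult_imp_dvd[OF \<mu>0(2) a(1)] a(2) by simp
  qed
  have "lead_coeff \<mu>0 dvd lead_coeff g"
    using dvd0[OF assms(2)] by (metis dvd_def lead_coeff_mult)
  then have unit: "is_unit (lead_coeff \<mu>0)" using assms(1) by simp
  define \<mu> where "\<mu> = smult (lead_coeff \<mu>0) \<mu>0"
  have "lead_coeff \<mu>0 = 1 \<or> lead_coeff \<mu>0 = -1" using unit by auto
  then have mm: "\<mu> = \<mu>0 \<or> \<mu> = - \<mu>0" "monic \<mu>" by (auto simp: \<mu>_def)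
  have root: "eval_int_poly \<mu> \<zeta> = 0" using root0 by (simp add: \<mu>_def)
  have iff: "eval_int_poly f \<zeta> = 0 \<longleftrightarrow> \<mu> dvd f" for f
    using dvd0[of f] mm root by (auto elim!: dvdE)
  have "degree \<mu> > 0"
  proof (rule ccontr)
    assume "\<not> ?thesis"
    then have "\<mu> = 1" using mm(2) monic_degree_0 by blast
    then show False using root by simp
  qed
  with mm(2) iff show thesis by (intro that) auto
qed

text \<open>The last hypothesis says that \<open>c\<close> is \<open>q\<close> times an element of the quotient of the polynomial ring by
\<open>\<mu>\<close>. This quotient is free on the powers of \<open>X\<close> below \<open>degree \<mu>\<close>, so the coefficients of \<open>1\<close> can be
compared.\<close>

lemma dvd_int_if_const_multiple_of_monic:
  fixes \<mu> t :: "int poly"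
  assumes "monic \<mu>" "degree \<mu> > 0" "\<mu> dvd smult q t - [:c:]"
  shows "q dvd c"
proof -
  have nz: "\<mu> \<noteq> 0" using assms by auto
  obtain s r where sr: "pseudo_divmod t \<mu> = (s, r)" by force
  have t: "t = \<mu> * s + r" and r: "r = 0 \<or> degree r < degree \<mu>"
    using pseudo_divmod[OF nz sr] assms(1) by auto
  have "smult q t - [:c:] = \<mu> * smult q s + (smult q r - [:c:])" by (simp add: t algebra_simps smult_add_right)
  then have "\<mu> dvd smult q r - [:c:]" using assms(3) by (metis dvd_add_right_iff dvd_triv_left)
  moreover have "degree (smult q r - [:c:]) < degree \<mu>"
    using r assms(2) by (intro degree_diff_less) (auto intro: le_less_trans[OF degree_smult_le])
  ultimately have "smult q r = [:c:]"
    by (metis dvd_imp_degree_le not_le right_minus_eq)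
  then have "c = q * coeff r 0" by (metis coeff_pCons_0 coeff_smult)
  then show ?thesis by simp
qed

lemma fermat_int:
  assumes "prime q"
  shows "[a ^ q = a] (mod int q)"
proof (cases "int q dvd a")
  case True
  then have "[a ^ q = 0] (mod int q)" "[a = 0] (mod int q)"
    using prime_gt_0_nat[OF assms] dvd_power[of q a] by (auto simp: cong_0_iff intro: dvd_trans)
  then show ?thesis by (metis cong_sym cong_trans)
next
  case False
  define b where "b = nat (a mod int q)"
  have b: "[int b = a] (mod int q)" using assms prime_gt_0_nat[of q] by (simp add: b_def cong_def)
  then have "\<not> q dvd b" using False by (metis cong_dvd_iff int_dvd_int_iff)
  then have "[b ^ (q - 1) * b = 1 * b] (mod q)" using fermat_theorem[OF assms] by (intro cong_mult) auto
  then have "[b ^ q = b] (mod q)" using prime_gt_0_nat[OF assms] by (metis mult.left_neutral power_minus_mult)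
  then have "[int b ^ q = int b] (mod int q)" by (metis cong_int_iff of_nat_power)
  then show ?thesis using b by (meson cong_pow cong_sym cong_trans)
qed

text \<open>The Frobenius congruence \<open>f(X\<^sup>q) \<equiv> f(X)\<^sup>q\<close> modulo \<open>q\<close>, by induction on the coefficients: the mixed binomial
coefficients are divisible by \<open>q\<close>, and \<open>a\<^sup>q \<equiv> a\<close>.\<close>

lemma frobenius_int_poly:
  fixes f :: "int poly"
  assumes "prime q"
  shows "\<exists>r. f \<circ>\<^sub>p monom 1 q = f ^ q + smult (int q) r"
proof (induction f)
  case 0
  then show ?case using assms prime_gt_0_nat by (intro exI[of _ 0]) (auto simp: zero_power)
next
  case (pCons a f)
  obtain r where r: "f \<circ>\<^sub>p monom 1 q = f ^ q + smult (int q) r" using pCons by blast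
  define u where "u = [:0,1:] * f"
  have "\<exists>s. ([:a:] + u) ^ q = [:a:] ^ q + u ^ q + smult (int q) s"
  proof -
    have "of_nat q dvd (of_nat (q choose k) * [:a:] ^ k * u ^ (q - k))" if "k \<in> {1..<q}" for k
    proof -
      obtain t where "q choose k = q * t" using assms \<open>k \<in> {1..<q}\<close> dvd_choose_prime[of k q] by (auto elim: dvdE)
      then show ?thesis by (simp add: mult.assoc)
    qed
    then have d: "of_nat q dvd (\<Sum>k=1..<q. of_nat (q choose k) * [:a:] ^ k * u ^ (q - k))"
      by (rule dvd_sum)
    have q0: "q > 0" using assms prime_gt_0_nat by blast
    have "([:a:] + u) ^ q = (\<Sum>k\<le>q. of_nat (q choose k) * [:a:] ^ k * u ^ (q - k))"
      by (rule binomial_ring)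
    also have "{..q} = insert 0 (insert q {1..<q})" using q0 by auto
    also have "(\<Sum>k\<in>\<dots>. of_nat (q choose k) * [:a:] ^ k * u ^ (q - k)) =
       [:a:] ^ q + u ^ q + (\<Sum>k=1..<q. of_nat (q choose k) * [:a:] ^ k * u ^ (q - k))"
      using q0 by (subst sum.insert | simp)+
    finally have e: "([:a:] + u) ^ q = [:a:] ^ q + u ^ q +
       (\<Sum>k=1..<q. of_nat (q choose k) * [:a:] ^ k * u ^ (q - k))" .
    obtain s where "(\<Sum>k=1..<q. of_nat (q choose k) * [:a:] ^ k * u ^ (q - k)) = of_nat q * s"
      using d by (rule dvdE)
    then show ?thesis unfolding e by (intro exI[of _ s]) (simp add: of_nat_poly)
  qed
  then obtain s where s: "([:a:] + u) ^ q = [:a:] ^ q + u ^ q + smult (int q) s" by blast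
  have "[a ^ q = a] (mod int q)" using fermat_int[OF assms] .
  then have "int q dvd a - a ^ q" by (metis cong_iff_dvd_diff cong_sym)
  then obtain c where "a - a ^ q = int q * c" by (rule dvdE)
  then have c: "a = a ^ q + int q * c" by linarith
  have c': "[:a:] = [:a:] ^ q + smult (int q) [:c:]"
  proof -
    have "[:a:] = [:a ^ q + int q * c:]" using c by (rule arg_cong)
    also have "\<dots> = [:a:] ^ q + smult (int q) [:c:]" by (simp add: poly_const_pow)
    finally show ?thesis .
  qed
  have uq: "u ^ q = monom 1 q * f ^ q" by (simp only: u_def power_mult_distrib monom_altdef smult_1_left)
  have regroup: "(b + x) + (v + y) = (b + v + w) + (x + y - w)" for b x v y w :: "int poly" by simp
  have "pCons a f \<circ>\<^sub>p monom 1 q = [:a:] + monom 1 q * (f \<circ>\<^sub>p monom 1 q)"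
    by (simp add: pcompose_pCons)
  also have "\<dots> = [:a:] + (u ^ q + smult (int q) (monom 1 q * r))"
    by (simp only: r uq distrib_left mult_smult_right)
  also have "\<dots> = ([:a:] ^ q + smult (int q) [:c:]) + (u ^ q + smult (int q) (monom 1 q * r))"
    by (simp only: c'[symmetric])
  also have "\<dots> = ([:a:] + u) ^ q + smult (int q) ([:c:] + monom 1 q * r - s)"
    unfolding s smult_add_right smult_diff_right by (rule regroup)
  also have "\<dots> = pCons a f ^ q + smult (int q) ([:c:] + monom 1 q * r - s)" by (simp add: u_def)
  finally show ?case by (intro exI)
qed

text \<open>The last assumption identifies \<open>\<mu>\<close> as the minimal polynomial of \<open>\<zeta>\<close> over the integers.\<close>

locale root_of_unity_min_poly =
  fixes e :: nat and \<zeta> :: complex and \<mu> :: "int poly"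
  assumes e_pos: "e > 0"
    and primitive: "primitive_root_of_unity e \<zeta>"
    and monic: "monic \<mu>"
    and degree_pos: "degree \<mu> > 0"
    and root_iff_dvd: "eval_int_poly f \<zeta> = 0 \<longleftrightarrow> \<mu> dvd f"
begin

lemma min_poly_dvd: "\<mu> dvd monom 1 e - 1"
  using primitive by (simp add: root_iff_dvd[symmetric] primitive_root_of_unity_def poly_monom)

lemma min_poly_dvd_imp_root:
  "\<mu> dvd f \<Longrightarrow> eval_int_poly \<mu> x = 0 \<Longrightarrow> eval_int_poly f (x::'a::comm_ring_1) = 0"
  by (auto elim!: dvdE)

lemma eval_quotient: "eval_int_poly (\<Sum>i<n. monom 1 (d * i)) (x::'a::comm_ring_1) = (\<Sum>i<n. (x ^ d) ^ i)"
  by (simp add: of_int_poly_hom.hom_sum poly_hom.hom_sum power_mult poly_monom of_int_hom.map_poly_hom_monom)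

text \<open>For a proper divisor \<open>d\<close> of \<open>e\<close> the polynomial \<open>(X\<^sup>e - 1)/(X\<^sup>d - 1)\<close> vanishes at \<open>\<zeta>\<close>, since \<open>\<zeta>\<^sup>d \<noteq> 1\<close>. At a point with
\<open>x\<^sup>d = 1\<close> its value is \<open>e/d\<close>; this is how roots of \<open>\<mu>\<close> in other rings are seen to be primitive.\<close>

lemma min_poly_dvd_quotient:
  assumes "0 < d" "d < e" "d dvd e"
  shows "\<mu> dvd (\<Sum>i<e div d. monom 1 (d * i))"
proof -
  have "\<zeta> ^ d \<noteq> 1" using primitive assms by (auto simp: primitive_root_of_unity_def)
  moreover have "(\<zeta> ^ d) ^ (e div d) = 1"
    using primitive assms by (simp add: primitive_root_of_unity_def flip: power_mult)
  ultimately have "(\<Sum>i<e div d. (\<zeta> ^ d) ^ i) = 0" by (simp add: geometric_sum)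
  then show ?thesis unfolding root_iff_dvd[symmetric] eval_quotient .
qed

lemma root_power_ne_one:
  fixes x :: "'a::comm_ring_1"
  assumes "eval_int_poly \<mu> x = 0" "0 < d" "d < e" "d dvd e" "of_nat e \<noteq> (0::'a)"
  shows "x ^ d \<noteq> 1"
proof
  assume "x ^ d = 1"
  have "(\<Sum>i<e div d. (x ^ d) ^ i) = 0"
    using min_poly_dvd_imp_root[OF min_poly_dvd_quotient assms(1)] assms unfolding eval_quotient by simp
  then have "of_nat (e div d) = (0::'a)" using \<open>x ^ d = 1\<close> by simp
  moreover have "of_nat e = of_nat (e div d) * (of_nat d :: 'a)"
    using assms(4) by (metis dvd_div_mult_self of_nat_mult)
  ultimately show False using assms(5) by simp
qed

text \<open>A prime divisor \<open>p\<close> of \<open>\<mu>(a)\<close> makes \<open>a\<close> a root of \<open>\<mu>\<close> modulo \<open>p\<close>. If \<open>a\<close> is a multiple of \<open>e N!\<close>, then \<open>p\<close> divides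
neither \<open>e\<close> nor \<open>N!\<close>, because \<open>\<mu>(0)\<close> divides \<open>-1\<close>; so the root is primitive, and the order \<open>e\<close> of \<open>a\<close>
modulo \<open>p\<close> divides \<open>p - 1\<close>.\<close>

lemma exists_prime_cong_1: "\<exists>p>N. prime p \<and> e dvd p - 1"
proof -
  define M where "M = int e * fact N"
  have "M > 0" using e_pos by (simp add: M_def)
  \<comment> \<open>a multiple \<open>a\<close> of \<open>M\<close> at which \<open>\<mu>\<close> is neither zero nor a unit\<close>
  have "finite {x. poly (\<mu> - [:c:]) x = 0}" for c
    using degree_pos by (intro poly_roots_finite) auto
  then have "finite (\<Union>c\<in>{-1,0,1}. {x. poly (\<mu> - [:c:]) x = 0})" by blast
  moreover have "infinite (range (\<lambda>t. M * int t))"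
    using \<open>M > 0\<close> by (intro range_inj_infinite) (auto simp: inj_def)
  ultimately obtain t where t: "M * int t \<notin> (\<Union>c\<in>{-1,0,1}. {x. poly (\<mu> - [:c:]) x = 0})"
    by (metis finite_subset image_subsetI)
  define a where "a = e * fact N * t"
  have a: "int a = M * int t" by (simp add: a_def M_def)
  have "\<bar>poly \<mu> (int a)\<bar> \<noteq> 1" "poly \<mu> (int a) \<noteq> 0" using t unfolding a by auto
  then have "nat \<bar>poly \<mu> (int a)\<bar> \<noteq> 1" by linarith
  then obtain p where p: "prime p" "p dvd nat \<bar>poly \<mu> (int a)\<bar>" using prime_factor_nat by blast
  then have pd: "int p dvd poly \<mu> (int a)" by (metis dvd_nat_abs_iff)
  have "poly \<mu> 0 dvd poly (monom 1 e - 1) 0" using min_poly_dvd by (metis dvd_def poly_mult)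
  then have unit: "poly \<mu> 0 dvd 1" using e_pos by (simp add: poly_monom zero_power)
  have "\<not> p dvd a"
  proof
    assume "p dvd a"
    have "int a dvd poly \<mu> (int a) - poly \<mu> 0" by (cases \<mu>) simp
    then have "int p dvd poly \<mu> (int a) - poly \<mu> 0" using \<open>p dvd a\<close> by (simp add: dvd_trans[of "int p" "int a"])
    then have "int p dvd poly \<mu> 0" using pd by (simp add: dvd_diff_right_iff)
    then have "int p dvd 1" using unit dvd_trans by blast
    then show False using p(1) by simp
  qed
  then have "\<not> p dvd e" "\<not> p dvd fact N" by (auto simp: a_def)
  then have "p > N" using p(1) by (metis not_le prime_dvd_fact_iff)
  have dvd_eval: "int p dvd poly f (int a)" if "\<mu> dvd f" for f
    using that pd by (auto elim!: dvdE)
  have "int p dvd int a ^ e - 1" using dvd_eval[OF min_poly_dvd] by (simp add: poly_monom)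
  then have "[a ^ e = 1] (mod p)" by (metis cong_iff_dvd_diff cong_int_iff of_nat_1 of_nat_power)
  define d where "d = ord p a"
  have "d dvd e" using \<open>[a ^ e = 1] (mod p)\<close> by (simp only: d_def ord_divides)
  then have "d > 0" using e_pos by (metis dvd_0_left gr0I)
  have "d = e"
  proof (rule ccontr)
    assume "d \<noteq> e"
    with \<open>d dvd e\<close> e_pos have "d < e" by (simp add: dvd_imp_le le_neq_implies_less)
    from dvd_eval[OF min_poly_dvd_quotient[OF \<open>d > 0\<close> this \<open>d dvd e\<close>]]
    have "int p dvd (\<Sum>i<e div d. int (a ^ d) ^ i)" by (simp add: poly_sum poly_monom power_mult)
    moreover have "[int (a ^ d) = 1] (mod int p)" using ord[of a p] unfolding d_def by (metis cong_int_iff of_nat_1)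
    then have "[(\<Sum>i<e div d. int (a ^ d) ^ i) = (\<Sum>i<e div d. 1 ^ i)] (mod int p)"
      by (intro cong_sum cong_pow)
    ultimately have "int p dvd int (e div d)" by (simp add: cong_dvd_iff)
    then have "p dvd e div d" by (simp only: int_dvd_int_iff)
    then show False using \<open>\<not> p dvd e\<close> \<open>d dvd e\<close> by (metis dvd_div_mult_self dvd_mult2)
  qed
  moreover have "d dvd p - 1"
    using fermat_theorem[OF p(1) \<open>\<not> p dvd a\<close>] by (simp only: d_def ord_divides)
  ultimately show ?thesis using \<open>p > N\<close> p(1) by blast
qed

text \<open>Write \<open>X\<^sup>e - 1 = \<mu> h\<close>. If \<open>\<mu>(\<zeta>\<^sup>q) \<noteq> 0\<close>, then \<open>h(\<zeta>\<^sup>q) = 0\<close>, and the derivative at \<open>\<zeta>\<^sup>q\<close> shows that \<open>\<mu>(\<zeta>\<^sup>q)\<close> divides \<open>e\<close>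
up to a unit. But \<open>\<mu>(\<zeta>\<^sup>q)\<close> is \<open>q\<close> times an element of the ring generated by \<open>\<zeta>\<close>, by the Frobenius congruence
and \<open>\<mu>(\<zeta>) = 0\<close>. Hence \<open>q\<close> divides \<open>e\<close>.\<close>

lemma conjugate_root_prime:
  assumes q: "prime q" "\<not> q dvd e"
  shows "eval_int_poly \<mu> (\<zeta> ^ q) = 0"
proof (rule ccontr)
  assume nz: "eval_int_poly \<mu> (\<zeta> ^ q) \<noteq> 0"
  have \<zeta>e: "\<zeta> ^ e = 1" using primitive by (simp add: primitive_root_of_unity_def)
  obtain h where h: "monom 1 e - 1 = \<mu> * h" using min_poly_dvd by (rule dvdE)
  have "eval_int_poly (\<mu> * h) (\<zeta> ^ q) = 0"
    unfolding h[symmetric] using \<zeta>e by (simp add: power_mult[symmetric] mult.commute[of q] power_mult[of \<zeta> e])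
  then have hz: "eval_int_poly h (\<zeta> ^ q) = 0" using nz by simp
  have "pderiv (monom 1 e - 1) = \<mu> * pderiv h + h * pderiv \<mu>" unfolding h by (rule pderiv_mult)
  then have "eval_int_poly (pderiv (monom 1 e - 1)) (\<zeta> ^ q) =
     eval_int_poly \<mu> (\<zeta> ^ q) * eval_int_poly (pderiv h) (\<zeta> ^ q)" using hz by simp
  then have D: "of_nat e * (\<zeta> ^ q) ^ (e - 1) = eval_int_poly \<mu> (\<zeta> ^ q) * eval_int_poly (pderiv h) (\<zeta> ^ q)"
    by (simp add: pderiv_monom pderiv_diff)
  obtain r where r: "\<mu> \<circ>\<^sub>p monom 1 q = \<mu> ^ q + smult (int q) r" using frobenius_int_poly[OF q(1)] by blast
  have "eval_int_poly (\<mu> \<circ>\<^sub>p monom 1 q) \<zeta> = of_nat q * eval_int_poly r \<zeta>"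
    unfolding r using root_iff_dvd[of \<mu>] prime_gt_0_nat[OF q(1)] by simp
  then have \<mu>q: "eval_int_poly \<mu> (\<zeta> ^ q) = of_nat q * eval_int_poly r \<zeta>" by simp
  \<comment> \<open>the factor \<open>X\<^sup>q\<close> turns \<open>(\<zeta>\<^sup>q)\<^bsup>e - 1\<^esup>\<close> into \<open>1\<close>\<close>
  define t where "t = r * (pderiv h \<circ>\<^sub>p monom 1 q) * monom 1 q"
  have "of_nat e = of_nat e * ((\<zeta> ^ q) ^ (e - 1) * \<zeta> ^ q)"
    using \<zeta>e e_pos by (metis mult.right_neutral power_commutes power_minus_mult power_mult power_one mult.commute)
  also have "\<dots> = of_nat q * eval_int_poly t \<zeta>"
    unfolding mult.assoc[symmetric] D \<mu>q by (simp add: t_def)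
  finally have "eval_int_poly (smult (int q) t - [:int e:]) \<zeta> = 0" by simp
  then have "int q dvd int e" unfolding root_iff_dvd by (rule dvd_int_if_const_multiple_of_monic[OF monic degree_pos])
  then show False using q(2) by simp
qed

end

lemma monic_unity_poly:
  assumes "e > 0"
  shows "degree (monom 1 e - 1 :: int poly) = e" "lead_coeff (monom 1 e - 1 :: int poly) = 1"
proof -
  show deg: "degree (monom 1 e - 1 :: int poly) = e"
    using assms by (simp only: diff_conv_add_uminus, subst degree_add_eq_left) (auto simp: degree_monom_eq)
  show "lead_coeff (monom 1 e - 1 :: int poly) = 1"
    unfolding deg using assms by (simp add: coeff_eq_0)
qed

lemma root_of_unity_min_poly_exists:
  assumes "e > 0" "primitive_root_of_unity e \<zeta>"
  obtains \<mu> where "root_of_unity_min_poly e \<zeta> \<mu>"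
proof -
  have "monic (monom 1 e - 1 :: int poly)" using monic_unity_poly[OF assms(1)] by simp
  moreover have "eval_int_poly (monom 1 e - 1) \<zeta> = 0"
    using assms by (simp add: primitive_root_of_unity_def)
  ultimately obtain \<mu> :: "int poly" where "monic \<mu>" "degree \<mu> > 0"
    "\<And>f. eval_int_poly f \<zeta> = 0 \<longleftrightarrow> \<mu> dvd f" by (rule monic_minimal_int_poly) (rule that)
  with assms show thesis by (intro that root_of_unity_min_poly.intro) auto
qed

lemma primitive_root_power_eq_one_iff:
  fixes \<zeta> :: "'a::monoid_mult"
  assumes "primitive_root_of_unity e \<zeta>" "e > 0"
  shows "\<zeta> ^ n = 1 \<longleftrightarrow> e dvd n"
proof
  have \<zeta>e: "\<zeta> ^ e = 1" and min: "\<And>k. 0 < k \<Longrightarrow> k < e \<Longrightarrow> \<zeta> ^ k \<noteq> 1"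
    using assms(1) by (auto simp: primitive_root_of_unity_def)
  have "\<zeta> ^ n = \<zeta> ^ (e * (n div e) + n mod e)" by simp
  also have "\<dots> = \<zeta> ^ (n mod e)" unfolding power_add power_mult using \<zeta>e by simp
  finally have mod: "\<zeta> ^ n = \<zeta> ^ (n mod e)" .
  assume "\<zeta> ^ n = 1"
  then show "e dvd n" using mod min[of "n mod e"] assms(2) by (auto simp: dvd_eq_mod_eq_0)
next
  assume "e dvd n"
  then show "\<zeta> ^ n = 1" using assms by (auto simp: primitive_root_of_unity_def power_mult elim!: dvdE)
qed

lemma primitive_root_power_inj:
  fixes \<zeta> :: "'a::field"
  assumes "primitive_root_of_unity e \<zeta>" "e > 0"
  shows "inj_on (\<lambda>i. \<zeta> ^ i) {..<e}"
proof (rule linorder_inj_onI')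
  fix i j assume ij: "i \<in> {..<e}" "j \<in> {..<e}" "i < j"
  have "\<zeta> \<noteq> 0" using assms by (auto simp: primitive_root_of_unity_def zero_power)
  then have "\<zeta> ^ j = \<zeta> ^ i * \<zeta> ^ (j - i)" using ij by (simp flip: power_add)
  moreover have "\<zeta> ^ (j - i) \<noteq> 1" using ij assms by (auto simp: primitive_root_of_unity_def)
  ultimately show "\<zeta> ^ i \<noteq> \<zeta> ^ j" using \<open>\<zeta> \<noteq> 0\<close> by simp
qed

lemma primitive_root_power:
  fixes \<zeta> :: "'a::idom"
  assumes "primitive_root_of_unity e \<zeta>" "coprime j e" "e > 0"
  shows "primitive_root_of_unity e (\<zeta> ^ j)"
proof -
  have "e dvd j * n \<longleftrightarrow> e dvd n" for n
    using assms(2) by (simp add: coprime_commute coprime_dvd_mult_right_iff)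
  then show ?thesis
    using assms primitive_root_power_eq_one_iff[OF assms(1,3)]
    unfolding primitive_root_of_unity_def power_mult[symmetric] by (auto dest: dvd_imp_le)
qed

text \<open>The statement for primes is applied to one prime factor of \<open>j\<close> at a time; the root of unity has to
vary in the induction, since it changes from \<open>\<zeta>\<close> to \<open>\<zeta>\<^sup>q\<close>.\<close>

lemma conjugate_root:
  fixes \<zeta> :: complex
  assumes "e > 0" "primitive_root_of_unity e \<zeta>" "coprime j e" "eval_int_poly f \<zeta> = 0"
  shows "eval_int_poly f (\<zeta> ^ j) = 0"
  using assms(2-)
proof (induction j arbitrary: \<zeta> rule: less_induct)
  case (less j)
  show ?case
  proof (cases "j \<le> 1")
    case True
    have "\<zeta> ^ j = \<zeta>"
    proof (cases "j = 0")
      case True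
      with less.prems have "e = 1" by simp
      then show ?thesis using less.prems True by (simp add: primitive_root_of_unity_def)
    next
      case False
      with True have "j = 1" by simp
      then show ?thesis by simp
    qed
    then show ?thesis using less.prems by simp
  next
    case False
    then obtain q where q: "prime q" "q dvd j" using prime_factor_nat[of j] by auto
    then obtain i where i: "j = q * i" by (auto elim: dvdE)
    have cop: "coprime q e" "coprime i e" using less.prems(2) by (simp_all add: i)
    obtain \<mu> where "root_of_unity_min_poly e \<zeta> \<mu>"
      using root_of_unity_min_poly_exists[OF assms(1) less.prems(1)] .
    then interpret root_of_unity_min_poly e \<zeta> \<mu> .
    have "\<not> q dvd e" using q(1) cop(1) prime_nat_iff
      by (metis coprime_absorb_left not_prime_unit)
    then have "eval_int_poly f (\<zeta> ^ q) = 0"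
      using conjugate_root_prime[OF q(1)] less.prems(3) min_poly_dvd_imp_root root_iff_dvd by blast
    moreover have "i < j" using i False q(1) prime_gt_1_nat[of q] by (cases "i = 0") auto
    ultimately have "eval_int_poly f ((\<zeta> ^ q) ^ i) = 0"
      using less.IH[of i "\<zeta> ^ q"] primitive_root_power[OF less.prems(1) cop(1) assms(1)] cop(2) by blast
    then show ?thesis by (simp add: i power_mult)
  qed
qed

text \<open>This makes the reduction map well defined. The polynomial \<open>\<mu>\<close> has a root \<open>z\<^sub>0\<close> among the powers of \<open>z\<close>,
because its cofactor in \<open>X\<^sup>e - 1\<close> has too few roots to take all of them. Then \<open>z = z\<^sub>0\<^sup>j\<close> with \<open>j\<close> prime to
\<open>e\<close>, and \<open>\<mu>\<close> divides \<open>f(X\<^sup>j)\<close>.\<close>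

lemma eval_int_poly_reduction:
  fixes z :: "'k::field"
  assumes e: "e > 0" and \<zeta>: "primitive_root_of_unity e \<zeta>" and z: "primitive_root_of_unity e z"
    and ne: "of_nat e \<noteq> (0::'k)" and f: "eval_int_poly f \<zeta> = (0::complex)"
  shows "eval_int_poly f z = 0"
proof -
  obtain \<mu> where "root_of_unity_min_poly e \<zeta> \<mu>"
    using root_of_unity_min_poly_exists[OF e \<zeta>] .
  then interpret root_of_unity_min_poly e \<zeta> \<mu> .
  obtain h where h: "monom 1 e - 1 = \<mu> * h" using min_poly_dvd by (rule dvdE)
  have ze: "z ^ e = 1" using z by (simp add: primitive_root_of_unity_def)
  have deg: "degree (monom 1 e - 1 :: int poly) = e" and "monic (monom 1 e - 1 :: int poly)"
    using monic_unity_poly[OF e] by auto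
  then have "lead_coeff \<mu> * lead_coeff h = 1" unfolding h lead_coeff_mult by simp
  then have "monic h" using monic by simp
  then have "h \<noteq> 0" by auto
  then have degh: "degree h < e" using deg degree_pos monic unfolding h
    by (subst (asm) degree_mult_eq) auto
  define H where "H = (map_poly of_int h :: 'k poly)"
  have "H \<noteq> 0" using \<open>monic h\<close> by (metis H_def coeff_0 of_int_1 of_int_hom.coeff_map_poly_hom zero_neq_one)
  have "degree H \<le> degree h" by (simp add: H_def degree_map_poly_le)
  have "card {x. poly H x = 0} < e" using poly_roots_degree[OF \<open>H \<noteq> 0\<close>] \<open>degree H \<le> degree h\<close> degh by linarith
  moreover have "card ((\<lambda>i. z ^ i) ` {..<e}) = e"
    using card_image[OF primitive_root_power_inj[OF z e]] by simp
  ultimately have "\<not> (\<lambda>i. z ^ i) ` {..<e} \<subseteq> {x. poly H x = 0}"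
    using poly_roots_finite[OF \<open>H \<noteq> 0\<close>] by (metis card_mono not_le)
  then obtain i where i: "poly H (z ^ i) \<noteq> 0" by auto
  \<comment> \<open>the root of the minimal polynomial among the powers of \<open>z\<close>\<close>
  define z0 where "z0 = z ^ i"
  have "eval_int_poly (\<mu> * h) z0 = 0"
    unfolding h[symmetric] z0_def using ze by (simp add: power_mult[symmetric] mult.commute[of i] power_mult[of z e])
  then have z0: "eval_int_poly \<mu> z0 = 0" using i by (simp add: H_def z0_def)
  have "coprime i e"
  proof (rule ccontr)
    assume nc: "\<not> coprime i e"
    define g where "g = gcd i e"
    have g: "g dvd e" "g dvd i" "g > 0" "g \<noteq> 1" using e nc by (auto simp: g_def coprime_iff_gcd_eq_1)
    define d where "d = e div g"
    have "d dvd e" "0 < d" using g e by (auto simp: d_def dvd_div_eq_0_iff)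
    moreover have "d < e" using g e by (auto simp: d_def)
    ultimately have "z0 ^ d \<noteq> 1" using root_power_ne_one[OF z0 _ _ _ ne] by blast
    moreover have "i * d = e * (i div g)" using g unfolding d_def by (simp add: div_mult_swap dvd_div_mult mult.commute)
    then have "z0 ^ d = 1" using ze unfolding z0_def power_mult[symmetric] by (simp add: power_mult)
    ultimately show False by blast
  qed
  then obtain j where j: "[i * j = 1] (mod e)" using cong_solve_coprime_nat by auto
  have "coprime (i * j) e" using cong_imp_coprime[OF cong_sym[OF j]] by simp
  then have "coprime j e" by simp
  have "z0 ^ j = z"
  proof (cases "e = 1")
    case True
    then show ?thesis using ze by (simp add: z0_def)
  next
    case False
    then have "i * j mod e = 1" using j e by (simp add: cong_def)
    then have "i * j = e * (i * j div e) + 1" by (metis mult_div_mod_eq)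
    then have "z ^ (i * j) = z ^ (e * (i * j div e) + 1)" by (rule arg_cong)
    also have "\<dots> = z" using ze by (simp add: power_add power_mult)
    finally show ?thesis unfolding z0_def power_mult[symmetric] .
  qed
  have "eval_int_poly (f \<circ>\<^sub>p monom 1 j) \<zeta> = 0" using conjugate_root[OF e \<zeta> \<open>coprime j e\<close> f] by simp
  then have "\<mu> dvd f \<circ>\<^sub>p monom 1 j" by (simp only: root_iff_dvd)
  from min_poly_dvd_imp_root[OF this z0] show ?thesis using \<open>z0 ^ j = z\<close> by simp
qed

text \<open>A suitable power of a primitive root modulo \<open>p\<close>.\<close>

lemma prime_cong_1_has_element_of_order:
  fixes p :: nat
  assumes p: "prime p" and e: "e dvd p - 1"
  shows "\<exists>x::int. [x ^ e = 1] (mod int p) \<and> (\<forall>n. 0 < n \<and> n < e \<longrightarrow> \<not> [x ^ n = 1] (mod int p))"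
proof -
  obtain a where a: "ord p a = p - 1" using residue_prime_has_primroot[OF p] by blast
  define l where "l = (p - 1) div e"
  have el: "e * l = p - 1" using e by (simp add: l_def)
  have p1: "p - 1 > 0" using prime_gt_1_nat[OF p] by simp
  then have "l > 0" using el by (intro Nat.gr0I) auto
  have iff: "[(int a ^ l) ^ n = 1] (mod int p) \<longleftrightarrow> e dvd n" for n
  proof -
    have "[(int a ^ l) ^ n = 1] (mod int p) \<longleftrightarrow> [a ^ (l * n) = 1] (mod p)"
      unfolding power_mult[symmetric] by (metis cong_int_iff of_nat_1 of_nat_power)
    also have "\<dots> \<longleftrightarrow> l * e dvd l * n" using el by (simp only: ord_divides a mult.commute[of l e])
    finally show ?thesis using \<open>l > 0\<close> by simp
  qed
  show ?thesis by (rule exI[of _ "int a ^ l"]) (use iff in \<open>auto dest: dvd_imp_le\<close>)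
qed

lemma power_power_eq_one: "x ^ e = 1 \<Longrightarrow> (x ^ i) ^ e = (1 :: 'a::monoid_mult)"
  by (metis mult.commute power_mult power_one)

lemma root_of_unity_is_power:
  fixes \<zeta> :: "'a::field"
  assumes "primitive_root_of_unity e \<zeta>" "e > 0" "x ^ e = 1"
  obtains k where "k < e" "x = \<zeta> ^ k"
proof -
  define P where "P = (monom 1 e - 1 :: 'a poly)"
  have c: "poly.coeff P e = 1" using assms(2) by (simp add: P_def coeff_eq_0)
  then have P0: "P \<noteq> 0" by auto
  have "degree P \<le> e" unfolding P_def by (intro degree_diff_le) (auto simp: degree_monom_le)
  have fin: "finite {y. poly P y = 0}" using P0 by (rule poly_roots_finite)
  have "card {y. poly P y = 0} \<le> e" using poly_roots_degree[OF P0] \<open>degree P \<le> e\<close> by simp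
  moreover have "(\<lambda>i. \<zeta> ^ i) ` {..<e} \<subseteq> {y. poly P y = 0}"
    using power_power_eq_one[of \<zeta> e] assms(1) by (auto simp: P_def primitive_root_of_unity_def)
  moreover have "card ((\<lambda>i. \<zeta> ^ i) ` {..<e}) = e"
    using card_image[OF primitive_root_power_inj[OF assms(1,2)]] by simp
  ultimately have "(\<lambda>i. \<zeta> ^ i) ` {..<e} = {y. poly P y = 0}" by (intro card_seteq[OF fin]) auto
  moreover have "x \<in> {y. poly P y = 0}" using assms(3) by (simp add: P_def)
  ultimately have "x \<in> (\<lambda>i. \<zeta> ^ i) ` {..<e}" by (simp only:)
  then obtain k where "k < e" "x = \<zeta> ^ k" by auto
  then show thesis by (rule that)
qed

lemma int_adjoin_closed:
  shows "x \<in> int_adjoin \<zeta> \<Longrightarrow> y \<in> int_adjoin \<zeta> \<Longrightarrow> x + y \<in> int_adjoin \<zeta>"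
    and "x \<in> int_adjoin \<zeta> \<Longrightarrow> y \<in> int_adjoin \<zeta> \<Longrightarrow> x * y \<in> int_adjoin \<zeta>"
    and int_adjoin_of_int: "of_int c \<in> int_adjoin \<zeta>"
    and int_adjoin_root: "\<zeta> \<in> int_adjoin \<zeta>"
proof -
  show "of_int c \<in> int_adjoin \<zeta>" unfolding int_adjoin_def by (rule range_eqI[of _ _ "[:c:]"]) simp
  show "\<zeta> \<in> int_adjoin \<zeta>" unfolding int_adjoin_def by (rule range_eqI[of _ _ "[:0,1:]"]) simp
  assume "x \<in> int_adjoin \<zeta>" "y \<in> int_adjoin \<zeta>"
  then obtain f g where "x = eval_int_poly f \<zeta>" "y = eval_int_poly g \<zeta>" by (auto simp: int_adjoin_def)
  then show "x + y \<in> int_adjoin \<zeta>" "x * y \<in> int_adjoin \<zeta>"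
    unfolding int_adjoin_def
    by - (rule range_eqI[of _ _ "f + g"], simp, rule range_eqI[of _ _ "f * g"], simp)
qed

lemma int_adjoin_simps [simp]:
  "0 \<in> int_adjoin \<zeta>" "1 \<in> int_adjoin \<zeta>" "of_nat n \<in> int_adjoin \<zeta>"
  using int_adjoin_of_int[of 0] int_adjoin_of_int[of 1] int_adjoin_of_int[of "int n"] by simp_all

lemma int_adjoin_power: "x \<in> int_adjoin \<zeta> \<Longrightarrow> x ^ n \<in> int_adjoin \<zeta>"
  by (induction n) (auto intro: int_adjoin_closed)

lemma int_adjoin_sum: "(\<And>i. i \<in> S \<Longrightarrow> F i \<in> int_adjoin \<zeta>) \<Longrightarrow> sum F S \<in> int_adjoin \<zeta>"
  by (induction S rule: infinite_finite_induct) (auto intro: int_adjoin_closed)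

section \<open>Subspaces as images of injective matrices\<close>

text \<open>A subspace of dimension \<open>k\<close> is represented by an \<open>n \<times> k\<close> matrix with trivial kernel whose image it is.
Restricting operators to an invariant subspace then is solving a matrix equation.\<close>

definition injective_mat :: "nat \<Rightarrow> nat \<Rightarrow> 'a::field mat \<Rightarrow> bool" where
  "injective_mat n k B \<longleftrightarrow> B \<in> carrier_mat n k \<and> (\<forall>x\<in>carrier_vec k. B *\<^sub>v x = 0\<^sub>v n \<longrightarrow> x = 0\<^sub>v k)"

lemma injective_mat_carrier: "injective_mat n k B \<Longrightarrow> B \<in> carrier_mat n k"
  by (simp add: injective_mat_def)

lemma wide_mat_kernel:
  fixes A :: "'a::field mat"
  assumes A: "A \<in> carrier_mat n m" and "n < m"
  obtains x where "x \<in> carrier_vec m" "x \<noteq> 0\<^sub>v m" "A *\<^sub>v x = 0\<^sub>v n"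
proof -
  define A' where "A' = mat m m (\<lambda>(i,j). if i < n then A $$ (i,j) else 0)"
  have A': "A' \<in> carrier_mat m m" by (simp add: A'_def)
  have "det A' = 0" unfolding laplace_expansion_row[OF A' assms(2)]
    using assms(2) by (intro sum.neutral) (auto simp: A'_def)
  then obtain x where x: "x \<in> carrier_vec m" "x \<noteq> 0\<^sub>v m" "A' *\<^sub>v x = 0\<^sub>v m"
    using det_0_iff_vec_prod_zero_field[OF A'] by auto
  have "A *\<^sub>v x = 0\<^sub>v n"
  proof (rule eq_vecI)
    fix i assume i: "i < dim_vec (0\<^sub>v n)"
    have "row A i = row A' i" using i assms by (intro eq_vecI) (auto simp: A'_def)
    moreover have "(A' *\<^sub>v x) $ i = 0" using x(3) i assms(2) by simp
    ultimately show "(A *\<^sub>v x) $ i = 0\<^sub>v n $ i" using i A A' assms(2) by simp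
  qed (use A in auto)
  with x that show thesis by blast
qed

lemma injective_mat_le: "injective_mat n k B \<Longrightarrow> k \<le> n"
proof (rule ccontr)
  assume inj: "injective_mat n k B" and "\<not> k \<le> n"
  then obtain x where "x \<in> carrier_vec k" "x \<noteq> 0\<^sub>v k" "B *\<^sub>v x = 0\<^sub>v n"
    using wide_mat_kernel[OF injective_mat_carrier[OF inj]] by auto
  then show False using inj by (auto simp: injective_mat_def)
qed

lemma injective_mat_eq:
  assumes "injective_mat n k B" "x \<in> carrier_vec k" "y \<in> carrier_vec k" "B *\<^sub>v x = B *\<^sub>v y"
  shows "x = y"
proof -
  have B: "B \<in> carrier_mat n k" using assms(1) by (rule injective_mat_carrier)
  have "B *\<^sub>v (x - y) = 0\<^sub>v n" using B assms(2-4) by (simp add: mult_minus_distrib_mat_vec)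
  then have "x - y = 0\<^sub>v k" using assms by (simp add: injective_mat_def)
  show ?thesis
  proof (rule eq_vecI)
    fix i assume "i < dim_vec y"
    then have "i < k" using assms(3) by simp
    then have "(x - y) $ i = 0" using \<open>x - y = 0\<^sub>v k\<close> by simp
    then show "x $ i = y $ i" using \<open>i < k\<close> assms(2,3) by simp
  qed (use assms in auto)
qed

lemma injective_square_surj:
  assumes B: "injective_mat n n B" and y: "y \<in> carrier_vec n"
  obtains x where "x \<in> carrier_vec n" "B *\<^sub>v x = y"
proof -
  have Bc: "B \<in> carrier_mat n n" using B by (rule injective_mat_carrier)
  have "det B \<noteq> 0" using B det_0_iff_vec_prod_zero_field[OF Bc] by (auto simp: injective_mat_def)
  from det_non_zero_imp_unit[OF Bc this, of "()"]
  obtain C where C: "C \<in> carrier_mat n n" "B * C = 1\<^sub>m n" by (auto simp: Units_def ring_mat_def)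
  have "B *\<^sub>v (C *\<^sub>v y) = y" using assoc_mult_mat_vec[OF Bc C(1) y] C(2) y by simp
  with C y show thesis by (intro that[of "C *\<^sub>v y"]) auto
qed

definition closed_subspace :: "nat \<Rightarrow> 'a::field vec set \<Rightarrow> bool" where
  "closed_subspace n W \<longleftrightarrow> W \<subseteq> carrier_vec n \<and> 0\<^sub>v n \<in> W \<and>
    (\<forall>v\<in>W. \<forall>w\<in>W. v + w \<in> W) \<and> (\<forall>c. \<forall>v\<in>W. c \<cdot>\<^sub>v v \<in> W)"

lemma closed_subspace_iff:
  "VectorSpace.subspace class_ring W (module_vec TYPE('a::field) n) \<longleftrightarrow> closed_subspace n (W :: 'a vec set)"
  unfolding VectorSpace.subspace_def submodule_def closed_subspace_def
  using vec_vs[where ?'a='a] vec_module[where ?'a='a] by (auto simp: module_vec_simps)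

lemma closed_subspace_image:
  "B \<in> carrier_mat n k \<Longrightarrow> closed_subspace k V \<Longrightarrow> closed_subspace n ((\<lambda>x. B *\<^sub>v x) ` V)"
  unfolding closed_subspace_def
  by (auto simp: image_iff mult_mat_vec[symmetric, of B n k] subset_iff
      intro!: bexI mult_mat_vec_carrier[of B n k] mult_add_distrib_mat_vec[symmetric, of B n k])

lemma closed_subspace_carrier: "closed_subspace k (carrier_vec k)"
  by (auto simp: closed_subspace_def)

lemma closed_subspace_kernel:
  "B \<in> carrier_mat n k \<Longrightarrow> closed_subspace k {x \<in> carrier_vec k. B *\<^sub>v x = 0\<^sub>v n}"
  unfolding closed_subspace_def
  by (auto simp: mult_add_distrib_mat_vec[of B n k] mult_mat_vec[of B n k])

text \<open>Take an injective matrix with columns in \<open>W\<close> and as many columns as possible. If some \<open>w\<close> in \<open>W\<close>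
were not in its image, \<open>w\<close> could be appended as one more column.\<close>

lemma subspace_obtain_mat:
  fixes W :: "'a::field vec set"
  assumes W: "closed_subspace n W"
  obtains k B where "injective_mat n k B" "W = (\<lambda>x. B *\<^sub>v x) ` carrier_vec k"
proof -
  define P where "P = (\<lambda>k. \<exists>B. injective_mat n k B \<and> (\<lambda>x. B *\<^sub>v x) ` carrier_vec k \<subseteq> W)"
  have "P 0"
  proof -
    have "0\<^sub>m n 0 *\<^sub>v x = (0\<^sub>v n :: 'a vec)" if "x \<in> carrier_vec 0" for x
      using that by (intro eq_vecI) (auto simp: scalar_prod_def)
    then show ?thesis using W unfolding P_def injective_mat_def closed_subspace_def
      by (intro exI[of _ "0\<^sub>m n 0"]) auto
  qed
  moreover have bnd: "k \<le> n" if "P k" for k using that injective_mat_le by (auto simp: P_def)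
  define k where "k = Greatest P"
  have Pk: "P k" and max: "\<And>j. P j \<Longrightarrow> j \<le> k"
    using GreatestI_nat[of P 0 n] Greatest_le_nat[of P _ n] \<open>P 0\<close> bnd unfolding k_def by auto
  obtain B where B: "injective_mat n k B" and BW: "(\<lambda>x. B *\<^sub>v x) ` carrier_vec k \<subseteq> W"
    using Pk by (auto simp: P_def)
  have Bc: "B \<in> carrier_mat n k" using B by (rule injective_mat_carrier)
  have "w \<in> (\<lambda>x. B *\<^sub>v x) ` carrier_vec k" if w: "w \<in> W" for w
  proof (rule ccontr)
    assume nw: "w \<notin> (\<lambda>x. B *\<^sub>v x) ` carrier_vec k"
    have wn: "w \<in> carrier_vec n" using W w by (auto simp: closed_subspace_def)
    define B' where "B' = mat n (Suc k) (\<lambda>(i,j). if j < k then B $$ (i,j) else w $ i)"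
    define tr where "tr = (\<lambda>x :: 'a vec. vec k (\<lambda>j. x $ j))"
    have tr: "tr x \<in> carrier_vec k" for x by (simp add: tr_def)
    have B'x: "B' *\<^sub>v x = B *\<^sub>v tr x + (x $ k) \<cdot>\<^sub>v w" if "x \<in> carrier_vec (Suc k)" for x
      using that Bc wn
      by (intro eq_vecI) (auto simp: B'_def tr_def scalar_prod_def mult.commute intro!: sum.cong)
    have "injective_mat n (Suc k) B'"
      unfolding injective_mat_def
    proof (intro conjI ballI impI)
      show "B' \<in> carrier_mat n (Suc k)" by (simp add: B'_def)
    next
      fix x assume x: "x \<in> carrier_vec (Suc k)" and "B' *\<^sub>v x = 0\<^sub>v n"
      then have eq: "B *\<^sub>v tr x + (x $ k) \<cdot>\<^sub>v w = 0\<^sub>v n" using B'x by simp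
      have Bt: "B *\<^sub>v tr x \<in> carrier_vec n" using Bc tr by simp
      have xk: "x $ k = 0"
      proof (rule ccontr)
        assume nz: "x $ k \<noteq> 0"
        have "w = B *\<^sub>v ((- 1 / x $ k) \<cdot>\<^sub>v tr x)"
        proof (rule eq_vecI)
          fix i assume "i < dim_vec (B *\<^sub>v ((- 1 / x $ k) \<cdot>\<^sub>v tr x))"
          then have i: "i < n" using Bc by simp
          have "(B *\<^sub>v tr x + (x $ k) \<cdot>\<^sub>v w) $ i = 0" using eq i by simp
          then have "(B *\<^sub>v tr x) $ i + x $ k * w $ i = 0" using i Bc wn by simp
          then have "w $ i = (- 1 / x $ k) * (B *\<^sub>v tr x) $ i" using nz by (simp add: field_simps add_eq_0_iff2)
          then show "w $ i = (B *\<^sub>v ((- 1 / x $ k) \<cdot>\<^sub>v tr x)) $ i"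
            unfolding mult_mat_vec[OF Bc tr] using i Bc by simp
        qed (use wn Bc in auto)
        then show False using nw tr by auto
      qed
      moreover have "0 \<cdot>\<^sub>v w = 0\<^sub>v n" using wn by (intro eq_vecI) auto
      ultimately have "B *\<^sub>v tr x = 0\<^sub>v n" using eq Bt wn by simp
      then have "tr x = 0\<^sub>v k" using B tr by (auto simp: injective_mat_def)
      then have "x $ j = 0" if "j < k" for j using that by (metis index_vec index_zero_vec(1) tr_def)
      with xk show "x = 0\<^sub>v (Suc k)" using x by (intro eq_vecI) (auto simp: less_Suc_eq)
    qed
    moreover have "(\<lambda>x. B' *\<^sub>v x) ` carrier_vec (Suc k) \<subseteq> W"
    proof
      fix y assume "y \<in> (\<lambda>x. B' *\<^sub>v x) ` carrier_vec (Suc k)"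
      then obtain x where "x \<in> carrier_vec (Suc k)" "y = B' *\<^sub>v x" by auto
      then have "y = B *\<^sub>v tr x + (x $ k) \<cdot>\<^sub>v w" using B'x by simp
      moreover have "B *\<^sub>v tr x \<in> W" using BW tr by auto
      ultimately show "y \<in> W" using W w by (auto simp: closed_subspace_def)
    qed
    ultimately have "P (Suc k)" by (auto simp: P_def)
    then show False using max by fastforce
  qed
  with BW B show thesis by (intro that[of k B]) auto
qed

lemma mat_col_equation:
  assumes A: "A \<in> carrier_mat n k" and B: "B \<in> carrier_mat n m"
    and "\<And>j. j < m \<Longrightarrow> col B j \<in> (\<lambda>x. A *\<^sub>v x) ` carrier_vec k"
  obtains U where "U \<in> carrier_mat k m" "A * U = B"
proof -
  have "\<forall>j. \<exists>x. j < m \<longrightarrow> x \<in> carrier_vec k \<and> A *\<^sub>v x = col B j"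
    using assms(3) by force
  then obtain x where x: "\<And>j. j < m \<Longrightarrow> x j \<in> carrier_vec k \<and> A *\<^sub>v x j = col B j" by metis
  define U where "U = mat k m (\<lambda>(i,j). x j $ i)"
  have U: "U \<in> carrier_mat k m" by (simp add: U_def)
  have c: "col U j = x j" if "j < m" for j using x[OF that] that by (intro eq_vecI) (auto simp: U_def)
  have "A * U = B"
  proof (rule mat_col_eqI)
    fix j assume "j < dim_col B"
    then have "j < m" using B by simp
    then show "col (A * U) j = col B j" using x c A U by (subst col_mult2[OF A U]) auto
  qed (use A B U in auto)
  with U show thesis by (rule that)
qed

lemma mat_eq_if_mult_vec_eq:
  fixes A :: "'a::semiring_1 mat"
  assumes "A \<in> carrier_mat n k" "B \<in> carrier_mat n k" "\<And>x. x \<in> carrier_vec k \<Longrightarrow> A *\<^sub>v x = B *\<^sub>v x"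
  shows "A = B"
proof (rule mat_col_eqI)
  fix j assume "j < dim_col B"
  then have j: "j < k" using assms by simp
  have c: "M *\<^sub>v unit_vec k j = col M j" if "M \<in> carrier_mat n k" for M :: "'a mat"
    using that j by (intro eq_vecI) auto
  have "A *\<^sub>v unit_vec k j = B *\<^sub>v unit_vec k j" using assms(3) by simp
  then show "col A j = col B j" using c assms(1,2) by simp
qed (use assms in auto)

lemma injective_mat_cancel:
  assumes "injective_mat n k B" "U \<in> carrier_mat k m" "V \<in> carrier_mat k m" "B * U = B * V"
  shows "U = V"
proof (rule mat_eq_if_mult_vec_eq[OF assms(2,3)])
  fix x :: "'a vec" assume x: "x \<in> carrier_vec m"
  have B: "B \<in> carrier_mat n k" using assms(1) by (rule injective_mat_carrier)
  have "B *\<^sub>v (U *\<^sub>v x) = B *\<^sub>v (V *\<^sub>v x)"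
    using assoc_mult_mat_vec[OF B assms(2) x] assoc_mult_mat_vec[OF B assms(3) x] assms(4) by simp
  then show "U *\<^sub>v x = V *\<^sub>v x" using injective_mat_eq[OF assms(1)] assms x by auto
qed

lemma injective_mat_mult:
  assumes "injective_mat n k B" "injective_mat k m C"
  shows "injective_mat n m (B * C)"
proof -
  have c: "B \<in> carrier_mat n k" "C \<in> carrier_mat k m" using assms by (auto intro: injective_mat_carrier)
  then show ?thesis using assms unfolding injective_mat_def by (auto simp: assoc_mult_mat_vec[OF c])
qed

lemma smult_mat_smult [simp]: "a \<cdot>\<^sub>m (b \<cdot>\<^sub>m A) = (a * b :: 'a::semigroup_mult) \<cdot>\<^sub>m A"
  by (rule eq_matI) (auto simp: mult.assoc)

lemma smult_mat_one [simp]: "(1 :: 'a::monoid_mult) \<cdot>\<^sub>m A = A"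
  by (rule eq_matI) auto

lemma smult_mat_mult_vec:
  fixes A :: "'a::comm_semiring_0 mat"
  shows "A \<in> carrier_mat n k \<Longrightarrow> x \<in> carrier_vec k \<Longrightarrow> (c \<cdot>\<^sub>m A) *\<^sub>v x = c \<cdot>\<^sub>v (A *\<^sub>v x)"
  by (rule eq_vecI) auto

lemma mult_mat_zero_vec [simp]:
  fixes A :: "'a::semiring_0 mat"
  shows "A \<in> carrier_mat n k \<Longrightarrow> A *\<^sub>v 0\<^sub>v k = 0\<^sub>v n"
  by (rule eq_vecI) auto

lemma closed_subspace_eigenspace:
  fixes T :: "'a::field mat"
  assumes "T \<in> carrier_mat n n"
  shows "closed_subspace n {v \<in> carrier_vec n. T *\<^sub>v v = c \<cdot>\<^sub>v v}"
  using assms unfolding closed_subspace_def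
  by (auto simp: mult_add_distrib_mat_vec[of T n n] mult_mat_vec[of T n n] smult_add_distrib_vec[of _ n]
      smult_smult_assoc mult.commute)

text \<open>The matrix \<open>U\<close> describes the restriction of \<open>M\<close> to the invariant image of \<open>B\<close>.\<close>

lemma invariant_image_factor:
  fixes B :: "'a::field mat"
  assumes B: "B \<in> carrier_mat n k" and M: "M \<in> carrier_mat n n"
    and inv: "\<And>v. v \<in> (\<lambda>x. B *\<^sub>v x) ` carrier_vec k \<Longrightarrow> M *\<^sub>v v \<in> (\<lambda>x. B *\<^sub>v x) ` carrier_vec k"
  obtains U where "U \<in> carrier_mat k k" "M * B = B * U"
proof -
  have MB: "M * B \<in> carrier_mat n k" using M B by simp
  have "col (M * B) j \<in> (\<lambda>x. B *\<^sub>v x) ` carrier_vec k" if "j < k" for j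
  proof -
    have "B *\<^sub>v unit_vec k j = col B j" using B that by (intro eq_vecI) auto
    then have "col B j \<in> (\<lambda>x. B *\<^sub>v x) ` carrier_vec k" by (metis image_eqI unit_vec_carrier)
    then show ?thesis using inv that by (simp add: col_mult2[OF M B])
  qed
  then obtain U where "U \<in> carrier_mat k k" "B * U = M * B" using mat_col_equation[OF B MB] by blast
  then show thesis using that by simp
qed

section \<open>Traces, eigenvalues and sums of matrices\<close>

lemma mat_trace_comm:
  fixes A :: "'a::comm_semiring_0 mat"
  assumes "A \<in> carrier_mat n m" "B \<in> carrier_mat m n"
  shows "mat_trace (A * B) = mat_trace (B * A)"
proof -
  have "mat_trace (A * B) = (\<Sum>i<n. \<Sum>j<m. A $$ (i,j) * B $$ (j,i))"
    using assms by (auto simp: mat_trace_def scalar_prod_def atLeast0LessThan intro!: sum.cong)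
  also have "\<dots> = (\<Sum>j<m. \<Sum>i<n. B $$ (j,i) * A $$ (i,j))"
    by (subst sum.swap) (simp add: mult.commute)
  also have "\<dots> = mat_trace (B * A)"
    using assms by (auto simp: mat_trace_def scalar_prod_def atLeast0LessThan intro!: sum.cong)
  finally show ?thesis .
qed

lemma mat_trace_smult: "mat_trace (c \<cdot>\<^sub>m A) = (c::'a::comm_semiring_0) * mat_trace A"
  if "A \<in> carrier_mat n n"
  using that by (simp add: mat_trace_def sum_distrib_left)

lemma mat_trace_one: "mat_trace (1\<^sub>m n) = (of_nat n :: 'a::semiring_1)"
  by (simp add: mat_trace_def)

lemma mat_trace_conj:
  fixes P :: "'a::comm_semiring_1 mat"
  assumes "P \<in> carrier_mat n n" "A \<in> carrier_mat n n" "Q \<in> carrier_mat n n" "Q * P = 1\<^sub>m n"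
  shows "mat_trace (P * A * Q) = mat_trace A"
proof -
  have "mat_trace (P * (A * Q)) = mat_trace ((A * Q) * P)" using assms by (intro mat_trace_comm[of _ n n]) auto
  also have "(A * Q) * P = A" using assms by (simp add: assoc_mult_mat[of A n n Q n P n])
  finally show ?thesis using assms by (simp add: assoc_mult_mat[of P n n A n Q n])
qed

lemma smult_one_pow: "(c \<cdot>\<^sub>m 1\<^sub>m n) ^\<^sub>m k = (c ^ k :: 'a::comm_semiring_1) \<cdot>\<^sub>m 1\<^sub>m n"
proof (induction k)
  case (Suc k)
  then show ?case by (simp add: mult_smult_assoc_mat[of _ n n _ n] mult_smult_distrib[of _ n n _ n] mult.commute)
qed simp

lemma pow_mat_mult:
  fixes A :: "'a::semiring_1 mat"
  assumes A: "A \<in> carrier_mat n n"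
  shows "A ^\<^sub>m (k * l) = (A ^\<^sub>m k) ^\<^sub>m l"
proof -
  have add: "A ^\<^sub>m (a + b) = A ^\<^sub>m a * A ^\<^sub>m b" for a b
    using A by (induction b) (auto simp: assoc_mult_mat[of _ n n _ n _ n])
  show ?thesis
  proof (induction l)
    case (Suc l)
    have "A ^\<^sub>m (k * Suc l) = A ^\<^sub>m (k * l + k)" by (simp add: add.commute)
    also have "\<dots> = A ^\<^sub>m (k * l) * A ^\<^sub>m k" by (rule add)
    finally show ?case using Suc A by simp
  qed (use A in auto)
qed

lemma upper_triangular_mult:
  fixes A B :: "'a::semiring_0 mat"
  assumes "A \<in> carrier_mat n n" "B \<in> carrier_mat n n" "upper_triangular A" "upper_triangular B"
  shows "upper_triangular (A * B)" "i < n \<Longrightarrow> (A * B) $$ (i,i) = A $$ (i,i) * B $$ (i,i)"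
proof -
  have z: "A $$ (i,k) * B $$ (k,j) = 0" if "i < n" "k < n" "j < n" "k \<noteq> i" "j \<le> i" for i j k
  proof (cases "k < i")
    case True
    then have "A $$ (i,k) = 0" using assms that by auto
    then show ?thesis by simp
  next
    case False
    then have "B $$ (k,j) = 0" using assms that by auto
    then show ?thesis by simp
  qed
  have e: "(A * B) $$ (i,j) = A $$ (i,i) * B $$ (i,j)" if "i < n" "j < n" "j \<le> i" for i j
  proof -
    have "(A * B) $$ (i,j) = (\<Sum>k<n. A $$ (i,k) * B $$ (k,j))"
      using assms that by (simp add: scalar_prod_def atLeast0LessThan)
    also have "\<dots> = (\<Sum>k\<in>{i}. A $$ (i,k) * B $$ (k,j))"
      using that z[of i _ j] by (intro sum.mono_neutral_right) auto
    finally show ?thesis by simp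
  qed
  show "upper_triangular (A * B)"
    using assms e by (intro upper_triangularI) (auto simp: upper_triangular_def)
  show "i < n \<Longrightarrow> (A * B) $$ (i,i) = A $$ (i,i) * B $$ (i,i)" using e by simp
qed

lemma upper_triangular_pow:
  fixes A :: "'a::comm_semiring_1 mat"
  assumes "A \<in> carrier_mat n n" "upper_triangular A"
  shows "upper_triangular (A ^\<^sub>m k) \<and> (\<forall>i<n. (A ^\<^sub>m k) $$ (i,i) = (A $$ (i,i)) ^ k)"
proof (induction k)
  case (Suc k)
  have "A ^\<^sub>m k \<in> carrier_mat n n" using assms by simp
  then show ?case using Suc upper_triangular_mult[OF _ assms(1) _ assms(2)] by (simp add: mult.commute)
qed (use assms in auto)

text \<open>By triangularisation: the diagonal of a power of a triangular matrix consists of the powers.\<close>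

lemma trace_pow_eigenvalues:
  fixes A :: "complex mat"
  assumes A: "A \<in> carrier_mat n n"
  obtains as where "length as = n" "char_poly A = (\<Prod>a\<leftarrow>as. [:- a, 1:])"
    "\<And>k. mat_trace (A ^\<^sub>m k) = (\<Sum>a\<leftarrow>as. a ^ k)"
proof -
  obtain es where "char_poly A = (\<Prod>a\<leftarrow>es. [:- a, 1:])" using char_poly_factorized[OF A] by blast
  from schur_decomposition_exists[OF A this] obtain B where
    B: "B \<in> carrier_mat n n" "upper_triangular B" "similar_mat A B" by blast
  obtain P Q where wit: "similar_mat_wit A B P Q" using B(3) by (auto simp: similar_mat_def)
  note w = similar_mat_witD2[OF A wit]
  have "char_poly A = (\<Prod>a\<leftarrow>diag_mat B. [:- a, 1:])"
    using char_poly_similar[OF B(3)] char_poly_upper_triangular[OF B(1,2)] by simp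
  moreover have "length (diag_mat B) = n" using B by (simp add: diag_mat_def)
  moreover have "mat_trace (A ^\<^sub>m k) = (\<Sum>a\<leftarrow>diag_mat B. a ^ k)" for k
  proof -
    have "mat_trace (A ^\<^sub>m k) = mat_trace (B ^\<^sub>m k)"
      unfolding similar_mat_wit_pow_id[OF wit] using w B by (intro mat_trace_conj) auto
    also have "\<dots> = (\<Sum>i<n. (B $$ (i,i)) ^ k)"
      using upper_triangular_pow[OF B(1,2), of k] B(1) by (simp add: mat_trace_def)
    also have "\<dots> = (\<Sum>a\<leftarrow>diag_mat B. a ^ k)"
      using B(1) by (simp add: diag_mat_def comp_def interv_sum_list_conv_sum_set_nat atLeast0LessThan)
    finally show ?thesis .
  qed
  ultimately show thesis by (intro that) auto
qed

lemma order_prod_linear: "Polynomial.order x (\<Prod>a\<leftarrow>as. [:- a, 1:]) = count_list as (x::'a::field)"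
proof (induction as)
  case (Cons a as)
  have "(\<Prod>a\<leftarrow>a # as. [:- a, 1:]) \<noteq> (0 :: 'a poly)" by (auto simp: prod_list_zero_iff simp del: mult_pCons_left)
  then have "[:- a, 1:] * (\<Prod>a\<leftarrow>as. [:- a, 1:]) \<noteq> 0" by simp
  from order_mult[OF this] show ?case using Cons by (simp add: order_linear' del: mult_pCons_left)
qed simp

lemma eigenvalue_iff_in_list:
  fixes A :: "'a::field mat"
  assumes "A \<in> carrier_mat n n" "char_poly A = (\<Prod>a\<leftarrow>as. [:- a, 1:])"
  shows "eigenvalue A x \<longleftrightarrow> x \<in> set as"
  unfolding eigenvalue_root_char_poly[OF assms(1)] assms(2) by (auto simp: poly_prod_list prod_list_zero_iff comp_def)

lemma exists_eigenvalue:
  fixes A :: "complex mat"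
  assumes "A \<in> carrier_mat n n" "n > 0"
  obtains x where "eigenvalue A x"
proof -
  obtain as where "length as = n" "char_poly A = (\<Prod>a\<leftarrow>as. [:- a, 1:])"
    using trace_pow_eigenvalues[OF assms(1)] by blast
  then have "eigenvalue A (hd as)" using eigenvalue_iff_in_list[OF assms(1)] assms(2) by auto
  then show thesis by (rule that)
qed

lemma nonzero_trace_imp_nonzero_eigenvalue:
  fixes A :: "complex mat"
  assumes "A \<in> carrier_mat n n" "mat_trace A \<noteq> 0"
  obtains x where "eigenvalue A x" "x \<noteq> 0"
proof -
  obtain as where as: "char_poly A = (\<Prod>a\<leftarrow>as. [:- a, 1:])" "\<And>k. mat_trace (A ^\<^sub>m k) = (\<Sum>a\<leftarrow>as. a ^ k)"
    using trace_pow_eigenvalues[OF assms(1)] by blast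
  have "mat_trace A = sum_list as" using as(2)[of 1] assms(1) by simp
  moreover have "sum_list as = 0" if "\<forall>a\<in>set as. a = 0" using that by (induction as) auto
  ultimately obtain a where "a \<in> set as" "a \<noteq> 0" using assms(2) by auto
  then show thesis using that[of a] eigenvalue_iff_in_list[OF assms(1) as(1)] by simp
qed

lemma eigenvalue_pow_eq_one:
  fixes A :: "'a::field mat"
  assumes A: "A \<in> carrier_mat n n" and "eigenvalue A x" and "A ^\<^sub>m k = 1\<^sub>m n"
  shows "x ^ k = 1"
proof -
  obtain v where v: "eigenvector A v x" using assms(2) by (auto simp: eigenvalue_def)
  then have vc: "v \<in> carrier_vec n" "v \<noteq> 0\<^sub>v n" using A by (auto simp: eigenvector_def)
  have "A ^\<^sub>m k *\<^sub>v v = x ^ k \<cdot>\<^sub>v v" using eigenvector_pow[OF A v] .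
  then have "v = x ^ k \<cdot>\<^sub>v v" using assms(3) vc by simp
  moreover obtain i where "i < n" "v $ i \<noteq> 0" using vc by (metis carrier_vecD eq_vecI index_zero_vec)
  ultimately have "v $ i = x ^ k * v $ i" using vc by (metis carrier_vecD index_smult_vec(1))
  then show ?thesis using \<open>v $ i \<noteq> 0\<close> by simp
qed

lemma sum_list_eq_sum_count:
  fixes F :: "'a \<Rightarrow> 'b::comm_semiring_1"
  assumes "finite S" "set as \<subseteq> S"
  shows "(\<Sum>a\<leftarrow>as. F a) = (\<Sum>a\<in>S. of_nat (count_list as a) * F a)"
  using assms(2)
proof (induction as)
  case (Cons b as)
  have "(\<Sum>a\<in>S. of_nat (count_list (b # as) a) * F a) = (\<Sum>a\<in>S. (if a = b then F b else 0) + of_nat (count_list as a) * F a)"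
    by (intro sum.cong) (auto simp: algebra_simps)
  also have "\<dots> = F b + (\<Sum>a\<in>S. of_nat (count_list as a) * F a)"
    using assms(1) Cons.prems by (simp add: sum.distrib sum.delta)
  finally show ?case using Cons by simp
qed simp

text \<open>Sums of matrices of a fixed shape over an arbitrary index set; the shape is a parameter so that the
empty sum has the right dimensions.\<close>

definition mat_sum :: "nat \<Rightarrow> nat \<Rightarrow> ('i \<Rightarrow> 'a::comm_monoid_add mat) \<Rightarrow> 'i set \<Rightarrow> 'a mat" where
  "mat_sum n m f S = mat n m (\<lambda>ij. \<Sum>s\<in>S. f s $$ ij)"

lemma mat_sum_carrier [simp]: "mat_sum n m f S \<in> carrier_mat n m"
  by (simp add: mat_sum_def)

lemma mat_sum_dim [simp]: "dim_row (mat_sum n m f S) = n" "dim_col (mat_sum n m f S) = m"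
  by (simp_all add: mat_sum_def)

lemma mat_sum_mult_left:
  fixes A :: "'a::comm_semiring_0 mat"
  assumes "A \<in> carrier_mat k n" "\<And>s. s \<in> S \<Longrightarrow> f s \<in> carrier_mat n m"
  shows "A * mat_sum n m f S = mat_sum k m (\<lambda>s. A * f s) S"
proof (rule eq_matI)
  fix i j assume "i < dim_row (mat_sum k m (\<lambda>s. A * f s) S)" "j < dim_col (mat_sum k m (\<lambda>s. A * f s) S)"
  then have ij: "i < k" "j < m" by auto
  have "(A * mat_sum n m f S) $$ (i,j) = (\<Sum>l<n. \<Sum>s\<in>S. A $$ (i,l) * f s $$ (l,j))"
    using assms(1) ij by (simp add: scalar_prod_def mat_sum_def sum_distrib_left atLeast0LessThan)
  also have "\<dots> = (\<Sum>s\<in>S. \<Sum>l<n. A $$ (i,l) * f s $$ (l,j))" by (rule sum.swap)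
  also have "\<dots> = (\<Sum>s\<in>S. (A * f s) $$ (i,j))"
    using assms(1) carrier_matD[OF assms(2)] ij by (intro sum.cong) (auto simp: scalar_prod_def atLeast0LessThan)
  finally show "(A * mat_sum n m f S) $$ (i,j) = mat_sum k m (\<lambda>s. A * f s) S $$ (i,j)"
    using ij by (simp add: mat_sum_def)
qed (use assms in auto)

lemma mat_sum_mult_right:
  fixes A :: "'a::comm_semiring_0 mat"
  assumes "A \<in> carrier_mat m k" "\<And>s. s \<in> S \<Longrightarrow> f s \<in> carrier_mat n m"
  shows "mat_sum n m f S * A = mat_sum n k (\<lambda>s. f s * A) S"
proof (rule eq_matI)
  fix i j assume "i < dim_row (mat_sum n k (\<lambda>s. f s * A) S)" "j < dim_col (mat_sum n k (\<lambda>s. f s * A) S)"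
  then have ij: "i < n" "j < k" by auto
  have "(mat_sum n m f S * A) $$ (i,j) = (\<Sum>l<m. \<Sum>s\<in>S. f s $$ (i,l) * A $$ (l,j))"
    using assms(1) ij by (simp add: scalar_prod_def mat_sum_def sum_distrib_right atLeast0LessThan)
  also have "\<dots> = (\<Sum>s\<in>S. \<Sum>l<m. f s $$ (i,l) * A $$ (l,j))" by (rule sum.swap)
  also have "\<dots> = (\<Sum>s\<in>S. (f s * A) $$ (i,j))"
    using assms(1) carrier_matD[OF assms(2)] ij by (intro sum.cong) (auto simp: scalar_prod_def atLeast0LessThan)
  finally show "(mat_sum n m f S * A) $$ (i,j) = mat_sum n k (\<lambda>s. f s * A) S $$ (i,j)"
    using ij by (simp add: mat_sum_def)
qed (use assms in auto)

lemma mat_sum_cong: "(\<And>s. s \<in> S \<Longrightarrow> f s = g s) \<Longrightarrow> mat_sum n m f S = mat_sum n m g S"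
  by (simp add: mat_sum_def)

lemma mat_sum_reindex: "bij_betw r S T \<Longrightarrow> mat_sum n m f T = mat_sum n m (\<lambda>s. f (r s)) S"
  unfolding mat_sum_def by (intro cong_mat refl) (rule sum.reindex_bij_betw[symmetric])

lemma trace_mat_sum:
  assumes "\<And>s. s \<in> S \<Longrightarrow> f s \<in> carrier_mat n n"
  shows "mat_trace (mat_sum n n f S) = (\<Sum>s\<in>S. mat_trace (f s))"
proof -
  have "mat_trace (mat_sum n n f S) = (\<Sum>i<n. \<Sum>s\<in>S. f s $$ (i,i))" by (simp add: mat_trace_def mat_sum_def)
  also have "\<dots> = (\<Sum>s\<in>S. \<Sum>i<n. f s $$ (i,i))" by (rule sum.swap)
  also have "\<dots> = (\<Sum>s\<in>S. mat_trace (f s))"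
    using carrier_matD[OF assms] by (intro sum.cong) (auto simp: mat_trace_def)
  finally show ?thesis .
qed

section \<open>Projective representations and Schur's lemma\<close>

locale twisted_group = group G for G :: "('g, 'more) monoid_scheme" (structure) +
  fixes \<alpha> :: "'g \<Rightarrow> 'g \<Rightarrow> complex"
  assumes finite_carrier [simp]: "finite (carrier G)"
    and unitary: "unitary_multiplier G \<alpha>"
begin

lemma alpha_nonzero [simp]: "x \<in> carrier G \<Longrightarrow> y \<in> carrier G \<Longrightarrow> \<alpha> x y \<noteq> 0"
  using unitary by (simp add: unitary_multiplier_def multiplier_def)

lemma cocycle:
  "x \<in> carrier G \<Longrightarrow> y \<in> carrier G \<Longrightarrow> z \<in> carrier G \<Longrightarrow> \<alpha> x y * \<alpha> (x \<otimes> y) z = \<alpha> x (y \<otimes> z) * \<alpha> y z"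
  using unitary by (simp add: unitary_multiplier_def multiplier_def)

lemma alpha_one [simp]: "x \<in> carrier G \<Longrightarrow> \<alpha> x \<one> = 1" "x \<in> carrier G \<Longrightarrow> \<alpha> \<one> x = 1"
  using unitary by (simp_all add: unitary_multiplier_def multiplier_def)

lemma alpha_inv_comm: "g \<in> carrier G \<Longrightarrow> \<alpha> (inv g) g = \<alpha> g (inv g)"
  using cocycle[of g "inv g" g] by simp

lemma inv_cancel:
  assumes "x \<in> carrier G" "y \<in> carrier G"
  shows "x \<otimes> (inv x \<otimes> y) = y" "inv x \<otimes> (x \<otimes> y) = y"
  using assms by (simp_all flip: m_assoc)

lemma beta_nonzero [simp]: "h \<in> carrier G \<Longrightarrow> g \<in> carrier G \<Longrightarrow> beta G \<alpha> h g \<noteq> 0"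
  by (simp add: beta_def)

end

locale projective_rep = twisted_group G \<alpha>
  for G :: "('g, 'more) monoid_scheme" (structure) and \<alpha> +
  fixes d :: nat and \<pi> :: "'g \<Rightarrow> complex mat"
  assumes rep: "proj_rep G \<alpha> d \<pi>"
begin

abbreviation \<chi> :: "'g \<Rightarrow> complex" where "\<chi> g \<equiv> mat_trace (\<pi> g)"

text \<open>The inverse of \<open>\<pi>(g)\<close>, expressed through \<open>\<pi>\<close> itself. Its trace takes the place of the complex
conjugate of the character in the orthogonality relations, so that these only involve numbers in the
ring generated by the roots of unity.\<close>

definition \<pi>_inv :: "'g \<Rightarrow> complex mat" where "\<pi>_inv g = (1 / \<alpha> g (inv g)) \<cdot>\<^sub>m \<pi> (inv g)"

lemma rep_carrier [simp]: "g \<in> carrier G \<Longrightarrow> \<pi> g \<in> carrier_mat d d"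
  using rep by (simp add: proj_rep_def)

lemma rep_dim [simp]: "g \<in> carrier G \<Longrightarrow> dim_row (\<pi> g) = d" "g \<in> carrier G \<Longrightarrow> dim_col (\<pi> g) = d"
  using carrier_matD[OF rep_carrier] by auto

lemma rep_mult: "x \<in> carrier G \<Longrightarrow> y \<in> carrier G \<Longrightarrow> \<pi> x * \<pi> y = \<alpha> x y \<cdot>\<^sub>m \<pi> (x \<otimes> y)"
  using rep by (simp add: proj_rep_def)

text \<open>The inner dimension of a product cannot be inferred by rewriting, so it is fixed to \<open>d\<close> here.\<close>

lemmas square_simps = mult_smult_distrib[of _ d d _ d] mult_smult_assoc_mat[of _ d d _ d] mult_carrier_mat[of _ d d _ d]
lemmas square_vec_simps = assoc_mult_mat_vec[of _ d d _ d] mult_mat_vec_carrier[of _ d d]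
lemmas square_assoc_simps = square_simps assoc_mult_mat[of _ d d _ d _ d]

lemma rep_one: "\<pi> \<one> = 1\<^sub>m d"
proof -
  obtain B where B: "\<pi> \<one> * B = 1\<^sub>m d" "B * \<pi> \<one> = 1\<^sub>m (dim_row B)"
    using rep by (force simp: proj_rep_def invertible_mat_def inverts_mat_def)
  have "dim_col B = d" using arg_cong[OF B(1), of dim_col] by simp
  moreover have "dim_row B = d" using arg_cong[OF B(2), of dim_col] by simp
  ultimately have Bc: "B \<in> carrier_mat d d" by auto
  have "\<pi> \<one> = \<pi> \<one> * (\<pi> \<one> * B)" using B(1) by simp
  also have "\<dots> = (\<pi> \<one> * \<pi> \<one>) * B" using Bc by (simp add: square_assoc_simps)
  also have "\<pi> \<one> * \<pi> \<one> = \<pi> \<one>" using rep_mult[of \<one> \<one>] by simp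
  finally show ?thesis using B(1) by simp
qed

lemma inv_carrier [simp]: "g \<in> carrier G \<Longrightarrow> \<pi>_inv g \<in> carrier_mat d d"
  by (simp add: \<pi>_inv_def)

lemma inv_dim [simp]: "g \<in> carrier G \<Longrightarrow> dim_row (\<pi>_inv g) = d" "g \<in> carrier G \<Longrightarrow> dim_col (\<pi>_inv g) = d"
  using carrier_matD[OF inv_carrier] by auto

lemma rep_inv [simp]:
  assumes "g \<in> carrier G"
  shows "\<pi> g * \<pi>_inv g = 1\<^sub>m d" "\<pi>_inv g * \<pi> g = 1\<^sub>m d"
  using assms rep_mult[of g "inv g"] rep_mult[of "inv g" g]
  by (simp_all add: \<pi>_inv_def square_simps
      alpha_inv_comm rep_one)

lemma rep_eq_one_cancel:
  assumes "g \<in> carrier G" "A \<in> carrier_mat d k"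
  shows "\<pi> g * (\<pi>_inv g * A) = A" "\<pi>_inv g * (\<pi> g * A) = A"
  using assms by (simp_all flip: assoc_mult_mat[of _ d d _ d _ k])

lemma inv_mult:
  assumes "x \<in> carrier G" "y \<in> carrier G"
  shows "\<pi>_inv y * \<pi>_inv x = (1 / \<alpha> x y) \<cdot>\<^sub>m \<pi>_inv (x \<otimes> y)"
proof -
  have "\<pi> (x \<otimes> y) = (1 / \<alpha> x y) \<cdot>\<^sub>m (\<pi> x * \<pi> y)"
    using assms by (simp add: rep_mult)
  then have "(1 / \<alpha> x y) \<cdot>\<^sub>m (\<pi>_inv (x \<otimes> y) * (\<pi> x * \<pi> y)) = 1\<^sub>m d"
    using rep_inv(2)[of "x \<otimes> y"] assms by (simp add: square_simps)
  then have "(1 / \<alpha> x y) \<cdot>\<^sub>m (\<pi>_inv (x \<otimes> y) * (\<pi> x * \<pi> y)) * (\<pi>_inv y * \<pi>_inv x) = \<pi>_inv y * \<pi>_inv x"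
    using assms by simp
  moreover have "(\<pi> x * \<pi> y) * (\<pi>_inv y * \<pi>_inv x) = 1\<^sub>m d"
    using assms by (simp add: square_assoc_simps rep_eq_one_cancel(1)[of y "\<pi>_inv x" d])
  ultimately show ?thesis
    using assms by (simp add: square_assoc_simps)
qed

text \<open>The numbers \<open>\<beta>\<^sub>h(g)\<close> measure, up to inversion, how far conjugation of matrices deviates from conjugation in the group.\<close>

lemma rep_conj:
  assumes "h \<in> carrier G" "g \<in> carrier G"
  shows "\<pi> h * \<pi> g * \<pi>_inv h = (1 / beta G \<alpha> h g) \<cdot>\<^sub>m \<pi> (h \<otimes> g \<otimes> inv h)"
proof -
  have "\<pi> h * \<pi> g * \<pi>_inv h = (1 / \<alpha> h (inv h)) \<cdot>\<^sub>m (\<pi> h * (\<pi> g * \<pi> (inv h)))"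
    using assms by (simp add: \<pi>_inv_def square_assoc_simps)
  also have "\<pi> h * (\<pi> g * \<pi> (inv h)) = (\<alpha> g (inv h) * \<alpha> h (g \<otimes> inv h)) \<cdot>\<^sub>m \<pi> (h \<otimes> g \<otimes> inv h)"
    using assms by (simp add: rep_mult square_simps m_assoc)
  finally show ?thesis using assms by (simp add: beta_def field_simps)
qed

lemma char_conj:
  assumes "h \<in> carrier G" "g \<in> carrier G"
  shows "\<chi> (h \<otimes> g \<otimes> inv h) = beta G \<alpha> h g * \<chi> g"
proof -
  have "mat_trace (\<pi> h * \<pi> g * \<pi>_inv h) = \<chi> g" using assms by (intro mat_trace_conj) auto
  then show ?thesis using assms by (simp add: rep_conj mat_trace_smult[of _ d] field_simps)
qed

lemma char_inv_conj:
  assumes "h \<in> carrier G" "g \<in> carrier G"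
  shows "mat_trace (\<pi>_inv (h \<otimes> g \<otimes> inv h)) = mat_trace (\<pi>_inv g) / beta G \<alpha> h g"
proof -
  define k where "k = h \<otimes> g \<otimes> inv h"
  have k: "k \<in> carrier G" using assms by (simp add: k_def)
  have "\<pi> k = beta G \<alpha> h g \<cdot>\<^sub>m (\<pi> h * \<pi> g * \<pi>_inv h)"
    using assms by (simp add: rep_conj k_def)
  then have "\<pi>_inv k * (\<pi> h * \<pi> g * \<pi>_inv h) = (1 / beta G \<alpha> h g) \<cdot>\<^sub>m (\<pi>_inv k * \<pi> k)"
    using assms k by (simp add: square_simps del: rep_inv)
  then have 1: "\<pi>_inv k * (\<pi> h * \<pi> g * \<pi>_inv h) = (1 / beta G \<alpha> h g) \<cdot>\<^sub>m 1\<^sub>m d" using k by simp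
  have "(\<pi> h * \<pi> g * \<pi>_inv h) * (\<pi> h * \<pi>_inv g * \<pi>_inv h) = 1\<^sub>m d"
    using assms by (simp add: square_assoc_simps rep_eq_one_cancel[of _ _ d])
  moreover have "\<pi> h * \<pi> g * \<pi>_inv h \<in> carrier_mat d d" "\<pi> h * \<pi>_inv g * \<pi>_inv h \<in> carrier_mat d d"
    using assms by (simp_all add: square_simps)
  ultimately have "\<pi>_inv k = \<pi>_inv k * (\<pi> h * \<pi> g * \<pi>_inv h) * (\<pi> h * \<pi>_inv g * \<pi>_inv h)"
    using right_mult_one_mat[OF inv_carrier[OF k]] assoc_mult_mat[OF inv_carrier[OF k]] by metis
  also have "\<dots> = (1 / beta G \<alpha> h g) \<cdot>\<^sub>m (\<pi> h * \<pi>_inv g * \<pi>_inv h)"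
    unfolding 1 using assms by (simp add: square_simps)
  finally have "mat_trace (\<pi>_inv k) = mat_trace (\<pi> h * \<pi>_inv g * \<pi>_inv h) / beta G \<alpha> h g"
    using assms by (simp add: mat_trace_smult[of _ d] square_simps)
  also have "mat_trace (\<pi> h * \<pi>_inv g * \<pi>_inv h) = mat_trace (\<pi>_inv g)" using assms by (intro mat_trace_conj) auto
  finally show ?thesis by (simp add: k_def)
qed

text \<open>If \<open>h\<close> commutes with \<open>g\<close>, then \<open>\<chi>(g) = \<beta>\<^sub>h(g) \<chi>(g)\<close>, and the factor differs from \<open>1\<close> for some such \<open>h\<close>.\<close>

lemma char_nonregular:
  assumes "g \<in> carrier G" "\<not> regular_element G \<alpha> g"
  shows "\<chi> g = 0"
proof -
  obtain h where h: "h \<in> carrier G" "g \<otimes> h = h \<otimes> g" "beta G \<alpha> h g \<noteq> 1"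
    using assms by (auto simp: regular_element_def)
  then have "h \<otimes> g \<otimes> inv h = g" using assms by (metis m_assoc r_inv r_one inv_closed)
  then have "\<chi> g = beta G \<alpha> h g * \<chi> g" using char_conj[of h g] h assms by simp
  then show ?thesis using h(3) by simp
qed

lemma rep_pow:
  assumes g: "g \<in> carrier G"
  shows "\<pi> g ^\<^sub>m n = (\<Prod>i=1..<n. \<alpha> (g [^] i) g) \<cdot>\<^sub>m \<pi> (g [^] n)"
proof (induction n)
  case 0
  then show ?case using g by (simp add: rep_one)
next
  case (Suc n)
  have "\<pi> g ^\<^sub>m Suc n = ((\<Prod>i=1..<n. \<alpha> (g [^] i) g) * \<alpha> (g [^] n) g) \<cdot>\<^sub>m \<pi> (g [^] Suc n)"
    using g Suc by (simp add: square_simps rep_mult)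
  also have "(\<Prod>i=1..<n. \<alpha> (g [^] i) g) * \<alpha> (g [^] n) g = (\<Prod>i=1..<Suc n. \<alpha> (g [^] i) g)"
    using g by (cases n) auto
  finally show ?case .
qed

text \<open>The image under \<open>\<pi>\<close> of the element of the twisted group algebra with coefficients \<open>f\<close>.\<close>

definition rep_lin :: "('g \<Rightarrow> complex) \<Rightarrow> complex mat" where
  "rep_lin f = mat_sum d d (\<lambda>g. f g \<cdot>\<^sub>m \<pi> g) (carrier G)"

lemma rep_lin_carrier [simp]: "rep_lin f \<in> carrier_mat d d"
  by (simp add: rep_lin_def)

lemma bij_conj: "x \<in> carrier G \<Longrightarrow> bij_betw (\<lambda>g. x \<otimes> g \<otimes> inv x) (carrier G) (carrier G)"
  by (rule bij_betw_byWitness[of _ "\<lambda>g. inv x \<otimes> g \<otimes> x"]) (auto simp: m_assoc inv_cancel)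

text \<open>The hypothesis on \<open>f\<close> is the twisted form of being a class function: it compensates the factors
\<open>\<beta>\<^sub>x(g)\<close> that conjugation introduces.\<close>

lemma rep_lin_central:
  assumes f: "\<And>x g. x \<in> carrier G \<Longrightarrow> g \<in> carrier G \<Longrightarrow> f (x \<otimes> g \<otimes> inv x) = f g / beta G \<alpha> x g"
    and x: "x \<in> carrier G"
  shows "\<pi> x * rep_lin f = rep_lin f * \<pi> x"
proof -
  have "rep_lin f * \<pi> x = mat_sum d d (\<lambda>g. (f g \<cdot>\<^sub>m \<pi> g) * \<pi> x) (carrier G)"
    unfolding rep_lin_def using x by (intro mat_sum_mult_right) auto
  also have "\<dots> = mat_sum d d (\<lambda>g. (f (x \<otimes> g \<otimes> inv x) \<cdot>\<^sub>m \<pi> (x \<otimes> g \<otimes> inv x)) * \<pi> x) (carrier G)"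
    using bij_conj[OF x] by (rule mat_sum_reindex)
  also have "\<dots> = mat_sum d d (\<lambda>g. \<pi> x * (f g \<cdot>\<^sub>m \<pi> g)) (carrier G)"
  proof (rule mat_sum_cong)
    fix g assume g: "g \<in> carrier G"
    have "(f (x \<otimes> g \<otimes> inv x) \<cdot>\<^sub>m \<pi> (x \<otimes> g \<otimes> inv x)) = f g \<cdot>\<^sub>m (\<pi> x * \<pi> g * \<pi>_inv x)"
      using f[OF x g] rep_conj[OF x g] by (simp add:)
    also have "\<dots> * \<pi> x = f g \<cdot>\<^sub>m (\<pi> x * \<pi> g)"
      using x g by (simp add: square_assoc_simps)
    also have "\<dots> = \<pi> x * (f g \<cdot>\<^sub>m \<pi> g)" using x g by (simp add: square_simps)
    finally show "(f (x \<otimes> g \<otimes> inv x) \<cdot>\<^sub>m \<pi> (x \<otimes> g \<otimes> inv x)) * \<pi> x = \<pi> x * (f g \<cdot>\<^sub>m \<pi> g)" .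
  qed
  also have "\<dots> = \<pi> x * rep_lin f"
    unfolding rep_lin_def using x by (intro mat_sum_mult_left[symmetric]) auto
  finally show ?thesis ..
qed

lemma trace_rep_lin: "mat_trace (rep_lin f) = (\<Sum>g\<in>carrier G. f g * \<chi> g)"
  unfolding rep_lin_def by (subst trace_mat_sum) (auto simp: mat_trace_smult[of _ d])

end

locale irreducible_rep = projective_rep G \<alpha> d \<pi>
  for G :: "('g, 'more) monoid_scheme" (structure) and \<alpha> d \<pi> +
  assumes irr: "irreducible_proj_rep G \<alpha> d \<pi>"
begin

lemma dim_pos: "d > 0" using irr by (simp add: irreducible_proj_rep_def)

lemma invariant_trivial:
  assumes "closed_subspace d W" "\<And>g w. g \<in> carrier G \<Longrightarrow> w \<in> W \<Longrightarrow> \<pi> g *\<^sub>v w \<in> W"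
  shows "W = {0\<^sub>v d} \<or> W = carrier_vec d"
  using irr assms by (auto simp: irreducible_proj_rep_def closed_subspace_iff)

text \<open>An eigenspace of \<open>T\<close> is invariant and nonzero, so it is the whole space.\<close>

lemma schur_scalar:
  assumes T: "T \<in> carrier_mat d d" and comm: "\<And>g. g \<in> carrier G \<Longrightarrow> \<pi> g * T = T * \<pi> g"
  obtains c where "T = c \<cdot>\<^sub>m 1\<^sub>m d" "mat_trace T = c * of_nat d"
proof -
  obtain c where "eigenvalue T c" using exists_eigenvalue[OF T dim_pos] .
  then obtain v where v: "eigenvector T v c" by (auto simp: eigenvalue_def)
  define W where "W = {v \<in> carrier_vec d. T *\<^sub>v v = c \<cdot>\<^sub>v v}"
  have memW: "v \<in> W \<longleftrightarrow> v \<in> carrier_vec d \<and> T *\<^sub>v v = c \<cdot>\<^sub>v v" for v by (simp add: W_def)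
  have "closed_subspace d W" unfolding W_def using T by (rule closed_subspace_eigenspace)
  moreover have "\<pi> g *\<^sub>v w \<in> W" if g: "g \<in> carrier G" and w: "w \<in> W" for g w
  proof -
    have wc: "w \<in> carrier_vec d" "T *\<^sub>v w = c \<cdot>\<^sub>v w" using w memW by auto
    have "T *\<^sub>v (\<pi> g *\<^sub>v w) = (T * \<pi> g) *\<^sub>v w" using T g wc by (simp add: square_vec_simps)
    also have "\<dots> = \<pi> g *\<^sub>v (T *\<^sub>v w)" using T g wc by (simp add: square_vec_simps flip: comm)
    also have "\<dots> = c \<cdot>\<^sub>v (\<pi> g *\<^sub>v w)" using g wc by (simp add: mult_mat_vec[of _ d d])
    finally show ?thesis using g wc by (simp add: memW square_vec_simps)
  qed
  ultimately have "W = {0\<^sub>v d} \<or> W = carrier_vec d" by (rule invariant_trivial)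
  moreover have "v \<in> W" "v \<noteq> 0\<^sub>v d" using v T by (auto simp: memW eigenvector_def)
  ultimately have W: "W = carrier_vec d" by auto
  have "T = c \<cdot>\<^sub>m 1\<^sub>m d"
  proof (rule mat_eq_if_mult_vec_eq[OF T])
    fix x :: "complex vec" assume "x \<in> carrier_vec d"
    then show "T *\<^sub>v x = (c \<cdot>\<^sub>m 1\<^sub>m d) *\<^sub>v x" using W memW[of x] by (simp add: smult_mat_mult_vec[of _ d d])
  qed auto
  moreover from this have "mat_trace T = c * of_nat d" by (simp add: mat_trace_smult[of _ d] mat_trace_one)
  ultimately show thesis by (rule that)
qed

end

section \<open>The exponent and the orthogonality relations\<close>

context twisted_group
begin

lemma alpha_power_order: "x \<in> carrier G \<Longrightarrow> y \<in> carrier G \<Longrightarrow> \<alpha> x y ^ multiplier_order G \<alpha> = 1"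
  and multiplier_order_pos: "multiplier_order G \<alpha> > 0"
proof -
  have "\<exists>N. N > 0 \<and> (\<forall>x\<in>carrier G. \<forall>y\<in>carrier G. \<alpha> x y ^ N = 1)"
    using unitary by (auto simp: unitary_multiplier_def)
  from LeastI_ex[OF this] show "x \<in> carrier G \<Longrightarrow> y \<in> carrier G \<Longrightarrow> \<alpha> x y ^ multiplier_order G \<alpha> = 1"
    "multiplier_order G \<alpha> > 0" by (auto simp: multiplier_order_def)
qed

text \<open>The scalar \<open>A\<^sub>g\<close> with \<open>\<pi>(g)\<^sup>n = A\<^sub>g\<close> for \<open>g\<close> of order \<open>n\<close>.\<close>

definition power_scalar :: "'g \<Rightarrow> complex" where
  "power_scalar g = (\<Prod>i=1..<ord g. \<alpha> (g [^] i) g)"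

lemma order_in_multiplier:
  assumes "g \<in> carrier G"
  obtains k where "k > 0" "power_scalar g ^ k = 1" "order_in_multiplier G \<alpha> g = ord g * k"
proof -
  have "power_scalar g ^ multiplier_order G \<alpha> = 1"
    using assms alpha_power_order by (simp add: power_scalar_def prod_power_distrib)
  then have "\<exists>k. k > 0 \<and> power_scalar g ^ k = 1" using multiplier_order_pos by blast
  from LeastI_ex[OF this] show thesis
    by (intro that[of "LEAST k. k > 0 \<and> power_scalar g ^ k = 1"])
      (auto simp: order_in_multiplier_def power_scalar_def Let_def)
qed

lemma order_in_multiplier_pos: "g \<in> carrier G \<Longrightarrow> order_in_multiplier G \<alpha> g > 0"
  using order_in_multiplier[of g] ord_ge_1[of g] by (metis finite_carrier nat_0_less_mult_iff less_eq_Suc_le One_nat_def)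

lemma exponent_pos: "multiplier_exponent G \<alpha> > 0"
proof -
  have "Lcm (order_in_multiplier G \<alpha> ` carrier G) \<noteq> 0"
    using order_in_multiplier_pos by (subst Lcm_0_iff_nat) (auto simp: image_iff)
  then have "multiplier_exponent G \<alpha> \<noteq> 0"
    using multiplier_order_pos unfolding multiplier_exponent_def by (metis lcm_eq_0_iff less_not_refl)
  then show ?thesis by simp
qed

lemma order_in_multiplier_dvd_exponent: "g \<in> carrier G \<Longrightarrow> order_in_multiplier G \<alpha> g dvd multiplier_exponent G \<alpha>"
  by (auto simp: multiplier_exponent_def intro: dvd_lcmI2)

lemma alpha_power_exponent:
  assumes "x \<in> carrier G" "y \<in> carrier G"
  shows "\<alpha> x y ^ multiplier_exponent G \<alpha> = 1"
proof -
  have "multiplier_order G \<alpha> dvd multiplier_exponent G \<alpha>" by (simp add: multiplier_exponent_def)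
  then show ?thesis using alpha_power_order[OF assms] by (auto simp: power_mult elim!: dvdE)
qed

lemma beta_power_exponent:
  "h \<in> carrier G \<Longrightarrow> g \<in> carrier G \<Longrightarrow> beta G \<alpha> h g ^ multiplier_exponent G \<alpha> = 1"
  by (simp add: beta_def power_divide power_mult_distrib alpha_power_exponent)

lemma irreducible_repI: "irreducible_proj_rep G \<alpha> d \<pi> \<Longrightarrow> irreducible_rep G \<alpha> d \<pi>"
  by (intro irreducible_rep.intro irreducible_rep_axioms.intro projective_rep.intro projective_rep_axioms.intro twisted_group_axioms)
    (auto simp: irreducible_proj_rep_def)

text \<open>Kernel and image of a nonzero \<open>S\<close> are invariant, so \<open>S\<close> is injective and surjective. The two-sided
inverse \<open>R\<close> turns equality of traces into commutativity of the trace.\<close>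

lemma schur_intertwiner:
  assumes A: "irreducible_rep G \<alpha> d \<pi>" and B: "irreducible_rep G \<alpha> d' \<pi>'"
    and S: "S \<in> carrier_mat d d'" and S0: "S \<noteq> 0\<^sub>m d d'"
    and intertwine: "\<And>g. g \<in> carrier G \<Longrightarrow> \<pi> g * S = S * \<pi>' g"
    and g: "g \<in> carrier G"
  shows "mat_trace (\<pi> g) = mat_trace (\<pi>' g)"
proof -
  interpret A: irreducible_rep G \<alpha> d \<pi> by fact
  interpret B: irreducible_rep G \<alpha> d' \<pi>' by fact
  have int: "\<pi> g *\<^sub>v (S *\<^sub>v x) = S *\<^sub>v (\<pi>' g *\<^sub>v x)" if "g \<in> carrier G" "x \<in> carrier_vec d'" for g x
    using assoc_mult_mat_vec[OF A.rep_carrier S, of g x] assoc_mult_mat_vec[OF S B.rep_carrier, of g x] that intertwine[of g]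
    by simp
  have not_zero: "\<not> (\<forall>x\<in>carrier_vec d'. S *\<^sub>v x = 0\<^sub>v d)"
  proof
    assume z: "\<forall>x\<in>carrier_vec d'. S *\<^sub>v x = 0\<^sub>v d"
    have "S = 0\<^sub>m d d'"
    proof (rule mat_eq_if_mult_vec_eq[OF S])
      fix x :: "complex vec" assume "x \<in> carrier_vec d'"
      then show "S *\<^sub>v x = 0\<^sub>m d d' *\<^sub>v x" using z by (intro eq_vecI) auto
    qed simp
    then show False using S0 by simp
  qed
  define K where "K = {x \<in> carrier_vec d'. S *\<^sub>v x = 0\<^sub>v d}"
  have "closed_subspace d' K" unfolding K_def using S by (rule closed_subspace_kernel)
  moreover have "\<pi>' g *\<^sub>v x \<in> K" if "g \<in> carrier G" "x \<in> K" for g x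
    using that int[of g x, symmetric] by (auto simp: K_def B.square_vec_simps mult_mat_zero_vec[of _ d d])
  ultimately have "K = {0\<^sub>v d'} \<or> K = carrier_vec d'" by (rule B.invariant_trivial)
  moreover have "K \<noteq> carrier_vec d'" using not_zero by (auto simp: K_def)
  ultimately have "K = {0\<^sub>v d'}" by simp
  then have inj: "injective_mat d d' S" using S by (auto simp: injective_mat_def K_def)
  define W where "W = (\<lambda>x. S *\<^sub>v x) ` carrier_vec d'"
  have "closed_subspace d W" unfolding W_def using S closed_subspace_carrier by (rule closed_subspace_image)
  moreover have "\<pi> g *\<^sub>v w \<in> W" if "g \<in> carrier G" "w \<in> W" for g w
    using that int[of g] by (auto simp: W_def B.square_vec_simps)
  ultimately have "W = {0\<^sub>v d} \<or> W = carrier_vec d" by (rule A.invariant_trivial)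
  moreover have "W \<noteq> {0\<^sub>v d}" using not_zero by (auto simp: W_def)
  ultimately have W: "W = carrier_vec d" by simp
  obtain R where R: "R \<in> carrier_mat d' d" "S * R = 1\<^sub>m d"
    using mat_col_equation[OF S one_carrier_mat] W unfolding W_def by (metis col_dim index_one_mat(2))
  have "S * (R * S) = S * 1\<^sub>m d'" using R S assoc_mult_mat[OF S R(1) S] by simp
  then have RS: "R * S = 1\<^sub>m d'" using injective_mat_cancel[OF inj, of "R * S" d' "1\<^sub>m d'"] R S by simp
  have "mat_trace (\<pi> g) = mat_trace (\<pi> g * (S * R))" using g R by simp
  also have "\<dots> = mat_trace (S * (\<pi>' g * R))"
    using g R S assoc_mult_mat[OF A.rep_carrier[OF g] S R(1)] assoc_mult_mat[OF S B.rep_carrier[OF g] R(1)] intertwine[OF g] by simp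
  also have "\<dots> = mat_trace (\<pi>' g * R * S)" using g R S by (intro mat_trace_comm) auto
  also have "\<pi>' g * R * S = \<pi>' g" using RS g R S assoc_mult_mat[OF B.rep_carrier[OF g] R(1) S] by simp
  finally show ?thesis .
qed

lemma bij_mult_left: "x \<in> carrier G \<Longrightarrow> bij_betw (\<lambda>g. x \<otimes> g) (carrier G) (carrier G)"
  by (rule bij_betw_byWitness[of _ "\<lambda>g. inv x \<otimes> g"]) (auto simp: inv_cancel)

text \<open>Substituting \<open>xg\<close> for \<open>g\<close> in the average: the factors \<open>\<alpha>(x,g)\<close> from \<open>\<pi>\<close> and \<open>1/\<alpha>(x,g)\<close> from the inverse
of \<open>\<pi>'\<close> cancel because both representations have the same multiplier.\<close>

lemma averaged_intertwines:
  assumes A: "projective_rep G \<alpha> d \<pi>" and B: "projective_rep G \<alpha> d' \<pi>'"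
    and E: "E \<in> carrier_mat d d'" and x: "x \<in> carrier G"
  defines "S \<equiv> mat_sum d d' (\<lambda>g. \<pi> g * E * projective_rep.\<pi>_inv G \<alpha> \<pi>' g) (carrier G)"
  shows "\<pi> x * S = S * \<pi>' x"
proof -
  interpret A: projective_rep G \<alpha> d \<pi> by fact
  interpret B: projective_rep G \<alpha> d' \<pi>' by fact
  note c = mult_carrier_mat[of _ d d' _ d'] mult_carrier_mat[of _ d d _ d']
  have "S * \<pi>' x = mat_sum d d' (\<lambda>g. \<pi> g * E * B.\<pi>_inv g * \<pi>' x) (carrier G)"
    unfolding S_def using x E by (intro mat_sum_mult_right) (auto simp: c)
  also have "\<dots> = mat_sum d d' (\<lambda>g. \<pi> (x \<otimes> g) * E * B.\<pi>_inv (x \<otimes> g) * \<pi>' x) (carrier G)"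
    using bij_mult_left[OF x] by (rule mat_sum_reindex)
  also have "\<dots> = mat_sum d d' (\<lambda>g. \<pi> x * (\<pi> g * E * B.\<pi>_inv g)) (carrier G)"
  proof (rule mat_sum_cong)
    fix g assume g: "g \<in> carrier G"
    have "B.\<pi>_inv g = B.\<pi>_inv g * B.\<pi>_inv x * \<pi>' x"
      using x g by (simp add: B.square_assoc_simps)
    also have "\<dots> = (1 / \<alpha> x g) \<cdot>\<^sub>m (B.\<pi>_inv (x \<otimes> g) * \<pi>' x)"
      using x g by (simp add: B.inv_mult B.square_simps)
    finally have inv: "B.\<pi>_inv g = \<dots>" .
    have "\<pi> x * (\<pi> g * E * B.\<pi>_inv g) = (\<pi> x * \<pi> g) * E * B.\<pi>_inv g"
      using x g E by (simp add: c assoc_mult_mat[of _ d d _ d _ d'] assoc_mult_mat[of _ d d _ d' _ d'])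
    also have "\<dots> = \<alpha> x g \<cdot>\<^sub>m (\<pi> (x \<otimes> g) * E * B.\<pi>_inv g)"
      using x g E by (simp add: A.rep_mult c mult_smult_assoc_mat[of _ d d _ d'] mult_smult_assoc_mat[of _ d d' _ d'])
    also have "\<dots> = \<alpha> x g \<cdot>\<^sub>m (\<pi> (x \<otimes> g) * E * ((1 / \<alpha> x g) \<cdot>\<^sub>m (B.\<pi>_inv (x \<otimes> g) * \<pi>' x)))"
      by (simp only: inv)
    also have "\<dots> = \<pi> (x \<otimes> g) * E * B.\<pi>_inv (x \<otimes> g) * \<pi>' x"
      using x g E by (simp add: mult_smult_distrib[of _ d d' _ d'] c B.square_simps assoc_mult_mat[of _ d d' _ d' _ d'])
    finally show "\<pi> (x \<otimes> g) * E * B.\<pi>_inv (x \<otimes> g) * \<pi>' x = \<pi> x * (\<pi> g * E * B.\<pi>_inv g)" ..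
  qed
  also have "\<dots> = \<pi> x * S"
    unfolding S_def using x E by (intro mat_sum_mult_left[symmetric]) (auto simp: c)
  finally show ?thesis ..
qed

lemma mult_elementary_mult:
  fixes A :: "'b::comm_semiring_1 mat"
  assumes "A \<in> carrier_mat n d" "B \<in> carrier_mat d' m" "j < d" "k < d'" "i < n" "l < m"
  shows "(A * mat d d' (\<lambda>(a,b). if a = j \<and> b = k then 1 else 0) * B) $$ (i,l) = A $$ (i,j) * B $$ (k,l)"
proof -
  have "(A * mat d d' (\<lambda>(a,b). if a = j \<and> b = k then 1 else 0)) $$ (i,b) = (if b = k then A $$ (i,j) else 0)" if "b < d'" for b
    using assms that by (simp add: scalar_prod_def if_distrib[of "\<lambda>x. _ * x"] sum.delta cong: if_cong)
  then show ?thesis using assms by (simp add: scalar_prod_def if_distrib[of "\<lambda>x. x * _"] sum.delta cong: if_cong)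
qed

text \<open>Averaging elementary matrices gives intertwiners, which vanish by Schur's lemma; their entries are
the products of matrix coefficients that occur in the sum.\<close>

lemma character_orthogonality_distinct:
  assumes A: "irreducible_rep G \<alpha> d \<pi>" and B: "irreducible_rep G \<alpha> d' \<pi>'"
    and neq: "\<exists>g\<in>carrier G. mat_trace (\<pi> g) \<noteq> mat_trace (\<pi>' g)"
  shows "(\<Sum>g\<in>carrier G. mat_trace (\<pi> g) * mat_trace (projective_rep.\<pi>_inv G \<alpha> \<pi>' g)) = 0"
proof -
  interpret A: irreducible_rep G \<alpha> d \<pi> by fact
  interpret B: irreducible_rep G \<alpha> d' \<pi>' by fact
  have ent: "(\<Sum>g\<in>carrier G. \<pi> g $$ (i,i) * B.\<pi>_inv g $$ (k,k)) = 0" if ik: "i < d" "k < d'" for i k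
  proof -
    define E where "E = mat d d' (\<lambda>(a,b). if a = i \<and> b = k then 1 else 0 :: complex)"
    define S where "S = mat_sum d d' (\<lambda>g. \<pi> g * E * B.\<pi>_inv g) (carrier G)"
    have E: "E \<in> carrier_mat d d'" by (simp add: E_def)
    have "\<pi> g * S = S * \<pi>' g" if "g \<in> carrier G" for g
      unfolding S_def using averaged_intertwines[OF A.projective_rep_axioms B.projective_rep_axioms E that] .
    then have "S = 0\<^sub>m d d'" using schur_intertwiner[OF A B, of S] neq by (auto simp: S_def)
    then have "S $$ (i,k) = 0" using ik by simp
    moreover have "S $$ (i,k) = (\<Sum>g\<in>carrier G. (\<pi> g * E * B.\<pi>_inv g) $$ (i,k))"
      using ik by (simp add: S_def mat_sum_def del: index_mult_mat)
    then have "S $$ (i,k) = (\<Sum>g\<in>carrier G. \<pi> g $$ (i,i) * B.\<pi>_inv g $$ (k,k))"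
      using ik by (simp add: E_def mult_elementary_mult[of _ d d _ d' d'] del: index_mult_mat)
    ultimately show ?thesis by simp
  qed
  have "(\<Sum>g\<in>carrier G. mat_trace (\<pi> g) * mat_trace (B.\<pi>_inv g)) =
    (\<Sum>g\<in>carrier G. \<Sum>i<d. \<Sum>k<d'. \<pi> g $$ (i,i) * B.\<pi>_inv g $$ (k,k))"
    by (intro sum.cong) (auto simp: mat_trace_def sum_product)
  also have "\<dots> = (\<Sum>i<d. \<Sum>g\<in>carrier G. \<Sum>k<d'. \<pi> g $$ (i,i) * B.\<pi>_inv g $$ (k,k))" by (rule sum.swap)
  also have "\<dots> = (\<Sum>i<d. \<Sum>k<d'. \<Sum>g\<in>carrier G. \<pi> g $$ (i,i) * B.\<pi>_inv g $$ (k,k))"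
    by (intro sum.cong refl sum.swap)
  also have "\<dots> = (\<Sum>i<d. \<Sum>k<d'. 0)"
    by (rule sum.cong[OF refl], rule sum.cong[OF refl]) (use ent in auto)
  also have "\<dots> = 0" by simp
  finally show ?thesis .
qed

text \<open>Here the average of an elementary matrix \<open>E\<close> is a scalar, determined by its trace, which is the group
order times the trace of \<open>E\<close>.\<close>

lemma character_orthogonality_same:
  assumes A: "irreducible_rep G \<alpha> d \<pi>"
  shows "(\<Sum>g\<in>carrier G. mat_trace (\<pi> g) * mat_trace (projective_rep.\<pi>_inv G \<alpha> \<pi> g)) = of_nat (card (carrier G))"
proof -
  interpret A: irreducible_rep G \<alpha> d \<pi> by fact
  have ent: "(\<Sum>g\<in>carrier G. \<pi> g $$ (i,i) * A.\<pi>_inv g $$ (k,k)) = (if i = k then of_nat (card (carrier G)) / of_nat d else 0)"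
    if ik: "i < d" "k < d" for i k
  proof -
    define E where "E = mat d d (\<lambda>(a,b). if a = i \<and> b = k then 1 else 0 :: complex)"
    define S where "S = mat_sum d d (\<lambda>g. \<pi> g * E * A.\<pi>_inv g) (carrier G)"
    have E: "E \<in> carrier_mat d d" by (simp add: E_def)
    have "\<pi> g * S = S * \<pi> g" if "g \<in> carrier G" for g
      unfolding S_def using averaged_intertwines[OF A.projective_rep_axioms A.projective_rep_axioms E that] .
    then obtain c where c: "S = c \<cdot>\<^sub>m 1\<^sub>m d" "mat_trace S = c * of_nat d"
      using A.schur_scalar[of S] by (auto simp: S_def)
    have "mat_trace S = (\<Sum>g\<in>carrier G. mat_trace (\<pi> g * E * A.\<pi>_inv g))"
      unfolding S_def using E by (intro trace_mat_sum) (auto simp: A.square_simps)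
    also have "\<dots> = (\<Sum>g\<in>carrier G. mat_trace E)"
      using E by (intro sum.cong refl mat_trace_conj) auto
    also have "mat_trace E = (if i = k then 1 else 0)"
      using ik by (auto simp: mat_trace_def E_def if_distrib sum.delta cong: if_cong conj_cong)
    finally have "c * of_nat d = (if i = k then of_nat (card (carrier G)) else 0)" using c(2) by simp
    then have "c = (if i = k then of_nat (card (carrier G)) / of_nat d else 0)"
      using A.dim_pos by (auto simp: field_simps)
    moreover have "S $$ (i,k) = (\<Sum>g\<in>carrier G. (\<pi> g * E * A.\<pi>_inv g) $$ (i,k))"
      using ik by (simp add: S_def mat_sum_def del: index_mult_mat)
    then have "S $$ (i,k) = (\<Sum>g\<in>carrier G. \<pi> g $$ (i,i) * A.\<pi>_inv g $$ (k,k))"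
      using ik by (simp add: E_def mult_elementary_mult[of _ d d _ d d] del: index_mult_mat)
    moreover have "S $$ (i,k) = c * (if i = k then 1 else 0)" using ik by (simp add: c(1))
    ultimately show ?thesis by auto
  qed
  have "(\<Sum>g\<in>carrier G. mat_trace (\<pi> g) * mat_trace (A.\<pi>_inv g)) =
    (\<Sum>g\<in>carrier G. \<Sum>i<d. \<Sum>k<d. \<pi> g $$ (i,i) * A.\<pi>_inv g $$ (k,k))"
    by (intro sum.cong) (auto simp: mat_trace_def sum_product)
  also have "\<dots> = (\<Sum>i<d. \<Sum>g\<in>carrier G. \<Sum>k<d. \<pi> g $$ (i,i) * A.\<pi>_inv g $$ (k,k))" by (rule sum.swap)
  also have "\<dots> = (\<Sum>i<d. \<Sum>k<d. \<Sum>g\<in>carrier G. \<pi> g $$ (i,i) * A.\<pi>_inv g $$ (k,k))"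
    by (intro sum.cong refl sum.swap)
  also have "\<dots> = (\<Sum>i<d. \<Sum>k<d. if i = k then of_nat (card (carrier G)) / of_nat d else 0)"
    by (intro sum.cong refl) (use ent in auto)
  also have "\<dots> = of_nat (card (carrier G))" using A.dim_pos by (simp add: sum.delta)
  finally show ?thesis .
qed

end

context projective_rep
begin

text \<open>The exponent is a multiple of \<open>o\<^sub>\<alpha>(g) = n n\<^sup>*\<close>, and \<open>\<pi>(g)\<^sup>n\<close> is the scalar \<open>A\<^sub>g\<close>.\<close>

lemma rep_pow_exponent:
  assumes g: "g \<in> carrier G"
  shows "\<pi> g ^\<^sub>m multiplier_exponent G \<alpha> = 1\<^sub>m d"
proof -
  obtain k where k: "power_scalar g ^ k = 1" "order_in_multiplier G \<alpha> g = ord g * k"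
    using order_in_multiplier[OF g] .
  obtain l where l: "multiplier_exponent G \<alpha> = ord g * k * l"
    using order_in_multiplier_dvd_exponent[OF g] k(2) by (auto elim: dvdE)
  have "\<pi> g ^\<^sub>m ord g = power_scalar g \<cdot>\<^sub>m 1\<^sub>m d"
    using rep_pow[OF g, of "ord g"] g by (simp add: power_scalar_def rep_one)
  then show ?thesis unfolding l using k(1) g
    using smult_one_pow[of "1::complex" d l] by (simp add: pow_mat_mult[of _ d] smult_one_pow)
qed

lemma eigenvalue_root_of_unity:
  assumes "g \<in> carrier G" "eigenvalue (\<pi> g) x"
  shows "x ^ multiplier_exponent G \<alpha> = 1"
  using eigenvalue_pow_eq_one[OF rep_carrier[OF assms(1)] assms(2) rep_pow_exponent[OF assms(1)]] .

text \<open>The inverse of \<open>\<pi>(g)\<close> is its power with exponent \<open>e - 1\<close>, and \<open>a\<^bsup>e - 1\<^esup>\<close> is the conjugate of \<open>a\<close> for an \<open>e\<close>-th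
root of unity \<open>a\<close>.\<close>

lemma trace_inv_eq_cnj:
  assumes g: "g \<in> carrier G"
  shows "mat_trace (\<pi>_inv g) = cnj (\<chi> g)"
proof -
  define e where "e = multiplier_exponent G \<alpha>"
  have e: "e = Suc (e - 1)" using exponent_pos by (simp add: e_def)
  obtain as where as: "char_poly (\<pi> g) = (\<Prod>a\<leftarrow>as. [:- a, 1:])" "\<And>k. mat_trace (\<pi> g ^\<^sub>m k) = (\<Sum>a\<leftarrow>as. a ^ k)"
    using trace_pow_eigenvalues[OF rep_carrier[OF g]] by blast
  have "\<pi> g ^\<^sub>m (e - 1) * \<pi> g = 1\<^sub>m d"
    using rep_pow_exponent[OF g] e pow_mat.simps(2)[of "\<pi> g" "e - 1"] by (simp add: e_def)
  then have "(\<pi> g ^\<^sub>m (e - 1) * \<pi> g) * \<pi>_inv g = \<pi>_inv g" using g by simp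
  then have "\<pi> g ^\<^sub>m (e - 1) = \<pi>_inv g" using g by (simp add: square_assoc_simps)
  then have "mat_trace (\<pi>_inv g) = (\<Sum>a\<leftarrow>as. a ^ (e - 1))" using as(2) by metis
  also have "\<dots> = (\<Sum>a\<leftarrow>as. cnj a)"
  proof (intro arg_cong[of _ _ sum_list] map_cong refl)
    fix a assume "a \<in> set as"
    then have ae: "a ^ e = 1"
      using eigenvalue_root_of_unity[OF g] eigenvalue_iff_in_list[OF rep_carrier[OF g] as(1)] by (simp add: e_def)
    then have "norm a = 1" using e by (metis power_eq_1_iff nat.distinct(1))
    then have "a * cnj a = 1" by (simp add: complex_norm_square[symmetric] flip: complex_norm_square)
    moreover have "a * a ^ (e - 1) = 1" using ae e by (metis power_Suc)
    ultimately show "a ^ (e - 1) = cnj a" by (metis mult.commute mult.left_commute mult.right_neutral)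
  qed
  also have "\<dots> = cnj (\<Sum>a\<leftarrow>as. a)" by (induction as) simp_all
  also have "\<dots> = cnj (\<chi> g)" using as(2)[of 1] g by simp
  finally show ?thesis .
qed

end

text \<open>The orthogonality relation writes the group order as the sum of the \<open>\<bar>\<chi>(g)\<bar>\<^sup>2\<close>, of which \<open>d\<^sup>2\<close> is the term at \<open>1\<close>.\<close>

lemma (in irreducible_rep) dim_square_le: "d ^ 2 \<le> card (carrier G)"
proof -
  have "complex_of_real (\<Sum>g\<in>carrier G. (norm (\<chi> g))\<^sup>2) = of_nat (card (carrier G))"
    using character_orthogonality_same[OF irreducible_rep_axioms]
    by (simp add: trace_inv_eq_cnj complex_norm_square[symmetric])
  then have "(\<Sum>g\<in>carrier G. (norm (\<chi> g))\<^sup>2) = real (card (carrier G))"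
    by (metis of_real_eq_iff of_real_of_nat_eq)
  moreover have "(norm (\<chi> \<one>))\<^sup>2 \<le> (\<Sum>g\<in>carrier G. (norm (\<chi> g))\<^sup>2)"
    by (rule member_le_sum) auto
  ultimately have "(real d)\<^sup>2 \<le> real (card (carrier G))" by (simp add: rep_one mat_trace_one)
  then show ?thesis by (metis of_nat_le_iff of_nat_power)
qed

section \<open>The twisted regular representation and regular elements\<close>

lemma (in twisted_group) projective_repI:
  assumes carr: "\<And>g. g \<in> carrier G \<Longrightarrow> \<pi> g \<in> carrier_mat d d"
    and mult: "\<And>x y. x \<in> carrier G \<Longrightarrow> y \<in> carrier G \<Longrightarrow> \<pi> x * \<pi> y = \<alpha> x y \<cdot>\<^sub>m \<pi> (x \<otimes> y)"
    and one: "\<pi> \<one> = 1\<^sub>m d"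
  shows "projective_rep G \<alpha> d \<pi>"
proof (intro projective_rep.intro projective_rep_axioms.intro twisted_group_axioms)
  have "invertible_mat (\<pi> g)" if g: "g \<in> carrier G" for g
  proof -
    define B where "B = (1 / \<alpha> g (inv g)) \<cdot>\<^sub>m \<pi> (inv g)"
    have "\<pi> g * B = 1\<^sub>m d" "B * \<pi> g = 1\<^sub>m d"
      using g carr mult one alpha_inv_comm[OF g] unfolding B_def
      by (simp_all add: mult_smult_distrib[of _ d d _ d] mult_smult_assoc_mat[of _ d d _ d])
    moreover have "dim_row B = d" using carr[of "inv g"] g by (auto simp: B_def)
    ultimately show ?thesis using carr[OF g] by (auto simp: invertible_mat_def inverts_mat_def intro!: exI[of _ B])
  qed
  then show "proj_rep G \<alpha> d \<pi>" using carr mult by (simp add: proj_rep_def)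
qed

context twisted_group
begin

definition enumeration :: "nat \<Rightarrow> 'g" where
  "enumeration = (SOME f. bij_betw f {..<card (carrier G)} (carrier G))"

lemma bij_enumeration: "bij_betw enumeration {..<card (carrier G)} (carrier G)"
proof -
  have "\<exists>f. bij_betw f {..<card (carrier G)} (carrier G)"
    using ex_bij_betw_nat_finite[OF finite_carrier] by (simp add: atLeast0LessThan)
  then show ?thesis unfolding enumeration_def by (rule someI_ex)
qed

lemma enumeration_in [simp]: "i < card (carrier G) \<Longrightarrow> enumeration i \<in> carrier G"
  using bij_enumeration by (auto simp: bij_betw_def)

lemma enumeration_eq_iff: "i < card (carrier G) \<Longrightarrow> j < card (carrier G) \<Longrightarrow> enumeration i = enumeration j \<longleftrightarrow> i = j"
  using bij_enumeration by (auto simp: bij_betw_def inj_on_def)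

lemma sum_enumeration: "(\<Sum>k<card (carrier G). F (enumeration k)) = (\<Sum>h\<in>carrier G. F h)"
  by (rule sum.reindex_bij_betw[OF bij_enumeration])

text \<open>Basis vectors are indexed by the group elements, and \<open>g\<close> sends the one at \<open>h\<close> to \<open>\<alpha>(g,h)\<close> times the one at \<open>gh\<close>.\<close>

definition regular_rep :: "'g \<Rightarrow> complex mat" where
  "regular_rep g = mat (card (carrier G)) (card (carrier G))
     (\<lambda>(i,j). if enumeration i = g \<otimes> enumeration j then \<alpha> g (enumeration j) else 0)"

lemma regular_rep_projective: "projective_rep G \<alpha> (card (carrier G)) regular_rep"
proof (rule projective_repI)
  fix x y assume xy: "x \<in> carrier G" "y \<in> carrier G"
  let ?n = "card (carrier G)"
  show "regular_rep x * regular_rep y = \<alpha> x y \<cdot>\<^sub>m regular_rep (x \<otimes> y)"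
  proof (rule eq_matI)
    fix i j assume "i < dim_row (\<alpha> x y \<cdot>\<^sub>m regular_rep (x \<otimes> y))" "j < dim_col (\<alpha> x y \<cdot>\<^sub>m regular_rep (x \<otimes> y))"
    then have ij: "i < ?n" "j < ?n" by (auto simp: regular_rep_def)
    define a b where "a = enumeration i" and "b = enumeration j"
    have ab: "a \<in> carrier G" "b \<in> carrier G" using ij by (auto simp: a_def b_def)
    have "(regular_rep x * regular_rep y) $$ (i,j) =
      (\<Sum>k<?n. (if a = x \<otimes> enumeration k then \<alpha> x (enumeration k) else 0) * (if enumeration k = y \<otimes> b then \<alpha> y b else 0))"
      unfolding a_def b_def using ij by (simp add: regular_rep_def scalar_prod_def atLeast0LessThan)
    also have "\<dots> = (\<Sum>h\<in>carrier G. (if a = x \<otimes> h then \<alpha> x h else 0) * (if h = y \<otimes> b then \<alpha> y b else 0))"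
      by (rule sum_enumeration)
    also have "\<dots> = (\<Sum>h\<in>carrier G. if h = y \<otimes> b then (if a = x \<otimes> (y \<otimes> b) then \<alpha> x (y \<otimes> b) else 0) * \<alpha> y b else 0)"
      by (intro sum.cong) auto
    also have "\<dots> = (if a = x \<otimes> (y \<otimes> b) then \<alpha> x (y \<otimes> b) else 0) * \<alpha> y b"
      using xy ab by (simp add: sum.delta)
    also have "\<dots> = (\<alpha> x y \<cdot>\<^sub>m regular_rep (x \<otimes> y)) $$ (i,j)"
      using ij ab xy cocycle[of x y b] by (simp add: regular_rep_def m_assoc flip: a_def b_def)
    finally show "(regular_rep x * regular_rep y) $$ (i,j) = (\<alpha> x y \<cdot>\<^sub>m regular_rep (x \<otimes> y)) $$ (i,j)" .
  qed (auto simp: regular_rep_def)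
next
  show "regular_rep \<one> = 1\<^sub>m (card (carrier G))"
    by (rule eq_matI) (auto simp: regular_rep_def enumeration_eq_iff)
qed (simp add: regular_rep_def)

lemma trace_regular_rep:
  assumes "g \<in> carrier G"
  shows "mat_trace (regular_rep g) = (if g = \<one> then of_nat (card (carrier G)) else 0)"
proof -
  have "mat_trace (regular_rep g) = (\<Sum>j<card (carrier G). if enumeration j = g \<otimes> enumeration j then \<alpha> g (enumeration j) else 0)"
    by (simp add: mat_trace_def regular_rep_def)
  also have "\<dots> = (\<Sum>h\<in>carrier G. if h = g \<otimes> h then \<alpha> g h else 0)" by (rule sum_enumeration)
  also have "\<dots> = (\<Sum>h\<in>carrier G. if g = \<one> then 1 else 0)"
    using assms by (intro sum.cong) auto
  finally show ?thesis by simp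
qed

lemma card_carrier_pos: "card (carrier G) > 0"
  using finite_carrier one_closed card_gt_0_iff by blast

text \<open>Conjugation by \<open>\<pi>(xh)\<close> is conjugation by \<open>\<pi>(h)\<close> followed by conjugation by \<open>\<pi>(x)\<close>, because the scalar
\<open>\<alpha>(x,h)\<close> cancels. Reading this off the regular representation gives an identity of numbers.\<close>

lemma beta_mult:
  assumes "x \<in> carrier G" "h \<in> carrier G" "g \<in> carrier G"
  shows "beta G \<alpha> (x \<otimes> h) g = beta G \<alpha> x (h \<otimes> g \<otimes> inv h) * beta G \<alpha> h g"
proof -
  define n where "n = card (carrier G)"
  interpret R: projective_rep G \<alpha> n regular_rep unfolding n_def by (rule regular_rep_projective)
  define k where "k = x \<otimes> (h \<otimes> g \<otimes> inv h) \<otimes> inv x"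
  have k: "k \<in> carrier G" "k = (x \<otimes> h) \<otimes> g \<otimes> inv (x \<otimes> h)"
    using assms by (simp_all add: k_def m_assoc inv_mult_group)
  have e1: "regular_rep (x \<otimes> h) = (1 / \<alpha> x h) \<cdot>\<^sub>m (regular_rep x * regular_rep h)"
    using assms by (simp add: R.rep_mult)
  have e2: "R.\<pi>_inv (x \<otimes> h) = \<alpha> x h \<cdot>\<^sub>m (R.\<pi>_inv h * R.\<pi>_inv x)"
    using assms by (simp add: R.inv_mult)
  have "(1 / beta G \<alpha> (x \<otimes> h) g) \<cdot>\<^sub>m regular_rep k = regular_rep (x \<otimes> h) * regular_rep g * R.\<pi>_inv (x \<otimes> h)"
    using assms unfolding k(2) by (simp only: R.rep_conj m_closed)
  also have "\<dots> = regular_rep x * (regular_rep h * regular_rep g * R.\<pi>_inv h) * R.\<pi>_inv x"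
    unfolding e1 e2 using assms by (simp add: R.square_assoc_simps)
  also have "\<dots> = (1 / beta G \<alpha> h g) \<cdot>\<^sub>m (regular_rep x * regular_rep (h \<otimes> g \<otimes> inv h) * R.\<pi>_inv x)"
    using assms by (simp add: R.rep_conj R.square_simps)
  also have "\<dots> = (1 / beta G \<alpha> h g * (1 / beta G \<alpha> x (h \<otimes> g \<otimes> inv h))) \<cdot>\<^sub>m regular_rep k"
    using assms by (simp add: R.rep_conj k_def)
  finally have "(1 / beta G \<alpha> (x \<otimes> h) g) \<cdot>\<^sub>m regular_rep k * R.\<pi>_inv k =
     (1 / beta G \<alpha> h g * (1 / beta G \<alpha> x (h \<otimes> g \<otimes> inv h))) \<cdot>\<^sub>m regular_rep k * R.\<pi>_inv k" by simp
  then have "(1 / beta G \<alpha> (x \<otimes> h) g) \<cdot>\<^sub>m 1\<^sub>m n = (1 / beta G \<alpha> h g * (1 / beta G \<alpha> x (h \<otimes> g \<otimes> inv h))) \<cdot>\<^sub>m 1\<^sub>m n"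
    using k(1) by (simp add: R.square_simps)
  then have "((1 / beta G \<alpha> (x \<otimes> h) g) \<cdot>\<^sub>m 1\<^sub>m n) $$ (0,0) = ((1 / beta G \<alpha> h g * (1 / beta G \<alpha> x (h \<otimes> g \<otimes> inv h))) \<cdot>\<^sub>m 1\<^sub>m n) $$ (0,0)"
    by simp
  then have "1 / beta G \<alpha> (x \<otimes> h) g = 1 / beta G \<alpha> h g * (1 / beta G \<alpha> x (h \<otimes> g \<otimes> inv h))"
    using card_carrier_pos by (simp add: n_def)
  then show ?thesis using assms by (simp add: field_simps)
qed

text \<open>Two conjugating elements differ by an element \<open>k\<close> of the centraliser of \<open>g\<close>, and \<open>\<beta>\<^sub>k(g) = 1\<close> by regularity.\<close>

lemma beta_well_defined:
  assumes g: "regular_element G \<alpha> g" and h: "h \<in> carrier G" "h' \<in> carrier G"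
    and eq: "h \<otimes> g \<otimes> inv h = h' \<otimes> g \<otimes> inv h'"
  shows "beta G \<alpha> h g = beta G \<alpha> h' g"
proof -
  have gc: "g \<in> carrier G" using g by (simp add: regular_element_def)
  define k where "k = inv h' \<otimes> h"
  have k: "k \<in> carrier G" "h = h' \<otimes> k" using h by (simp_all add: k_def inv_cancel)
  have "h \<otimes> g = h' \<otimes> (g \<otimes> (inv h' \<otimes> h))"
    using arg_cong[OF eq, of "\<lambda>x. x \<otimes> h"] h gc by (simp add: m_assoc)
  then have "k \<otimes> g = g \<otimes> k"
    using h gc by (simp add: k_def m_assoc inv_cancel)
  then have "k \<otimes> g \<otimes> inv k = g" and "beta G \<alpha> k g = 1"
    using g k gc by (simp_all add: regular_element_def m_assoc)
  then show ?thesis using beta_mult[OF h(2) k(1) gc] k(2) by simp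
qed

lemma regular_conj:
  assumes g: "regular_element G \<alpha> g" and h: "h \<in> carrier G"
  shows "regular_element G \<alpha> (h \<otimes> g \<otimes> inv h)"
  unfolding regular_element_def
proof (intro conjI ballI impI)
  have gc: "g \<in> carrier G" using g by (simp add: regular_element_def)
  then show "h \<otimes> g \<otimes> inv h \<in> carrier G" using h by simp
  fix k assume k: "k \<in> carrier G" and comm: "h \<otimes> g \<otimes> inv h \<otimes> k = k \<otimes> (h \<otimes> g \<otimes> inv h)"
  have "(k \<otimes> h) \<otimes> g \<otimes> inv (k \<otimes> h) = k \<otimes> (h \<otimes> g \<otimes> inv h) \<otimes> inv k"
    using h k gc by (simp add: m_assoc inv_mult_group)
  also have "\<dots> = h \<otimes> g \<otimes> inv h" unfolding comm[symmetric] using h k gc by (simp add: m_assoc)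
  finally have "beta G \<alpha> (k \<otimes> h) g = beta G \<alpha> h g" using h k by (intro beta_well_defined[OF g]) auto
  then show "beta G \<alpha> k (h \<otimes> g \<otimes> inv h) = 1" using beta_mult[OF k h gc] h gc by simp
qed

lemma conjugacy_class_conj:
  assumes "g \<in> carrier G" "a \<in> conjugacy_class G g"
  shows "conjugacy_class G a = conjugacy_class G g"
proof -
  have sub: "conjugacy_class G (k \<otimes> x \<otimes> inv k) \<subseteq> conjugacy_class G x" if "x \<in> carrier G" "k \<in> carrier G" for x k
  proof
    fix z assume "z \<in> conjugacy_class G (k \<otimes> x \<otimes> inv k)"
    then obtain l where "l \<in> carrier G" "z = l \<otimes> (k \<otimes> x \<otimes> inv k) \<otimes> inv l" by (auto simp: conjugacy_class_def)
    then have "z = (l \<otimes> k) \<otimes> x \<otimes> inv (l \<otimes> k)" "l \<otimes> k \<in> carrier G" using that by (simp_all add: m_assoc inv_mult_group)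
    then show "z \<in> conjugacy_class G x" by (auto simp: conjugacy_class_def)
  qed
  obtain h where h: "h \<in> carrier G" "a = h \<otimes> g \<otimes> inv h" using assms by (auto simp: conjugacy_class_def)
  have "inv h \<otimes> a \<otimes> inv (inv h) = g" using h assms by (simp add: m_assoc inv_cancel)
  then show ?thesis using sub[of g h] sub[of a "inv h"] h assms(1) by auto
qed

lemma regular_class_of: "regular_element G \<alpha> g \<Longrightarrow> conjugacy_class G g \<in> regular_classes G \<alpha>"
  using regular_conj by (auto simp: regular_classes_def conjugacy_class_def regular_element_def)

lemma in_conjugacy_class: "g \<in> carrier G \<Longrightarrow> g \<in> conjugacy_class G g"
  unfolding conjugacy_class_def by (rule image_eqI[of _ _ \<one>]) auto

lemma one_regular: "regular_element G \<alpha> \<one>"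
  by (simp add: regular_element_def beta_def)

end

section \<open>Functions on the regular classes\<close>

locale class_enum = twisted_group G \<alpha>
  for G :: "('g, 'more) monoid_scheme" (structure) and \<alpha> +
  fixes m :: nat and C :: "nat \<Rightarrow> 'g set" and c0 :: "nat \<Rightarrow> 'g"
  assumes bij_classes: "bij_betw C {..<m} (regular_classes G \<alpha>)"
    and representative: "i < m \<Longrightarrow> c0 i \<in> C i"
begin

lemma representative_regular: "i < m \<Longrightarrow> regular_element G \<alpha> (c0 i)"
  using bij_classes representative by (auto simp: bij_betw_def regular_classes_def)

lemma representative_carrier [simp]: "i < m \<Longrightarrow> c0 i \<in> carrier G"
  using representative_regular by (simp add: regular_element_def)

lemma class_eq: assumes "i < m" shows "C i = conjugacy_class G (c0 i)"
proof -
  have "C i \<in> regular_classes G \<alpha>" using bij_betwE[OF bij_classes] assms by simp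
  then obtain g where "g \<in> carrier G" "C i = conjugacy_class G g" by (auto simp: regular_classes_def)
  then show ?thesis using conjugacy_class_conj[of g "c0 i"] representative[OF assms] by simp
qed

lemma class_cases:
  assumes "i < m" "g \<in> C i"
  obtains h where "h \<in> carrier G" "g = h \<otimes> c0 i \<otimes> inv h"
  using assms class_eq by (auto simp: conjugacy_class_def)

lemma class_regular: "i < m \<Longrightarrow> g \<in> C i \<Longrightarrow> regular_element G \<alpha> g"
  by (rule class_cases) (auto intro: regular_conj representative_regular)

lemma class_carrier: "i < m \<Longrightarrow> g \<in> C i \<Longrightarrow> g \<in> carrier G"
  by (rule class_cases) auto

lemma class_subset: "i < m \<Longrightarrow> C i \<subseteq> carrier G"
  using class_carrier by blast

lemma class_conj: "i < m \<Longrightarrow> g \<in> carrier G \<Longrightarrow> x \<in> carrier G \<Longrightarrow> x \<otimes> g \<otimes> inv x \<in> C i \<longleftrightarrow> g \<in> C i"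
proof -
  assume i: "i < m" and g: "g \<in> carrier G" and x: "x \<in> carrier G"
  have c: "conjugacy_class G (x \<otimes> g \<otimes> inv x) = conjugacy_class G g"
    using g x by (intro conjugacy_class_conj) (auto simp: conjugacy_class_def)
  have mem: "y \<in> C i \<longleftrightarrow> conjugacy_class G y = C i" if "y \<in> carrier G" for y
    using in_conjugacy_class[OF that] conjugacy_class_conj[of "c0 i" y] class_eq[OF i] i by auto
  show ?thesis using mem[OF g] mem[of "x \<otimes> g \<otimes> inv x"] c g x by simp
qed

lemma class_disjoint: "i < m \<Longrightarrow> j < m \<Longrightarrow> g \<in> C i \<Longrightarrow> g \<in> C j \<Longrightarrow> i = j"
proof -
  assume ij: "i < m" "j < m" "g \<in> C i" "g \<in> C j"
  then have "C i = C j"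
    using class_eq conjugacy_class_conj[of "c0 i" g] conjugacy_class_conj[of "c0 j" g] by simp
  then show "i = j" using bij_classes ij by (auto simp: bij_betw_def inj_on_def)
qed

lemma regular_in_class:
  assumes "regular_element G \<alpha> g" obtains i where "i < m" "g \<in> C i"
proof -
  have "conjugacy_class G g \<in> C ` {..<m}" using regular_class_of[OF assms] bij_classes by (auto simp: bij_betw_def)
  then obtain i where "i < m" "C i = conjugacy_class G g" by auto
  then show thesis using that in_conjugacy_class assms by (auto simp: regular_element_def)
qed

text \<open>The class of the identity is regular.\<close>

lemma m_pos: "m > 0"
  using regular_in_class[OF one_regular] by (metis gr0I less_nat_zero_code)

text \<open>The element chosen in the definition of \<open>\<beta>(g,g')\<close> may be replaced by any conjugating element.\<close>

lemma beta_conj_eq: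
  assumes "i < m" "h \<in> carrier G"
  shows "beta_conj G \<alpha> (c0 i) (h \<otimes> c0 i \<otimes> inv h) = beta G \<alpha> h (c0 i)"
proof -
  define k where "k = (SOME k. k \<in> carrier G \<and> h \<otimes> c0 i \<otimes> inv h = k \<otimes> c0 i \<otimes> inv k)"
  have k: "k \<in> carrier G \<and> h \<otimes> c0 i \<otimes> inv h = k \<otimes> c0 i \<otimes> inv k"
    unfolding k_def by (rule someI[of _ h], rule conjI[OF assms(2) refl])
  have "beta_conj G \<alpha> (c0 i) (h \<otimes> c0 i \<otimes> inv h) = beta G \<alpha> k (c0 i)"
    by (simp only: beta_conj_def k_def)
  also have "\<dots> = beta G \<alpha> h (c0 i)"
    by (rule beta_well_defined[OF representative_regular[OF assms(1)] conjunct1[OF k] assms(2) conjunct2[OF k, symmetric]])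
  finally show ?thesis .
qed

lemma beta_conj_conj:
  assumes "i < m" "g \<in> C i" "x \<in> carrier G"
  shows "beta_conj G \<alpha> (c0 i) (x \<otimes> g \<otimes> inv x) = beta G \<alpha> x g * beta_conj G \<alpha> (c0 i) g"
proof -
  obtain h where h: "h \<in> carrier G" "g = h \<otimes> c0 i \<otimes> inv h" using class_cases[OF assms(1,2)] .
  have "x \<otimes> g \<otimes> inv x = (x \<otimes> h) \<otimes> c0 i \<otimes> inv (x \<otimes> h)"
    using h assms by (simp add: m_assoc inv_mult_group)
  then show ?thesis
    using beta_conj_eq[OF assms(1), of "x \<otimes> h"] beta_conj_eq[OF assms(1), of h] beta_mult[of x h "c0 i"] h assms by simp
qed

lemma beta_conj_nonzero: "i < m \<Longrightarrow> g \<in> C i \<Longrightarrow> beta_conj G \<alpha> (c0 i) g \<noteq> 0"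
  by (rule class_cases[of i g]) (auto simp: beta_conj_eq)

lemma beta_conj_power: "i < m \<Longrightarrow> g \<in> C i \<Longrightarrow> beta_conj G \<alpha> (c0 i) g ^ multiplier_exponent G \<alpha> = 1"
  by (rule class_cases[of i g]) (auto simp: beta_conj_eq beta_power_exponent)

lemma char_on_class:
  assumes "projective_rep G \<alpha> d \<pi>" "i < m" "g \<in> C i"
  shows "mat_trace (\<pi> g) = beta_conj G \<alpha> (c0 i) g * mat_trace (\<pi> (c0 i))"
    and "mat_trace (projective_rep.\<pi>_inv G \<alpha> \<pi> g) = mat_trace (projective_rep.\<pi>_inv G \<alpha> \<pi> (c0 i)) / beta_conj G \<alpha> (c0 i) g"
proof -
  interpret projective_rep G \<alpha> d \<pi> by fact
  obtain h where "h \<in> carrier G" "g = h \<otimes> c0 i \<otimes> inv h" using class_cases[OF assms(2,3)] .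
  then show "mat_trace (\<pi> g) = beta_conj G \<alpha> (c0 i) g * mat_trace (\<pi> (c0 i))"
    "mat_trace (\<pi>_inv g) = mat_trace (\<pi>_inv (c0 i)) / beta_conj G \<alpha> (c0 i) g"
    using assms by (simp_all add: char_conj char_inv_conj beta_conj_eq)
qed

lemma sum_over_classes:
  assumes "\<And>g. g \<in> carrier G \<Longrightarrow> \<not> regular_element G \<alpha> g \<Longrightarrow> F g = 0"
  shows "(\<Sum>g\<in>carrier G. F g) = (\<Sum>i<m. \<Sum>g\<in>C i. F g)"
proof -
  have "(\<Sum>i<m. \<Sum>g\<in>C i. F g) = (\<Sum>g\<in>(\<Union>i<m. C i). F g)"
  proof (rule sum.UNION_disjoint[symmetric])
    show "\<forall>i\<in>{..<m}. finite (C i)" using class_subset finite_subset[OF _ finite_carrier] by blast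
    show "\<forall>i\<in>{..<m}. \<forall>j\<in>{..<m}. i \<noteq> j \<longrightarrow> C i \<inter> C j = {}" using class_disjoint by blast
  qed simp
  also have "\<dots> = (\<Sum>g\<in>carrier G. F g)"
  proof (rule sum.mono_neutral_left)
    show "\<forall>g\<in>carrier G - (\<Union>i<m. C i). F g = 0" using assms by (auto elim: regular_in_class)
  qed (use class_carrier in auto)
  finally show ?thesis ..
qed

lemma char_product_on_classes:
  assumes A: "projective_rep G \<alpha> d \<pi>" and B: "projective_rep G \<alpha> d' \<pi>'"
  shows "(\<Sum>g\<in>carrier G. mat_trace (\<pi> g) * mat_trace (projective_rep.\<pi>_inv G \<alpha> \<pi>' g)) =
    (\<Sum>i<m. of_nat (card (C i)) * mat_trace (\<pi> (c0 i)) * mat_trace (projective_rep.\<pi>_inv G \<alpha> \<pi>' (c0 i)))"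
proof -
  have "(\<Sum>g\<in>carrier G. mat_trace (\<pi> g) * mat_trace (projective_rep.\<pi>_inv G \<alpha> \<pi>' g)) =
    (\<Sum>i<m. \<Sum>g\<in>C i. mat_trace (\<pi> g) * mat_trace (projective_rep.\<pi>_inv G \<alpha> \<pi>' g))"
    by (rule sum_over_classes) (simp add: projective_rep.char_nonregular[OF A])
  also have "\<dots> = (\<Sum>i<m. \<Sum>g\<in>C i. mat_trace (\<pi> (c0 i)) * mat_trace (projective_rep.\<pi>_inv G \<alpha> \<pi>' (c0 i)))"
    by (intro sum.cong refl) (simp add: char_on_class(1)[OF A] char_on_class(2)[OF B] beta_conj_nonzero)
  finally show ?thesis by (simp add: mult.assoc)
qed

text \<open>The twisted class function with value \<open>u i\<close> at the \<open>i\<close>-th representative; its values on the rest of the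
class are forced by the conjugation factors, and it vanishes on elements that are not regular.\<close>

definition class_fun :: "(nat \<Rightarrow> complex) \<Rightarrow> 'g \<Rightarrow> complex" where
  "class_fun u g = (\<Sum>i<m. if g \<in> C i then u i / beta_conj G \<alpha> (c0 i) g else 0)"

lemma class_fun_on_class:
  assumes "i < m" "g \<in> C i" shows "class_fun u g = u i / beta_conj G \<alpha> (c0 i) g"
proof -
  have "class_fun u g = (\<Sum>j<m. if j = i then u i / beta_conj G \<alpha> (c0 i) g else 0)"
    unfolding class_fun_def using assms class_disjoint by (intro sum.cong) auto
  then show ?thesis using assms by (simp add: sum.delta)
qed

lemma class_fun_nonregular: "\<not> regular_element G \<alpha> g \<Longrightarrow> class_fun u g = 0"
  unfolding class_fun_def by (intro sum.neutral) (auto dest: class_regular)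

lemma class_fun_conj:
  assumes "x \<in> carrier G" "g \<in> carrier G"
  shows "class_fun u (x \<otimes> g \<otimes> inv x) = class_fun u g / beta G \<alpha> x g"
  unfolding class_fun_def sum_divide_distrib
  using assms by (intro sum.cong) (auto simp: class_conj beta_conj_conj)

lemma sum_class_fun_char:
  assumes A: "projective_rep G \<alpha> d \<pi>"
  shows "(\<Sum>g\<in>carrier G. class_fun u g * mat_trace (\<pi> g)) = (\<Sum>i<m. u i * of_nat (card (C i)) * mat_trace (\<pi> (c0 i)))"
proof -
  have "(\<Sum>g\<in>carrier G. class_fun u g * mat_trace (\<pi> g)) = (\<Sum>i<m. \<Sum>g\<in>C i. class_fun u g * mat_trace (\<pi> g))"
    by (rule sum_over_classes) (simp add: class_fun_nonregular)
  also have "\<dots> = (\<Sum>i<m. \<Sum>g\<in>C i. u i * mat_trace (\<pi> (c0 i)))"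
    by (intro sum.cong refl) (simp add: class_fun_on_class char_on_class(1)[OF A] beta_conj_nonzero)
  finally show ?thesis by (simp add: mult_ac)
qed

lemma class_fun_acts_as_scalar:
  assumes A: "irreducible_rep G \<alpha> d \<pi>"
  obtains c where "projective_rep.rep_lin G d \<pi> (class_fun u) = c \<cdot>\<^sub>m 1\<^sub>m d"
    "c * of_nat d = (\<Sum>i<m. u i * of_nat (card (C i)) * mat_trace (\<pi> (c0 i)))"
proof -
  interpret irreducible_rep G \<alpha> d \<pi> by fact
  have comm: "\<pi> x * rep_lin (class_fun u) = rep_lin (class_fun u) * \<pi> x" if "x \<in> carrier G" for x
    using that by (intro rep_lin_central class_fun_conj)
  obtain c where "rep_lin (class_fun u) = c \<cdot>\<^sub>m 1\<^sub>m d" "mat_trace (rep_lin (class_fun u)) = c * of_nat d"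
    by (rule schur_scalar[OF rep_lin_carrier comm])
  then show thesis using that trace_rep_lin[of "class_fun u"] sum_class_fun_char[OF projective_rep_axioms, of u] by simp
qed

end

section \<open>The number of irreducible characters\<close>

context twisted_group
begin

text \<open>An eigenspace of a central operator is invariant, and an invariant subspace of least positive
dimension in it is irreducible. The matrix \<open>B\<close> is the inclusion of that subspace.\<close>

lemma irreducible_in_eigenspace:
  assumes \<rho>: "projective_rep G \<alpha> n \<rho>" and T: "T \<in> carrier_mat n n"
    and comm: "\<And>g. g \<in> carrier G \<Longrightarrow> \<rho> g * T = T * \<rho> g"
    and ev: "eigenvalue T c"
  obtains d \<pi> B where "irreducible_rep G \<alpha> d \<pi>" "injective_mat n d B" "T * B = c \<cdot>\<^sub>m B"
    "\<And>g. g \<in> carrier G \<Longrightarrow> \<rho> g * B = B * \<pi> g"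
proof -
  interpret R: projective_rep G \<alpha> n \<rho> by fact
  \<comment> \<open>invariant subspaces of the eigenspace, given by their inclusion matrices\<close>
  define P where "P = (\<lambda>d B. d > 0 \<and> injective_mat n d B \<and> T * B = c \<cdot>\<^sub>m B \<and>
    (\<forall>g\<in>carrier G. \<exists>U\<in>carrier_mat d d. \<rho> g * B = B * U))"
  have "\<exists>d B. P d B"
  proof -
    define V where "V = {v \<in> carrier_vec n. T *\<^sub>v v = c \<cdot>\<^sub>v v}"
    have "closed_subspace n V" unfolding V_def using T by (rule closed_subspace_eigenspace)
    then obtain d B where B: "injective_mat n d B" and VB: "V = (\<lambda>x. B *\<^sub>v x) ` carrier_vec d"
      using subspace_obtain_mat by blast
    have Bc: "B \<in> carrier_mat n d" using B by (rule injective_mat_carrier)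
    obtain v where v: "v \<in> V" "v \<noteq> 0\<^sub>v n" using ev T by (auto simp: eigenvalue_def eigenvector_def V_def)
    have "d > 0"
    proof (rule ccontr)
      assume "\<not> d > 0"
      then have "v = 0\<^sub>v n" using v(1) Bc unfolding VB by (auto intro!: eq_vecI simp: scalar_prod_def)
      then show False using v(2) by simp
    qed
    moreover have "T * B = c \<cdot>\<^sub>m B"
    proof (rule mat_eq_if_mult_vec_eq[of _ n d])
      fix x :: "complex vec" assume x: "x \<in> carrier_vec d"
      then have "B *\<^sub>v x \<in> V" by (simp add: VB)
      then show "T * B *\<^sub>v x = c \<cdot>\<^sub>m B *\<^sub>v x"
        using x T Bc by (simp add: V_def smult_mat_mult_vec[OF Bc] assoc_mult_mat_vec[of T n n B d])
    qed (use T Bc in auto)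
    moreover have "\<exists>U\<in>carrier_mat d d. \<rho> g * B = B * U" if g: "g \<in> carrier G" for g
    proof -
      have "\<rho> g *\<^sub>v v \<in> V" if "v \<in> V" for v
      proof -
        have v: "v \<in> carrier_vec n" "T *\<^sub>v v = c \<cdot>\<^sub>v v" using that by (auto simp: V_def)
        have "T *\<^sub>v (\<rho> g *\<^sub>v v) = \<rho> g *\<^sub>v (T *\<^sub>v v)"
          using g v(1) T comm[OF g] assoc_mult_mat_vec[OF T R.rep_carrier[OF g] v(1)]
            assoc_mult_mat_vec[OF R.rep_carrier[OF g] T v(1)] by simp
        also have "\<dots> = c \<cdot>\<^sub>v (\<rho> g *\<^sub>v v)" using v g by (simp add: mult_mat_vec[of _ n n])
        finally show ?thesis using g v by (simp add: V_def R.square_vec_simps)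
      qed
      then show ?thesis using invariant_image_factor[OF Bc R.rep_carrier[OF g]] unfolding VB by blast
    qed
    ultimately have "P d B" using B by (simp add: P_def)
    then show ?thesis by blast
  qed
  define d where "d = (LEAST d. \<exists>B. P d B)"
  have "\<exists>B. P d B" unfolding d_def using \<open>\<exists>d B. P d B\<close> by (rule LeastI_ex)
  then obtain B where B: "P d B" by blast
  have least: "d \<le> k" if "P k C" for k C unfolding d_def using that by (intro Least_le) blast
  have inj: "injective_mat n d B" and TB: "T * B = c \<cdot>\<^sub>m B" and d: "d > 0" using B by (auto simp: P_def)
  have Bc: "B \<in> carrier_mat n d" using inj by (rule injective_mat_carrier)
  have "\<forall>g. \<exists>U. g \<in> carrier G \<longrightarrow> U \<in> carrier_mat d d \<and> \<rho> g * B = B * U" using B by (auto simp: P_def)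
  then obtain \<pi> where \<pi>: "\<And>g. g \<in> carrier G \<Longrightarrow> \<pi> g \<in> carrier_mat d d"
    "\<And>g. g \<in> carrier G \<Longrightarrow> \<rho> g * B = B * \<pi> g" by metis
  have rep: "projective_rep G \<alpha> d \<pi>"
  proof (rule projective_repI)
    fix x y assume xy: "x \<in> carrier G" "y \<in> carrier G"
    have "B * (\<pi> x * \<pi> y) = \<rho> x * \<rho> y * B"
      using xy \<pi> Bc assoc_mult_mat[OF Bc \<pi>(1)[OF xy(1)] \<pi>(1)[OF xy(2)]]
        assoc_mult_mat[OF R.rep_carrier[OF xy(1)] R.rep_carrier[OF xy(2)] Bc]
        assoc_mult_mat[OF R.rep_carrier[OF xy(1)] Bc \<pi>(1)[OF xy(2)]] by simp
    also have "\<dots> = \<alpha> x y \<cdot>\<^sub>m (\<rho> (x \<otimes> y) * B)" using xy Bc by (simp add: R.rep_mult mult_smult_assoc_mat[of _ n n _ d])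
    also have "\<dots> = B * (\<alpha> x y \<cdot>\<^sub>m \<pi> (x \<otimes> y))" using xy \<pi> Bc by (simp add: mult_smult_distrib[of _ n d _ d])
    finally show "\<pi> x * \<pi> y = \<alpha> x y \<cdot>\<^sub>m \<pi> (x \<otimes> y)"
      using injective_mat_cancel[OF inj, of "\<pi> x * \<pi> y" d "\<alpha> x y \<cdot>\<^sub>m \<pi> (x \<otimes> y)"] xy \<pi>(1)
      by (simp add: mult_carrier_mat[of _ d d _ d])
  next
    have "B * \<pi> \<one> = B * 1\<^sub>m d" using \<pi>(2)[of \<one>] Bc by (simp add: R.rep_one)
    then show "\<pi> \<one> = 1\<^sub>m d" using injective_mat_cancel[OF inj, of "\<pi> \<one>" d "1\<^sub>m d"] \<pi>(1) by simp
  qed (rule \<pi>(1))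
  \<comment> \<open>a smaller invariant subspace of the new representation would be a smaller one of the old\<close>
  have triv: "W = {0\<^sub>v d} \<or> W = carrier_vec d"
    if W: "closed_subspace d W" and Winv: "\<And>g w. g \<in> carrier G \<Longrightarrow> w \<in> W \<Longrightarrow> \<pi> g *\<^sub>v w \<in> W" for W
  proof -
    obtain k C where C: "injective_mat d k C" and WC: "W = (\<lambda>x. C *\<^sub>v x) ` carrier_vec k"
      using subspace_obtain_mat[OF W] .
    have Cc: "C \<in> carrier_mat d k" using C by (rule injective_mat_carrier)
    show ?thesis
    proof (cases "k = 0")
      case True
      have "w = 0\<^sub>v d" if "w \<in> W" for w using that Cc True unfolding WC by (auto intro!: eq_vecI simp: scalar_prod_def)
      then show ?thesis using W by (auto simp: closed_subspace_def)
    next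
      case False
      have "P k (B * C)"
        unfolding P_def
      proof (intro conjI ballI)
        show "injective_mat n k (B * C)" using inj C by (rule injective_mat_mult)
        show "T * (B * C) = c \<cdot>\<^sub>m (B * C)"
          using assoc_mult_mat[OF T Bc Cc] TB Bc Cc by (simp add: mult_smult_assoc_mat[of _ n d _ k])
        fix g assume g: "g \<in> carrier G"
        obtain U where U: "U \<in> carrier_mat k k" "\<pi> g * C = C * U"
          using invariant_image_factor[OF Cc \<pi>(1)[OF g]] Winv[OF g] unfolding WC by blast
        have "\<rho> g * (B * C) = B * C * U"
          using assoc_mult_mat[OF R.rep_carrier[OF g] Bc Cc] assoc_mult_mat[OF Bc \<pi>(1)[OF g] Cc]
            assoc_mult_mat[OF Bc Cc U(1)] \<pi>(2)[OF g] U(2) by simp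
        then show "\<exists>U\<in>carrier_mat k k. \<rho> g * (B * C) = B * C * U" using U by blast
      qed (use False in simp)
      then have kd: "k = d" using least[of k "B * C"] injective_mat_le[OF C] by simp
      have "y \<in> W" if "y \<in> carrier_vec d" for y
        using injective_square_surj[OF C[unfolded kd] that] unfolding WC kd by blast
      then have "W = carrier_vec d" using W by (auto simp: closed_subspace_def)
      then show ?thesis by simp
    qed
  qed
  have "irreducible_proj_rep G \<alpha> d \<pi>"
    unfolding irreducible_proj_rep_def closed_subspace_iff
    using projective_rep.rep[OF rep] d triv by blast
  then show thesis using irreducible_repI inj TB \<pi>(2) by (intro that) auto
qed

lemma irreducible_characters_cases:
  assumes "\<chi> \<in> irreducible_characters G \<alpha>"
  obtains d \<pi> where "irreducible_rep G \<alpha> d \<pi>" "\<chi> = proj_character G \<pi>"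
  using assms irreducible_repI by (auto simp: irreducible_characters_def)

lemma irreducible_characters_memI: "irreducible_rep G \<alpha> d \<pi> \<Longrightarrow> proj_character G \<pi> \<in> irreducible_characters G \<alpha>"
  by (auto simp: irreducible_characters_def dest: irreducible_rep.irr)

lemma proj_character_eq [simp]: "g \<in> carrier G \<Longrightarrow> proj_character G \<pi> g = mat_trace (\<pi> g)"
  by (simp add: proj_character_def)

lemma proj_character_eqI:
  "(\<And>g. g \<in> carrier G \<Longrightarrow> mat_trace (\<pi> g) = mat_trace (\<pi>' g)) \<Longrightarrow> proj_character G \<pi> = proj_character G \<pi>'"
  by (auto simp: proj_character_def restrict_def)

text \<open>The trace of the inverse of \<open>\<pi>(g)\<close>, in terms of the character \<open>\<chi>\<close> of \<open>\<pi>\<close>.\<close>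

definition dual :: "('g \<Rightarrow> complex) \<Rightarrow> 'g \<Rightarrow> complex" where
  "dual \<chi> g = \<chi> (inv g) / \<alpha> g (inv g)"

lemma trace_inv_eq_dual:
  assumes "projective_rep G \<alpha> d \<pi>" "g \<in> carrier G"
  shows "mat_trace (projective_rep.\<pi>_inv G \<alpha> \<pi> g) = dual (proj_character G \<pi>) g"
proof -
  interpret projective_rep G \<alpha> d \<pi> by fact
  show ?thesis using assms(2) by (simp add: \<pi>_inv_def dual_def mat_trace_smult[of _ d])
qed

end

context class_enum
begin

lemma class_orthogonality:
  assumes "\<chi> \<in> irreducible_characters G \<alpha>" "\<psi> \<in> irreducible_characters G \<alpha>"
  shows "(\<Sum>i<m. of_nat (card (C i)) * \<chi> (c0 i) * dual \<psi> (c0 i)) = (if \<chi> = \<psi> then of_nat (card (carrier G)) else 0)"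
proof -
  obtain d \<pi> where A: "irreducible_rep G \<alpha> d \<pi>" and \<chi>: "\<chi> = proj_character G \<pi>"
    using irreducible_characters_cases[OF assms(1)] .
  obtain d' \<pi>' where B: "irreducible_rep G \<alpha> d' \<pi>'" and \<psi>: "\<psi> = proj_character G \<pi>'"
    using irreducible_characters_cases[OF assms(2)] .
  interpret A: irreducible_rep G \<alpha> d \<pi> by fact
  interpret B: irreducible_rep G \<alpha> d' \<pi>' by fact
  show ?thesis
  proof (cases "\<chi> = \<psi>")
    case True
    have "(\<Sum>i<m. of_nat (card (C i)) * \<chi> (c0 i) * dual \<psi> (c0 i)) =
      (\<Sum>i<m. of_nat (card (C i)) * mat_trace (\<pi> (c0 i)) * mat_trace (A.\<pi>_inv (c0 i)))"
      by (intro sum.cong refl) (simp add: True[symmetric] \<chi> trace_inv_eq_dual[OF A.projective_rep_axioms])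
    also have "\<dots> = of_nat (card (carrier G))"
      using char_product_on_classes[OF A.projective_rep_axioms A.projective_rep_axioms] character_orthogonality_same[OF A] by simp
    finally show ?thesis using True by simp
  next
    case False
    then have neq: "\<exists>g\<in>carrier G. mat_trace (\<pi> g) \<noteq> mat_trace (\<pi>' g)"
      unfolding \<chi> \<psi> using proj_character_eqI by blast
    have "(\<Sum>i<m. of_nat (card (C i)) * \<chi> (c0 i) * dual \<psi> (c0 i)) =
      (\<Sum>i<m. of_nat (card (C i)) * mat_trace (\<pi> (c0 i)) * mat_trace (B.\<pi>_inv (c0 i)))"
      by (intro sum.cong refl) (simp add: \<chi> \<psi> trace_inv_eq_dual[OF B.projective_rep_axioms])
    also have "\<dots> = 0"
      using char_product_on_classes[OF A.projective_rep_axioms B.projective_rep_axioms] character_orthogonality_distinct[OF A B neq] by simp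
    finally show ?thesis using False by simp
  qed
qed

text \<open>The weighted class sum of \<open>C k\<close> acts as a scalar \<open>c\<close> with \<open>c d = \<bar>C k\<bar> \<chi>(c0 k)\<close>, where \<open>d\<close> is the degree. The trace of its
product with \<open>\<pi>(c0 i)\<close> is computed from this and from \<open>\<pi>(a) \<pi>(c0 i) = \<alpha>(a, c0 i) \<pi>(a c0 i)\<close>, and the values of
\<open>\<chi>\<close> are then reduced to those at the representatives.\<close>

lemma class_equation:
  assumes A: "irreducible_rep G \<alpha> d \<pi>" and k: "k < m" and i: "i < m"
  shows "(\<Sum>j<m. (\<Sum>a | a \<in> C k \<and> a \<otimes> c0 i \<in> C j.
       beta_conj G \<alpha> (c0 j) (a \<otimes> c0 i) / beta_conj G \<alpha> (c0 k) a * \<alpha> a (c0 i)) * mat_trace (\<pi> (c0 j))) * of_nat d =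
     of_nat (card (C k)) * mat_trace (\<pi> (c0 k)) * mat_trace (\<pi> (c0 i))"
proof -
  interpret irreducible_rep G \<alpha> d \<pi> by fact
  \<comment> \<open>the class function that belongs to the weighted sum over \<open>C k\<close>\<close>
  define u where "u = (\<lambda>j. if j = k then 1 else 0 :: complex)"
  have finC: "finite (C k)" using class_subset[OF k] finite_carrier by (rule finite_subset)
  have cc: "c0 i \<in> carrier G" using i by simp
  obtain c where c: "rep_lin (class_fun u) = c \<cdot>\<^sub>m 1\<^sub>m d"
    "c * of_nat d = (\<Sum>j<m. u j * of_nat (card (C j)) * mat_trace (\<pi> (c0 j)))"
    using class_fun_acts_as_scalar[OF A, of u] .
  have "(\<Sum>j<m. u j * of_nat (card (C j)) * \<chi> (c0 j)) = (\<Sum>j<m. if j = k then of_nat (card (C k)) * \<chi> (c0 k) else 0)"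
    by (intro sum.cong) (auto simp: u_def)
  then have cd: "c * of_nat d = of_nat (card (C k)) * \<chi> (c0 k)" using c(2) k by (simp add: sum.delta)
  \<comment> \<open>a character is determined by its values at the representatives\<close>
  have expand: "\<chi> g = (\<Sum>j<m. if g \<in> C j then beta_conj G \<alpha> (c0 j) g * \<chi> (c0 j) else 0)" if g: "g \<in> carrier G" for g
  proof (cases "regular_element G \<alpha> g")
    case True
    then obtain j where j: "j < m" "g \<in> C j" by (rule regular_in_class)
    have "(\<Sum>l<m. if g \<in> C l then beta_conj G \<alpha> (c0 l) g * \<chi> (c0 l) else 0) = (\<Sum>l<m. if l = j then \<chi> g else 0)"
      using j class_disjoint char_on_class(1)[OF projective_rep_axioms j] by (intro sum.cong refl) auto
    then show ?thesis using j by (simp add: sum.delta)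
  next
    case False
    then have "(\<Sum>l<m. if g \<in> C l then beta_conj G \<alpha> (c0 l) g * \<chi> (c0 l) else 0) = 0"
      by (intro sum.neutral) (auto dest: class_regular)
    then show ?thesis using char_nonregular[OF g False] by simp
  qed
  have "mat_trace (rep_lin (class_fun u) * \<pi> (c0 i)) = (\<Sum>g\<in>carrier G. class_fun u g * (\<alpha> g (c0 i) * \<chi> (g \<otimes> c0 i)))"
  proof -
    have "rep_lin (class_fun u) * \<pi> (c0 i) = mat_sum d d (\<lambda>g. class_fun u g \<cdot>\<^sub>m \<pi> g * \<pi> (c0 i)) (carrier G)"
      unfolding rep_lin_def using cc by (intro mat_sum_mult_right) auto
    also have "\<dots> = mat_sum d d (\<lambda>g. (class_fun u g * \<alpha> g (c0 i)) \<cdot>\<^sub>m \<pi> (g \<otimes> c0 i)) (carrier G)"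
      using cc by (intro mat_sum_cong) (simp add: square_simps rep_mult)
    finally show ?thesis using cc by (simp add: trace_mat_sum mat_trace_smult[of _ d] mult.assoc)
  qed
  also have "\<dots> = (\<Sum>a\<in>C k. class_fun u a * (\<alpha> a (c0 i) * \<chi> (a \<otimes> c0 i)))"
  proof (rule sum.mono_neutral_right)
    show "\<forall>g\<in>carrier G - C k. class_fun u g * (\<alpha> g (c0 i) * \<chi> (g \<otimes> c0 i)) = 0"
      by (auto simp: class_fun_def u_def intro!: sum.neutral)
  qed (use class_subset[OF k] in auto)
  also have "\<dots> = (\<Sum>a\<in>C k. \<Sum>j<m. if a \<otimes> c0 i \<in> C j then
      beta_conj G \<alpha> (c0 j) (a \<otimes> c0 i) / beta_conj G \<alpha> (c0 k) a * \<alpha> a (c0 i) * \<chi> (c0 j) else 0)"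
  proof (intro sum.cong refl)
    fix a assume a: "a \<in> C k"
    then have "a \<otimes> c0 i \<in> carrier G" using class_carrier[OF k] cc by simp
    then show "class_fun u a * (\<alpha> a (c0 i) * \<chi> (a \<otimes> c0 i)) = (\<Sum>j<m. if a \<otimes> c0 i \<in> C j then
      beta_conj G \<alpha> (c0 j) (a \<otimes> c0 i) / beta_conj G \<alpha> (c0 k) a * \<alpha> a (c0 i) * \<chi> (c0 j) else 0)"
      by (subst expand) (auto simp: class_fun_on_class[OF k a] u_def sum_distrib_left intro!: sum.cong)
  qed
  also have "\<dots> = (\<Sum>j<m. \<Sum>a\<in>C k. if a \<otimes> c0 i \<in> C j then
      beta_conj G \<alpha> (c0 j) (a \<otimes> c0 i) / beta_conj G \<alpha> (c0 k) a * \<alpha> a (c0 i) * \<chi> (c0 j) else 0)" by (rule sum.swap)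
  also have "\<dots> = (\<Sum>j<m. (\<Sum>a | a \<in> C k \<and> a \<otimes> c0 i \<in> C j.
       beta_conj G \<alpha> (c0 j) (a \<otimes> c0 i) / beta_conj G \<alpha> (c0 k) a * \<alpha> a (c0 i)) * \<chi> (c0 j))"
    using finC by (intro sum.cong refl) (simp add: sum_distrib_right flip: sum.inter_filter)
  finally have "mat_trace (rep_lin (class_fun u) * \<pi> (c0 i)) = \<dots>" .
  moreover have "mat_trace (rep_lin (class_fun u) * \<pi> (c0 i)) = c * \<chi> (c0 i)"
    unfolding c(1) using cc by (simp add: square_simps mat_trace_smult[of _ d])
  ultimately have "(\<Sum>j<m. (\<Sum>a | a \<in> C k \<and> a \<otimes> c0 i \<in> C j.
       beta_conj G \<alpha> (c0 j) (a \<otimes> c0 i) / beta_conj G \<alpha> (c0 k) a * \<alpha> a (c0 i)) * \<chi> (c0 j)) * of_nat d = c * \<chi> (c0 i) * of_nat d"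
    by simp
  also have "\<dots> = c * of_nat d * \<chi> (c0 i)" by (simp add: mult_ac)
  finally show ?thesis unfolding cd .
qed

text \<open>A class function orthogonal to all irreducible characters vanishes. It gives a central operator \<open>T\<close> on
the regular representation. If its coefficient at \<open>g\<^sub>0\<close> is not zero, then \<open>T\<close> times the inverse of
\<open>\<rho>(g\<^sub>0)\<close> has nonzero trace, hence a nonzero eigenvalue; on that eigenspace \<open>T\<close> has an eigenvector, and its
eigenvalue \<open>c\<close> is nonzero because the two factors commute. An irreducible representation inside the
\<open>c\<close>-eigenspace of \<open>T\<close> gives a contradiction: there \<open>T\<close> acts as \<open>c\<close>, but by orthogonality as zero.\<close>

lemma class_fun_complete:
  assumes orth: "\<And>\<chi>. \<chi> \<in> irreducible_characters G \<alpha> \<Longrightarrow> (\<Sum>i<m. u i * of_nat (card (C i)) * \<chi> (c0 i)) = 0"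
    and k: "k < m"
  shows "u k = 0"
proof (rule ccontr)
  assume uk: "u k \<noteq> 0"
  define n where "n = card (carrier G)"
  have n_pos: "n > 0" unfolding n_def by (rule card_carrier_pos)
  interpret R: projective_rep G \<alpha> n regular_rep unfolding n_def by (rule regular_rep_projective)
  define T where "T = R.rep_lin (class_fun u)"
  \<comment> \<open>an element at which the class function, and so a coefficient of \<open>T\<close>, is not zero\<close>
  define g0 where "g0 = c0 k"
  have g0: "g0 \<in> carrier G" using k by (simp add: g0_def)
  have f0: "class_fun u g0 \<noteq> 0"
    using uk k representative[OF k] beta_conj_nonzero[OF k] by (simp add: g0_def class_fun_on_class)
  have T: "T \<in> carrier_mat n n" by (simp add: T_def)
  have comm: "regular_rep g * T = T * regular_rep g" if "g \<in> carrier G" for g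
    unfolding T_def using that by (intro R.rep_lin_central class_fun_conj)
  define R0 where "R0 = R.\<pi>_inv g0"
  have R0: "R0 \<in> carrier_mat n n" using g0 by (simp add: R0_def)
  have commR: "R0 * T = T * R0"
    using comm[of "inv g0"] g0 T by (simp add: R0_def R.\<pi>_inv_def R.square_simps)
  \<comment> \<open>only the term \<open>g = g0\<close> contributes: in the regular representation all other elements have trace zero\<close>
  have "mat_trace (T * R0) = (\<Sum>g\<in>carrier G. class_fun u g * mat_trace (regular_rep g * R0))"
  proof -
    have "T * R0 = mat_sum n n (\<lambda>g. class_fun u g \<cdot>\<^sub>m regular_rep g * R0) (carrier G)"
      unfolding T_def R.rep_lin_def using R0 by (intro mat_sum_mult_right) auto
    then show ?thesis using R0 by (simp add: trace_mat_sum mat_trace_smult[of _ n] R.square_simps)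
  qed
  also have "\<dots> = (\<Sum>g\<in>carrier G. if g = g0 then class_fun u g0 * of_nat n else 0)"
  proof (intro sum.cong refl)
    fix g assume g: "g \<in> carrier G"
    have "regular_rep g * R0 = (1 / \<alpha> g0 (inv g0) * \<alpha> g (inv g0)) \<cdot>\<^sub>m regular_rep (g \<otimes> inv g0)"
      using g g0 by (simp add: R0_def R.\<pi>_inv_def R.square_simps R.rep_mult)
    then have "mat_trace (regular_rep g * R0) = (1 / \<alpha> g0 (inv g0) * \<alpha> g (inv g0)) * (if g \<otimes> inv g0 = \<one> then of_nat n else 0)"
      using g g0 trace_regular_rep[of "g \<otimes> inv g0"] mat_trace_smult[of "regular_rep (g \<otimes> inv g0)" n]
      by (simp flip: n_def)
    moreover have "g \<otimes> inv g0 = \<one> \<longleftrightarrow> g = g0"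
    proof
      assume "g \<otimes> inv g0 = \<one>"
      then have "g = inv (inv g0)" using g g0 by (intro inv_equality[symmetric]) auto
      then show "g = g0" using g0 by simp
    qed (use g0 in auto)
    ultimately show "class_fun u g * mat_trace (regular_rep g * R0) = (if g = g0 then class_fun u g0 * of_nat n else 0)"
      using g0 by auto
  qed
  also have "\<dots> = class_fun u g0 * of_nat n" using g0 by (simp add: sum.delta)
  finally have "mat_trace (T * R0) \<noteq> 0" using f0 n_pos by simp
  then obtain \<mu> where \<mu>: "eigenvalue (T * R0) \<mu>" "\<mu> \<noteq> 0"
    using nonzero_trace_imp_nonzero_eigenvalue[of "T * R0" n] T R0 by auto
  define W where "W = {v \<in> carrier_vec n. (T * R0) *\<^sub>v v = \<mu> \<cdot>\<^sub>v v}"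
  have TR0: "T * R0 \<in> carrier_mat n n" using T R0 by simp
  have "closed_subspace n W" unfolding W_def using TR0 by (rule closed_subspace_eigenspace)
  then obtain l B where B: "injective_mat n l B" and WB: "W = (\<lambda>x. B *\<^sub>v x) ` carrier_vec l"
    using subspace_obtain_mat by blast
  have Bc: "B \<in> carrier_mat n l" using B by (rule injective_mat_carrier)
  obtain v where v: "v \<in> W" "v \<noteq> 0\<^sub>v n" using \<mu>(1) T by (auto simp: eigenvalue_def eigenvector_def W_def)
  have "l > 0"
  proof (rule ccontr)
    assume "\<not> l > 0"
    then have "v = 0\<^sub>v n" using v(1) Bc unfolding WB by (auto intro!: eq_vecI simp: scalar_prod_def)
    then show False using v(2) by simp
  qed
  \<comment> \<open>\<open>T\<close> commutes with \<open>T * R0\<close>, so it acts on the eigenspace \<open>W\<close>\<close>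
  have "T *\<^sub>v w \<in> W" if "w \<in> W" for w
  proof -
    have w: "w \<in> carrier_vec n" "(T * R0) *\<^sub>v w = \<mu> \<cdot>\<^sub>v w" using that by (auto simp: W_def)
    have "(T * R0) *\<^sub>v (T *\<^sub>v w) = T *\<^sub>v ((R0 * T) *\<^sub>v w)"
      using T R0 w by (simp add: assoc_mult_mat_vec[of _ n n _ n])
    also have "\<dots> = \<mu> \<cdot>\<^sub>v (T *\<^sub>v w)" unfolding commR using w T by (simp add: mult_mat_vec[of _ n n])
    finally show ?thesis using T w by (simp add: W_def mult_mat_vec_carrier[of _ n n])
  qed
  then obtain T0 where T0: "T0 \<in> carrier_mat l l" "T * B = B * T0"
    using invariant_image_factor[OF Bc T] unfolding WB by blast
  obtain c where "eigenvalue T0 c" using exists_eigenvalue[OF T0(1) \<open>l > 0\<close>] .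
  then obtain x where x: "x \<in> carrier_vec l" "x \<noteq> 0\<^sub>v l" "T0 *\<^sub>v x = c \<cdot>\<^sub>v x"
    using T0 by (auto simp: eigenvalue_def eigenvector_def)
  define y where "y = B *\<^sub>v x"
  have y: "y \<in> carrier_vec n" "y \<noteq> 0\<^sub>v n" "y \<in> W" using x B Bc by (auto simp: y_def injective_mat_def WB)
  have Ty: "T *\<^sub>v y = c \<cdot>\<^sub>v y"
    using assoc_mult_mat_vec[OF T Bc x(1)] assoc_mult_mat_vec[OF Bc T0(1) x(1)] T0(2) x(3) mult_mat_vec[OF Bc x(1)]
    by (simp add: y_def)
  then have evT: "eigenvalue T c" using y T by (auto simp: eigenvalue_def eigenvector_def)
  \<comment> \<open>a vector of \<open>W\<close> killed by \<open>T\<close> would be killed by \<open>R0 * T = T * R0\<close>, whose eigenvalue on \<open>W\<close> is \<open>\<mu>\<close>\<close>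
  have "c \<noteq> 0"
  proof
    assume c0: "c = 0"
    have "0 \<cdot>\<^sub>v y = 0\<^sub>v n" using y(1) by (intro eq_vecI) auto
    then have "T *\<^sub>v y = 0\<^sub>v n" using Ty c0 by simp
    then have "(R0 * T) *\<^sub>v y = 0\<^sub>v n" using R0 T y(1) by (simp add: assoc_mult_mat_vec[of _ n n _ n])
    then have "\<mu> \<cdot>\<^sub>v y = 0\<^sub>v n" using y(3) commR by (simp add: W_def)
    then have "\<mu> * y $ i = 0" if "i < n" for i using that y(1) by (metis carrier_vecD index_smult_vec(1) index_zero_vec(1))
    then have "y = 0\<^sub>v n" using \<mu>(2) y(1) by (intro eq_vecI) auto
    then show False using y(2) by simp
  qed
  obtain d \<pi> D where irr: "irreducible_rep G \<alpha> d \<pi>" and D: "injective_mat n d D" "T * D = c \<cdot>\<^sub>m D"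
    and act: "\<And>g. g \<in> carrier G \<Longrightarrow> regular_rep g * D = D * \<pi> g"
    by (rule irreducible_in_eigenspace[OF R.projective_rep_axioms T comm evT]) (assumption | rule that)+
  interpret P: irreducible_rep G \<alpha> d \<pi> by fact
  have Dc: "D \<in> carrier_mat n d" using D(1) by (rule injective_mat_carrier)
  have "T * D = mat_sum n d (\<lambda>g. (class_fun u g \<cdot>\<^sub>m regular_rep g) * D) (carrier G)"
    unfolding T_def R.rep_lin_def using Dc by (intro mat_sum_mult_right) auto
  also have "\<dots> = mat_sum n d (\<lambda>g. D * (class_fun u g \<cdot>\<^sub>m \<pi> g)) (carrier G)"
    using Dc act by (intro mat_sum_cong) (simp add: mult_smult_assoc_mat[of _ n n _ d] mult_smult_distrib[of _ n d _ d])
  also have "\<dots> = D * P.rep_lin (class_fun u)"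
    unfolding P.rep_lin_def using Dc by (intro mat_sum_mult_left[symmetric]) auto
  finally have TD: "T * D = D * P.rep_lin (class_fun u)" .
  obtain s where s: "P.rep_lin (class_fun u) = s \<cdot>\<^sub>m 1\<^sub>m d"
    "s * of_nat d = (\<Sum>i<m. u i * of_nat (card (C i)) * mat_trace (\<pi> (c0 i)))"
    using class_fun_acts_as_scalar[OF irr, of u] .
  have "s * of_nat d = 0" unfolding s(2) using orth[OF irreducible_characters_memI[OF irr]] by simp
  then have "s = 0" using P.dim_pos by simp
  have "c \<cdot>\<^sub>m D = D * (0 \<cdot>\<^sub>m 1\<^sub>m d)" using D(2) TD s(1) \<open>s = 0\<close> by simp
  then have "D * (c \<cdot>\<^sub>m 1\<^sub>m d) = D * (0 \<cdot>\<^sub>m 1\<^sub>m d)" using Dc by (simp add: mult_smult_distrib[of _ n d _ d])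
  then have "c \<cdot>\<^sub>m 1\<^sub>m d = (0 \<cdot>\<^sub>m 1\<^sub>m d :: complex mat)"
    using injective_mat_cancel[OF D(1), of "c \<cdot>\<^sub>m 1\<^sub>m d" d "0 \<cdot>\<^sub>m 1\<^sub>m d"] by simp
  then have "(c \<cdot>\<^sub>m 1\<^sub>m d) $$ (0,0) = (0 \<cdot>\<^sub>m 1\<^sub>m d :: complex mat) $$ (0,0)" by simp
  then show False using P.dim_pos \<open>c \<noteq> 0\<close> by simp
qed

text \<open>More than \<open>m\<close> characters would be linearly dependent on the \<open>m\<close> regular classes, against
orthogonality.\<close>

lemma card_le_if_subset_irreducible_characters:
  assumes "finite S" "S \<subseteq> irreducible_characters G \<alpha>"
  shows "card S \<le> m"
proof (rule ccontr)
  assume "\<not> card S \<le> m"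
  obtain f where f: "bij_betw f {..<card S} S"
    using ex_bij_betw_nat_finite[OF assms(1)] by (auto simp: atLeast0LessThan)
  define s where "s = card S"
  define M where "M = mat m s (\<lambda>(i,j). f j (c0 i))"
  obtain x where x: "x \<in> carrier_vec s" "x \<noteq> 0\<^sub>v s" "M *\<^sub>v x = 0\<^sub>v m"
    using wide_mat_kernel[of M m s] \<open>\<not> card S \<le> m\<close> by (auto simp: M_def s_def)
  have irr: "f j \<in> irreducible_characters G \<alpha>" if "j < s" for j using f assms(2) that by (auto simp: bij_betw_def s_def)
  have row: "(\<Sum>j<s. f j (c0 i) * x $ j) = 0" if "i < m" for i
  proof -
    have "(M *\<^sub>v x) $ i = 0" using x(3) that by simp
    then show ?thesis using x(1) that by (simp add: M_def scalar_prod_def atLeast0LessThan)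
  qed
  have "x $ l = 0" if l: "l < s" for l
  proof -
    have "0 = (\<Sum>i<m. of_nat (card (C i)) * dual (f l) (c0 i) * (\<Sum>j<s. f j (c0 i) * x $ j))"
      using row by simp
    also have "\<dots> = (\<Sum>i<m. \<Sum>j<s. x $ j * (of_nat (card (C i)) * f j (c0 i) * dual (f l) (c0 i)))"
      by (simp add: sum_distrib_left mult_ac)
    also have "\<dots> = (\<Sum>j<s. \<Sum>i<m. x $ j * (of_nat (card (C i)) * f j (c0 i) * dual (f l) (c0 i)))" by (rule sum.swap)
    also have "\<dots> = (\<Sum>j<s. x $ j * (if f j = f l then of_nat (card (carrier G)) else 0))"
      using irr l by (intro sum.cong refl) (simp add: class_orthogonality flip: sum_distrib_left)
    also have "\<dots> = (\<Sum>j<s. if j = l then x $ l * of_nat (card (carrier G)) else 0)"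
      using f l by (intro sum.cong refl) (auto simp: bij_betw_def inj_on_def s_def)
    also have "\<dots> = x $ l * of_nat (card (carrier G))" using l by (simp add: sum.delta)
    finally show ?thesis using one_closed by auto
  qed
  then have "x = 0\<^sub>v s" using x(1) by (intro eq_vecI) auto
  then show False using x(2) by simp
qed

lemma finite_irreducible_characters: "finite (irreducible_characters G \<alpha>)"
  using card_le_if_subset_irreducible_characters by (rule finite_if_finite_subsets_card_bdd[THEN conjunct1])

lemma card_irreducible_characters: "card (irreducible_characters G \<alpha>) = m"
proof (rule antisym)
  show "card (irreducible_characters G \<alpha>) \<le> m"
    by (rule card_le_if_subset_irreducible_characters[OF finite_irreducible_characters order_refl])
  show "m \<le> card (irreducible_characters G \<alpha>)"
  proof (rule ccontr)
    define s where "s = card (irreducible_characters G \<alpha>)"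
    assume "\<not> m \<le> card (irreducible_characters G \<alpha>)"
    obtain f where f: "bij_betw f {..<s} (irreducible_characters G \<alpha>)"
      using ex_bij_betw_nat_finite[OF finite_irreducible_characters] by (auto simp: atLeast0LessThan s_def)
    define M where "M = mat s m (\<lambda>(j,i). of_nat (card (C i)) * f j (c0 i))"
    obtain x where x: "x \<in> carrier_vec m" "x \<noteq> 0\<^sub>v m" "M *\<^sub>v x = 0\<^sub>v s"
      using wide_mat_kernel[of M s m] \<open>\<not> m \<le> _\<close> by (auto simp: M_def s_def)
    have orth: "(\<Sum>i<m. x $ i * of_nat (card (C i)) * \<chi> (c0 i)) = 0" if \<chi>: "\<chi> \<in> irreducible_characters G \<alpha>" for \<chi>
    proof -
      have "\<chi> \<in> f ` {..<s}" using f \<chi> by (simp add: bij_betw_def)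
      then obtain j where j: "j < s" "\<chi> = f j" by auto
      then have "(M *\<^sub>v x) $ j = 0" using x(3) by simp
      then show ?thesis using x(1) j by (simp add: M_def scalar_prod_def atLeast0LessThan mult_ac)
    qed
    have "x $ k = 0" if "k < m" for k using class_fun_complete[of "\<lambda>i. x $ i", OF orth that] .
    then have "x = 0\<^sub>v m" using x(1) by (intro eq_vecI) auto
    then show False using x(2) by simp
  qed
qed

end

section \<open>The reduction map and the multiplicities of eigenvalues\<close>

context projective_rep
begin

lemma power_trace_multiplicities:
  assumes \<zeta>: "primitive_root_of_unity (multiplier_exponent G \<alpha>) \<zeta>" and g: "g \<in> carrier G"
  shows "(\<Prod>i=1..<n. \<alpha> (g [^] i) g) * \<chi> (g [^] n) =
      (\<Sum>k<multiplier_exponent G \<alpha>. of_nat (eigenvalue_multiplicity (\<pi> g) (\<zeta> ^ k)) * \<zeta> ^ (k * n))"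
    and "eigenvalue_multiplicity (\<pi> g) x \<le> d"
proof -
  define e where "e = multiplier_exponent G \<alpha>"
  have e: "e > 0" using exponent_pos by (simp add: e_def)
  obtain as where as: "length as = d" "char_poly (\<pi> g) = (\<Prod>a\<leftarrow>as. [:- a, 1:])" "\<And>k. mat_trace (\<pi> g ^\<^sub>m k) = (\<Sum>a\<leftarrow>as. a ^ k)"
    using trace_pow_eigenvalues[OF rep_carrier[OF g]] by blast
  have mult: "eigenvalue_multiplicity (\<pi> g) x = count_list as x" for x
    by (simp add: eigenvalue_multiplicity_def as(2) order_prod_linear)
  have sub: "set as \<subseteq> (\<lambda>k. \<zeta> ^ k) ` {..<e}"
  proof
    fix a assume "a \<in> set as"
    then have "a ^ e = 1"
      using eigenvalue_root_of_unity[OF g] eigenvalue_iff_in_list[OF rep_carrier[OF g] as(2)] by (simp add: e_def)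
    then show "a \<in> (\<lambda>k. \<zeta> ^ k) ` {..<e}" using root_of_unity_is_power[OF \<zeta>[folded e_def] e] by blast
  qed
  have "(\<Prod>i=1..<n. \<alpha> (g [^] i) g) * \<chi> (g [^] n) = mat_trace (\<pi> g ^\<^sub>m n)"
    using g by (simp add: rep_pow mat_trace_smult[of _ d])
  also have "\<dots> = (\<Sum>a\<in>(\<lambda>k. \<zeta> ^ k) ` {..<e}. of_nat (count_list as a) * a ^ n)"
    unfolding as(3) using sub by (intro sum_list_eq_sum_count) auto
  also have "\<dots> = (\<Sum>k<e. of_nat (count_list as (\<zeta> ^ k)) * (\<zeta> ^ k) ^ n)"
    by (rule sum.reindex[OF primitive_root_power_inj[OF \<zeta>[folded e_def] e], unfolded comp_def])
  finally show "(\<Prod>i=1..<n. \<alpha> (g [^] i) g) * \<chi> (g [^] n) =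
      (\<Sum>k<multiplier_exponent G \<alpha>. of_nat (eigenvalue_multiplicity (\<pi> g) (\<zeta> ^ k)) * \<zeta> ^ (k * n))"
    by (simp add: mult e_def power_mult)
  show "eigenvalue_multiplicity (\<pi> g) x \<le> d"
    unfolding mult using count_le_length[of as x] as(1) by simp
qed

lemma char_in_int_adjoin:
  assumes \<zeta>: "primitive_root_of_unity (multiplier_exponent G \<alpha>) \<zeta>" and g: "g \<in> carrier G"
  shows "\<chi> g \<in> int_adjoin \<zeta>"
proof -
  have "\<chi> g = (\<Sum>k<multiplier_exponent G \<alpha>. of_nat (eigenvalue_multiplicity (\<pi> g) (\<zeta> ^ k)) * \<zeta> ^ (k * 1))"
    using power_trace_multiplicities(1)[OF \<zeta> g, of 1] g by simp
  then show ?thesis by (auto intro!: int_adjoin_sum int_adjoin_closed int_adjoin_power)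
qed

end

locale dixon = twisted_group G \<alpha>
  for G :: "('g, 'more) monoid_scheme" (structure) and \<alpha> +
  fixes e :: nat and \<zeta> :: complex and z :: "'p::prime_card mod_ring"
  assumes e_def: "e = multiplier_exponent G \<alpha>"
    and \<zeta>: "primitive_root_of_unity e \<zeta>" and z: "primitive_root_of_unity e z"
    and p_large: "real CARD('p) > 2 * sqrt (real (card (carrier G)))"
    and p_cong: "e dvd CARD('p) - 1"
begin

definition \<theta> :: "complex \<Rightarrow> 'p mod_ring" where "\<theta> = theta \<zeta> z"

lemma e_pos: "e > 0" by (simp add: e_def exponent_pos)

lemma of_nat_eq_0_iff_p: "of_nat n = (0 :: 'p mod_ring) \<longleftrightarrow> CARD('p) dvd n"
  using of_nat_0_mod_ring_dvd[of n] by (auto elim!: dvdE)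

lemma of_nat_e_nonzero: "of_nat e \<noteq> (0 :: 'p mod_ring)"
proof
  assume "of_nat e = (0 :: 'p mod_ring)"
  then have "CARD('p) dvd CARD('p) - 1" using p_cong by (auto simp: of_nat_eq_0_iff_p intro: dvd_trans)
  moreover have "CARD('p) > 1" using prime_card[where 'a='p] by (rule prime_gt_1_nat)
  ultimately show False by (auto dest: dvd_imp_le)
qed

lemma well_defined:
  assumes "eval_int_poly f \<zeta> = eval_int_poly g \<zeta>"
  shows "eval_int_poly f z = eval_int_poly g z"
  using eval_int_poly_reduction[OF e_pos \<zeta> z of_nat_e_nonzero, of "f - g"] assms by simp

lemma theta_eval: "\<theta> (eval_int_poly f \<zeta>) = eval_int_poly f z"
  unfolding \<theta>_def theta_def
proof (rule the_equality)
  fix y assume "\<exists>g. eval_int_poly f \<zeta> = eval_int_poly g \<zeta> \<and> y = eval_int_poly g z"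
  then obtain g where "eval_int_poly f \<zeta> = eval_int_poly g \<zeta>" "y = eval_int_poly g z" by blast
  then show "y = eval_int_poly f z" using well_defined[of f g] by simp
qed blast

lemma theta_add: "x \<in> int_adjoin \<zeta> \<Longrightarrow> y \<in> int_adjoin \<zeta> \<Longrightarrow> \<theta> (x + y) = \<theta> x + \<theta> y"
proof -
  assume "x \<in> int_adjoin \<zeta>" "y \<in> int_adjoin \<zeta>"
  then obtain f g where "x = eval_int_poly f \<zeta>" "y = eval_int_poly g \<zeta>" by (auto simp: int_adjoin_def)
  then show ?thesis using theta_eval[of "f + g"] theta_eval[of f] theta_eval[of g] by simp
qed

lemma theta_mult: "x \<in> int_adjoin \<zeta> \<Longrightarrow> y \<in> int_adjoin \<zeta> \<Longrightarrow> \<theta> (x * y) = \<theta> x * \<theta> y"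
proof -
  assume "x \<in> int_adjoin \<zeta>" "y \<in> int_adjoin \<zeta>"
  then obtain f g where "x = eval_int_poly f \<zeta>" "y = eval_int_poly g \<zeta>" by (auto simp: int_adjoin_def)
  then show ?thesis using theta_eval[of "f * g"] theta_eval[of f] theta_eval[of g] by simp
qed

lemma theta_of_int: "\<theta> (of_int c) = of_int c"
  using theta_eval[of "[:c:]"] by simp

lemma theta_simps [simp]: "\<theta> 0 = 0" "\<theta> 1 = 1" "\<theta> (of_nat n) = of_nat n"
  using theta_of_int[of 0] theta_of_int[of 1] theta_of_int[of "int n"] by simp_all

lemma theta_root: "\<theta> \<zeta> = z"
  using theta_eval[of "[:0,1:]"] by simp

lemma theta_power: "x \<in> int_adjoin \<zeta> \<Longrightarrow> \<theta> (x ^ n) = \<theta> x ^ n"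
  by (induction n) (auto simp: theta_mult int_adjoin_power)

lemma theta_sum: "(\<And>i. i \<in> S \<Longrightarrow> F i \<in> int_adjoin \<zeta>) \<Longrightarrow> \<theta> (sum F S) = (\<Sum>i\<in>S. \<theta> (F i))"
  by (induction S rule: infinite_finite_induct) (auto simp: theta_add int_adjoin_sum)

lemma root_of_unity_in_int_adjoin: "x ^ e = 1 \<Longrightarrow> x \<in> int_adjoin \<zeta>"
  by (rule root_of_unity_is_power[OF \<zeta> e_pos, of x]) (auto intro: int_adjoin_power int_adjoin_root)

lemma theta_prod: "(\<And>i. i \<in> S \<Longrightarrow> F i \<in> int_adjoin \<zeta>) \<Longrightarrow> prod F S \<in> int_adjoin \<zeta> \<and> \<theta> (prod F S) = (\<Prod>i\<in>S. \<theta> (F i))"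
  by (induction S rule: infinite_finite_induct) (auto simp: theta_mult intro: int_adjoin_closed)

lemma theta_divide:
  assumes x: "x \<in> int_adjoin \<zeta>" and y: "y ^ e = 1"
  shows "x / y \<in> int_adjoin \<zeta>" "\<theta> (x / y) = \<theta> x / \<theta> y"
proof -
  have y0: "y \<noteq> 0" using y e_pos by (auto simp: zero_power)
  have "(1 / y) ^ e = 1" using y by (simp add: power_divide)
  then have yi: "1 / y \<in> int_adjoin \<zeta>" by (rule root_of_unity_in_int_adjoin)
  have xy: "x / y = x * (1 / y)" by simp
  show xin: "x / y \<in> int_adjoin \<zeta>" unfolding xy using x yi by (rule int_adjoin_closed)
  have yin: "y \<in> int_adjoin \<zeta>" using y by (rule root_of_unity_in_int_adjoin)
  have "\<theta> y ^ e = 1" using theta_power[OF yin, of e] y by simp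
  then have "\<theta> y \<noteq> 0" using e_pos by (auto simp: zero_power)
  moreover have "\<theta> (x / y) * \<theta> y = \<theta> x" using theta_mult[OF xin yin] y0 by simp
  ultimately show "\<theta> (x / y) = \<theta> x / \<theta> y" by (simp add: field_simps)
qed

lemma theta_ring_hom:
  "\<theta> \<in> Ring.ring_hom (ring_of_type_algebra\<lparr>carrier := int_adjoin \<zeta>\<rparr>) ring_of_type_algebra"
  by (simp add: Ring.ring_hom_def ring_of_type_algebra_def theta_add theta_mult)

lemma alpha_power_e: "x \<in> carrier G \<Longrightarrow> y \<in> carrier G \<Longrightarrow> \<alpha> x y ^ e = 1"
  using alpha_power_exponent by (simp add: e_def)

text \<open>Otherwise some element would have order \<open>p\<close>, by Cauchy's theorem, and \<open>p\<close> would divide the exponent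
\<open>e\<close>, which divides \<open>p - 1\<close>.\<close>

lemma p_not_dvd_order: "of_nat (card (carrier G)) \<noteq> (0 :: 'p mod_ring)"
proof
  assume "of_nat (card (carrier G)) = (0 :: 'p mod_ring)"
  \<comment> \<open>a Sylow subgroup statement with exponent one gives a subgroup of order \<open>p\<close>\<close>
  then obtain m where "card (carrier G) = CARD('p) * m" by (auto simp: of_nat_eq_0_iff_p elim: dvdE)
  then have "Coset.order G = CARD('p) ^ 1 * m" by (simp add: Coset.order_def)
  then obtain H where H: "subgroup H G" "card H = CARD('p)"
    using sylow_thm[OF prime_card[where 'a='p] is_group _ finite_carrier, of 1 m] by auto
  have p1: "CARD('p) > 1" using prime_card[where 'a='p] by (rule prime_gt_1_nat)
  then have "\<not> H \<subseteq> {\<one>}" using H(2) card_mono[of "{\<one>}" H] by auto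
  then obtain h where h: "h \<in> H" "h \<noteq> \<one>" by auto
  interpret H: group "G\<lparr>carrier := H\<rparr>" using H(1) by (rule subgroup.subgroup_is_group) (rule is_group)
  have hG: "h \<in> carrier G" using h H(1) subgroup.subset by blast
  have "h [^]\<^bsub>G\<lparr>carrier := H\<rparr>\<^esub> CARD('p) = \<one>"
    using H.pow_order_eq_1[of h] h H(2) by (simp add: Coset.order_def)
  then have "h [^] CARD('p) = \<one>" by (simp add: nat_pow_consistent[symmetric])
  then have "ord h dvd CARD('p)" using hG by (simp add: pow_eq_id)
  then have "ord h = CARD('p)" using h(2) hG ord_eq_1 prime_card[where 'a='p] by (auto simp: prime_nat_iff)
  moreover have "ord h dvd e"
    using order_in_multiplier_dvd_exponent[OF hG] order_in_multiplier[OF hG] by (metis dvd_trans dvd_triv_left e_def)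
  ultimately show False using of_nat_e_nonzero by (simp add: of_nat_eq_0_iff_p)
qed

lemma degree_less_p:
  assumes "irreducible_rep G \<alpha> d \<pi>"
  shows "d < CARD('p)" "of_nat d \<noteq> (0 :: 'p mod_ring)"
proof -
  interpret irreducible_rep G \<alpha> d \<pi> by fact
  have "real d ^ 2 \<le> real (card (carrier G))" using dim_square_le by (metis of_nat_le_iff of_nat_power)
  then have "real d \<le> sqrt (real (card (carrier G)))" by (rule real_le_rsqrt)
  then have "real d < real CARD('p)" using p_large real_sqrt_ge_zero[of "real (card (carrier G))"] by linarith
  then show "d < CARD('p)" by simp
  then show "of_nat d \<noteq> (0 :: 'p mod_ring)" using dim_pos by (auto simp: of_nat_eq_0_iff_p dest: dvd_imp_le)
qed

lemma char_integral: "projective_rep G \<alpha> d \<pi> \<Longrightarrow> g \<in> carrier G \<Longrightarrow> mat_trace (\<pi> g) \<in> int_adjoin \<zeta>"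
  using projective_rep.char_in_int_adjoin \<zeta> by (simp add: e_def)

text \<open>The reduced traces of the powers of \<open>\<pi>(g)\<close> are the discrete Fourier transform of the multiplicities,
and \<open>z\<close> is a primitive \<open>e\<close>-th root of unity, so the transform can be inverted.\<close>

lemma multiplicity_formula:
  assumes R: "projective_rep G \<alpha> d \<pi>" and g: "g \<in> carrier G" and k: "k < e"
  shows "(of_nat (eigenvalue_multiplicity (\<pi> g) (\<zeta> ^ k)) :: 'p mod_ring) = inverse (of_nat e) *
    (\<Sum>n<e. inverse z ^ (n * k) * \<theta> (mat_trace (\<pi> (g [^] n))) * (\<Prod>i=1..<n. \<theta> (\<alpha> (g [^] i) g)))"
proof -
  interpret projective_rep G \<alpha> d \<pi> by fact
  define \<mu> where "\<mu> = (\<lambda>k. eigenvalue_multiplicity (\<pi> g) (\<zeta> ^ k))"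
  have z0: "z \<noteq> 0" using z e_pos by (auto simp: primitive_root_of_unity_def zero_power)
  have ze: "z ^ e = 1" using z by (simp add: primitive_root_of_unity_def)
  have fourier: "\<theta> (\<chi> (g [^] n)) * (\<Prod>i=1..<n. \<theta> (\<alpha> (g [^] i) g)) = (\<Sum>j<e. of_nat (\<mu> j) * z ^ (j * n))" for n
  proof -
    have prod: "(\<Prod>i=1..<n. \<alpha> (g [^] i) g) \<in> int_adjoin \<zeta> \<and> \<theta> (\<Prod>i=1..<n. \<alpha> (g [^] i) g) = (\<Prod>i=1..<n. \<theta> (\<alpha> (g [^] i) g))"
      using g by (intro theta_prod root_of_unity_in_int_adjoin alpha_power_e) auto
    have "\<theta> (\<chi> (g [^] n)) * (\<Prod>i=1..<n. \<theta> (\<alpha> (g [^] i) g)) = \<theta> ((\<Prod>i=1..<n. \<alpha> (g [^] i) g) * \<chi> (g [^] n))"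
      using prod g char_integral[OF R] by (simp add: theta_mult mult.commute)
    also have "\<dots> = \<theta> (\<Sum>j<e. of_nat (\<mu> j) * \<zeta> ^ (j * n))"
      using power_trace_multiplicities(1)[of \<zeta> g n] \<zeta> g by (simp add: e_def \<mu>_def)
    also have "\<dots> = (\<Sum>j<e. of_nat (\<mu> j) * z ^ (j * n))"
      by (subst theta_sum) (auto simp: theta_mult theta_power theta_root int_adjoin_power int_adjoin_root intro: int_adjoin_closed)
    finally show ?thesis .
  qed
  \<comment> \<open>orthogonality of the characters of the cyclic group of order \<open>e\<close>\<close>
  have geo: "(\<Sum>n<e. inverse z ^ (n * k) * z ^ (j * n)) = (if j = k then of_nat e else 0)" if j: "j < e" for j
  proof -
    define w where "w = inverse z ^ k * z ^ j"
    have "w * z ^ k = z ^ j" using z0 by (simp add: w_def power_inverse field_simps)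
    then have "w = 1 \<Longrightarrow> j = k"
      using inj_onD[OF primitive_root_power_inj[OF z e_pos], of k j] j k by auto
    moreover have "j = k \<Longrightarrow> w = 1" using z0 by (simp add: w_def power_inverse)
    ultimately have w1: "w = 1 \<longleftrightarrow> j = k" by blast
    have "w ^ e = 1" using ze power_power_eq_one[of z e] by (simp add: w_def power_mult_distrib power_inverse)
    have "(\<Sum>n<e. inverse z ^ (n * k) * z ^ (j * n)) = (\<Sum>n<e. w ^ n)"
      by (intro sum.cong refl) (simp add: w_def power_mult_distrib mult.commute flip: power_mult)
    also have "\<dots> = (if j = k then of_nat e else 0)"
      using w1 \<open>w ^ e = 1\<close> by (cases "w = 1") (simp_all add: geometric_sum)
    finally show ?thesis .
  qed
  have "(\<Sum>n<e. inverse z ^ (n * k) * \<theta> (\<chi> (g [^] n)) * (\<Prod>i=1..<n. \<theta> (\<alpha> (g [^] i) g))) =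
      (\<Sum>n<e. \<Sum>j<e. of_nat (\<mu> j) * (inverse z ^ (n * k) * z ^ (j * n)))"
    using fourier by (simp add: mult.assoc sum_distrib_left mult.left_commute)
  also have "\<dots> = (\<Sum>j<e. of_nat (\<mu> j) * (\<Sum>n<e. inverse z ^ (n * k) * z ^ (j * n)))"
    by (subst sum.swap) (simp add: sum_distrib_left)
  also have "\<dots> = (\<Sum>j<e. if j = k then of_nat (\<mu> k) * of_nat e else 0)"
    using geo by (intro sum.cong) auto
  also have "\<dots> = of_nat (\<mu> k) * of_nat e" using k by (simp add: sum.delta)
  finally show ?thesis using of_nat_e_nonzero by (simp add: \<mu>_def)
qed

end

section \<open>The class matrices modulo p\<close>

locale dixon_classes = dixon G \<alpha> e \<zeta> z + class_enum G \<alpha> m C c0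
  for G :: "('g, 'more) monoid_scheme" (structure) and \<alpha> e \<zeta> and z :: "'p::prime_card mod_ring" and m C c0
begin

text \<open>The class matrices and the reduced character vectors of the theorem.\<close>

definition M :: "nat \<Rightarrow> 'p mod_ring mat" where "M = class_matrix G \<alpha> \<theta> m C c0"
definition w :: "('g \<Rightarrow> complex) \<Rightarrow> 'p mod_ring vec" where "w = character_vec \<theta> m c0"

lemma M_carrier [simp]: "M k \<in> carrier_mat m m" by (simp add: M_def class_matrix_def)
lemma w_carrier [simp]: "w \<chi> \<in> carrier_vec m" by (simp add: w_def character_vec_def)

lemma M_dim [simp]: "dim_row (M k) = m" "dim_col (M k) = m" by (simp_all add: M_def class_matrix_def)
lemma w_dim [simp]: "dim_vec (w \<chi>) = m" by (simp add: w_def character_vec_def)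
lemma w_index [simp]: "j < m \<Longrightarrow> w \<chi> $ j = \<theta> (\<chi> (c0 j))" by (simp add: w_def character_vec_def)

text \<open>The scalar by which the weighted class sum of \<open>C k\<close> acts on a representation of degree \<open>d\<close> with character \<open>\<chi>\<close>, reduced modulo \<open>p\<close>.\<close>

definition class_eigenvalue :: "nat \<Rightarrow> ('g \<Rightarrow> complex) \<Rightarrow> nat \<Rightarrow> 'p mod_ring" where
  "class_eigenvalue d \<chi> k = of_nat (card (C k)) * \<theta> (\<chi> (c0 k)) * inverse (of_nat d)"

text \<open>The class equation lies in the ring generated by \<open>\<zeta>\<close>, so \<open>\<theta>\<close> can be applied to it; the degree \<open>d\<close> is
moved to the other side only afterwards, as \<open>1/d\<close> need not lie in that ring.\<close>

lemma eigen_equation: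
  assumes A: "irreducible_rep G \<alpha> d \<pi>" and k: "k < m"
  shows "M k *\<^sub>v w (proj_character G \<pi>) = class_eigenvalue d (proj_character G \<pi>) k \<cdot>\<^sub>v w (proj_character G \<pi>)"
proof (rule eq_vecI)
  interpret irreducible_rep G \<alpha> d \<pi> by fact
  note ch = char_integral[OF projective_rep_axioms]
  let ?\<chi> = "proj_character G \<pi>"
  fix i assume "i < dim_vec (class_eigenvalue d ?\<chi> k \<cdot>\<^sub>v w ?\<chi>)"
  then have i: "i < m" by simp
  define F where "F = (\<lambda>j a. beta_conj G \<alpha> (c0 j) (a \<otimes> c0 i) / beta_conj G \<alpha> (c0 k) a * \<alpha> a (c0 i))"
  have F: "F j a \<in> int_adjoin \<zeta>"
    "\<theta> (F j a) = \<theta> (beta_conj G \<alpha> (c0 j) (a \<otimes> c0 i)) / \<theta> (beta_conj G \<alpha> (c0 k) a) * \<theta> (\<alpha> a (c0 i))"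
    if "j < m" "a \<in> C k" "a \<otimes> c0 i \<in> C j" for j a
  proof -
    have 1: "beta_conj G \<alpha> (c0 j) (a \<otimes> c0 i) \<in> int_adjoin \<zeta>"
      using beta_conj_power[OF that(1,3)] by (intro root_of_unity_in_int_adjoin) (simp add: e_def)
    have 2: "beta_conj G \<alpha> (c0 k) a ^ e = 1" using beta_conj_power[OF k that(2)] by (simp add: e_def)
    have 3: "\<alpha> a (c0 i) \<in> int_adjoin \<zeta>"
      using class_carrier[OF k that(2)] i by (intro root_of_unity_in_int_adjoin alpha_power_e) auto
    show "F j a \<in> int_adjoin \<zeta>" unfolding F_def using theta_divide(1)[OF 1 2] 3 by (rule int_adjoin_closed)
    show "\<theta> (F j a) = \<theta> (beta_conj G \<alpha> (c0 j) (a \<otimes> c0 i)) / \<theta> (beta_conj G \<alpha> (c0 k) a) * \<theta> (\<alpha> a (c0 i))"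
      unfolding F_def using theta_mult[OF theta_divide(1)[OF 1 2] 3] theta_divide(2)[OF 1 2] by simp
  qed
  define S where "S = (\<lambda>j. {a \<in> C k. a \<otimes> c0 i \<in> C j})"
  have entry: "M k $$ (i,j) = \<theta> (\<Sum>a\<in>S j. F j a)" if "j < m" for j
  proof -
    have "M k $$ (i,j) = (\<Sum>a\<in>S j. \<theta> (beta_conj G \<alpha> (c0 j) (a \<otimes> c0 i)) / \<theta> (beta_conj G \<alpha> (c0 k) a) * \<theta> (\<alpha> a (c0 i)))"
      using that i by (simp add: M_def class_matrix_def S_def)
    also have "\<dots> = (\<Sum>a\<in>S j. \<theta> (F j a))" using F(2)[OF that] by (intro sum.cong) (auto simp: S_def)
    also have "\<dots> = \<theta> (\<Sum>a\<in>S j. F j a)"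
      using F(1)[OF that] by (intro theta_sum[symmetric]) (auto simp: S_def)
    finally show ?thesis .
  qed
  have Sin: "(\<Sum>a\<in>S j. F j a) \<in> int_adjoin \<zeta>" if "j < m" for j
    using F that by (intro int_adjoin_sum) (auto simp: S_def)
  have "(M k *\<^sub>v w ?\<chi>) $ i = (\<Sum>j<m. M k $$ (i,j) * \<theta> (\<chi> (c0 j)))"
    using i by (simp add: scalar_prod_def atLeast0LessThan)
  also have "\<dots> = (\<Sum>j<m. \<theta> ((\<Sum>a\<in>S j. F j a) * \<chi> (c0 j)))"
    using Sin ch by (intro sum.cong) (auto simp: entry theta_mult)
  also have "\<dots> = \<theta> (\<Sum>j<m. (\<Sum>a\<in>S j. F j a) * \<chi> (c0 j))"
    using Sin ch by (intro theta_sum[symmetric] int_adjoin_closed) auto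
  moreover have "(\<Sum>j<m. (\<Sum>a\<in>S j. F j a) * \<chi> (c0 j)) \<in> int_adjoin \<zeta>"
    by (rule int_adjoin_sum, rule int_adjoin_closed(2)) (use Sin ch in auto)
  ultimately have "(M k *\<^sub>v w ?\<chi>) $ i * of_nat d = \<theta> ((\<Sum>j<m. (\<Sum>a\<in>S j. F j a) * \<chi> (c0 j)) * of_nat d)"
    by (simp add: theta_mult)
  also have "(\<Sum>j<m. (\<Sum>a\<in>S j. F j a) * \<chi> (c0 j)) * of_nat d = of_nat (card (C k)) * \<chi> (c0 k) * \<chi> (c0 i)"
    unfolding S_def F_def by (rule class_equation[OF A k i])
  also have "\<theta> \<dots> = of_nat (card (C k)) * \<theta> (\<chi> (c0 k)) * \<theta> (\<chi> (c0 i))"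
    using ch k i by (simp add: theta_mult int_adjoin_closed)
  finally show "(M k *\<^sub>v w ?\<chi>) $ i = (class_eigenvalue d ?\<chi> k \<cdot>\<^sub>v w ?\<chi>) $ i"
    using degree_less_p(2)[OF A] i k by (simp add: class_eigenvalue_def field_simps)
qed simp

definition irr :: "nat \<Rightarrow> 'g \<Rightarrow> complex" where
  "irr = (SOME f. bij_betw f {..<m} (irreducible_characters G \<alpha>))"

lemma bij_irr: "bij_betw irr {..<m} (irreducible_characters G \<alpha>)"
proof -
  have "\<exists>f. bij_betw f {..<m} (irreducible_characters G \<alpha>)"
    using ex_bij_betw_nat_finite[OF finite_irreducible_characters]
    by (simp add: atLeast0LessThan card_irreducible_characters)
  then show ?thesis unfolding irr_def by (rule someI_ex)
qed

lemma irr_mem: "j < m \<Longrightarrow> irr j \<in> irreducible_characters G \<alpha>"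
  using bij_irr by (auto simp: bij_betw_def)

lemma irr_eq_iff: "j < m \<Longrightarrow> l < m \<Longrightarrow> irr j = irr l \<longleftrightarrow> j = l"
  using bij_irr by (auto simp: bij_betw_def inj_on_def)

lemma irr_cases:
  assumes "\<chi> \<in> irreducible_characters G \<alpha>" obtains j where "j < m" "\<chi> = irr j"
  using assms bij_irr by (auto simp: bij_betw_def)

text \<open>The degree is determined by the character, as its value at the identity.\<close>

definition deg :: "('g \<Rightarrow> complex) \<Rightarrow> nat" where
  "deg \<chi> = (SOME d. \<exists>\<pi>. irreducible_rep G \<alpha> d \<pi> \<and> \<chi> = proj_character G \<pi>)"

lemma deg_rep:
  assumes "\<chi> \<in> irreducible_characters G \<alpha>"
  obtains \<pi> where "irreducible_rep G \<alpha> (deg \<chi>) \<pi>" "\<chi> = proj_character G \<pi>"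
proof -
  have "\<exists>d \<pi>. irreducible_rep G \<alpha> d \<pi> \<and> \<chi> = proj_character G \<pi>"
    using irreducible_characters_cases[OF assms] by metis
  then have "\<exists>\<pi>. irreducible_rep G \<alpha> (deg \<chi>) \<pi> \<and> \<chi> = proj_character G \<pi>"
    unfolding deg_def by (rule someI_ex)
  then show thesis using that by blast
qed

lemma character_one:
  assumes "irreducible_rep G \<alpha> d \<pi>" shows "proj_character G \<pi> \<one> = of_nat d"
proof -
  interpret irreducible_rep G \<alpha> d \<pi> by fact
  show ?thesis by (simp add: rep_one mat_trace_one)
qed

lemma deg_eq: "irreducible_rep G \<alpha> d \<pi> \<Longrightarrow> deg (proj_character G \<pi>) = d"
proof -
  assume A: "irreducible_rep G \<alpha> d \<pi>"
  obtain \<pi>' where B: "irreducible_rep G \<alpha> (deg (proj_character G \<pi>)) \<pi>'" "proj_character G \<pi> = proj_character G \<pi>'"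
    using deg_rep[OF irreducible_characters_memI[OF A]] .
  have "of_nat (deg (proj_character G \<pi>)) = (of_nat d :: complex)"
    using character_one[OF A] character_one[OF B(1)] B(2) by simp
  then show ?thesis by (simp only: of_nat_eq_iff)
qed

definition irr_eigenvalue :: "nat \<Rightarrow> nat \<Rightarrow> 'p mod_ring" where "irr_eigenvalue j k = class_eigenvalue (deg (irr j)) (irr j) k"

lemma eigen_equation_irr: "j < m \<Longrightarrow> k < m \<Longrightarrow> M k *\<^sub>v w (irr j) = irr_eigenvalue j k \<cdot>\<^sub>v w (irr j)"
  using eigen_equation deg_rep[OF irr_mem[of j]] unfolding irr_eigenvalue_def by metis

lemma deg_nonzero: "j < m \<Longrightarrow> of_nat (deg (irr j)) \<noteq> (0 :: 'p mod_ring)"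
  using degree_less_p(2) deg_rep[OF irr_mem[of j]] by metis

lemma irr_integral: "j < m \<Longrightarrow> g \<in> carrier G \<Longrightarrow> irr j g \<in> int_adjoin \<zeta>"
proof -
  assume j: "j < m" and g: "g \<in> carrier G"
  obtain \<pi> where A: "irreducible_rep G \<alpha> (deg (irr j)) \<pi>" "irr j = proj_character G \<pi>" using deg_rep[OF irr_mem[OF j]] .
  interpret irreducible_rep G \<alpha> "deg (irr j)" \<pi> by (rule A(1))
  show ?thesis using char_integral[OF projective_rep_axioms g] A(2) g by simp
qed

lemma dual_integral: "j < m \<Longrightarrow> g \<in> carrier G \<Longrightarrow> dual (irr j) g \<in> int_adjoin \<zeta>"
  unfolding dual_def by (intro theta_divide(1) irr_integral alpha_power_e) auto

lemma theta_orthogonality: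
  assumes "j < m" "l < m"
  shows "(\<Sum>i<m. of_nat (card (C i)) * \<theta> (irr l (c0 i)) * \<theta> (dual (irr j) (c0 i))) =
     (if j = l then of_nat (card (carrier G)) else 0)"
proof -
  have in_A: "of_nat (card (C i)) * irr l (c0 i) * dual (irr j) (c0 i) \<in> int_adjoin \<zeta>" if "i < m" for i
    using that assms by (intro int_adjoin_closed(2)) (auto simp: irr_integral dual_integral)
  have "(\<Sum>i<m. of_nat (card (C i)) * \<theta> (irr l (c0 i)) * \<theta> (dual (irr j) (c0 i))) =
    (\<Sum>i<m. \<theta> (of_nat (card (C i)) * irr l (c0 i) * dual (irr j) (c0 i)))"
    using assms by (intro sum.cong) (auto simp: theta_mult irr_integral dual_integral int_adjoin_closed)
  also have "\<dots> = \<theta> (\<Sum>i<m. of_nat (card (C i)) * irr l (c0 i) * dual (irr j) (c0 i))"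
    using in_A by (intro theta_sum[symmetric]) auto
  also have "\<dots> = (if j = l then of_nat (card (carrier G)) else 0)"
    unfolding class_orthogonality[OF irr_mem[OF assms(2)] irr_mem[OF assms(1)]] using irr_eq_iff[OF assms] by auto
  finally show ?thesis .
qed

text \<open>The columns of \<open>char_table\<close> are the vectors \<open>w\<^sub>\<chi>\<close>. By orthogonality \<open>dual_table\<close> is its inverse, so it computes
the coordinates of a vector in this basis.\<close>

definition char_table :: "'p mod_ring mat" where "char_table = mat m m (\<lambda>(i,j). \<theta> (irr j (c0 i)))"
definition dual_table :: "'p mod_ring mat" where
  "dual_table = mat m m (\<lambda>(j,i). of_nat (card (C i)) * \<theta> (dual (irr j) (c0 i)) / of_nat (card (carrier G)))"
definition eigenvalue_mat :: "nat \<Rightarrow> 'p mod_ring mat" where "eigenvalue_mat k = mat m m (\<lambda>(i,j). if i = j then irr_eigenvalue j k else 0)"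

lemma basis_carrier [simp]: "char_table \<in> carrier_mat m m" "dual_table \<in> carrier_mat m m" "eigenvalue_mat k \<in> carrier_mat m m"
  by (simp_all add: char_table_def dual_table_def eigenvalue_mat_def)

lemma basis_dim [simp]: "dim_row char_table = m" "dim_col char_table = m" "dim_row dual_table = m" "dim_col dual_table = m"
    "dim_row (eigenvalue_mat k) = m" "dim_col (eigenvalue_mat k) = m"
  by (simp_all add: char_table_def dual_table_def eigenvalue_mat_def)

lemma dual_table_mult: "dual_table * char_table = 1\<^sub>m m"
proof (rule eq_matI)
  fix j l assume "j < dim_row (1\<^sub>m m :: 'p mod_ring mat)" "l < dim_col (1\<^sub>m m :: 'p mod_ring mat)"
  then have jl: "j < m" "l < m" by auto
  have "(dual_table * char_table) $$ (j,l) = (\<Sum>i<m. of_nat (card (C i)) * \<theta> (dual (irr j) (c0 i)) / of_nat (card (carrier G)) * \<theta> (irr l (c0 i)))"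
    using jl by (simp add: dual_table_def char_table_def scalar_prod_def atLeast0LessThan)
  also have "\<dots> = (\<Sum>i<m. of_nat (card (C i)) * \<theta> (irr l (c0 i)) * \<theta> (dual (irr j) (c0 i))) / of_nat (card (carrier G))"
    unfolding sum_divide_distrib by (intro sum.cong) auto
  also have "\<dots> = 1\<^sub>m m $$ (j,l)" unfolding theta_orthogonality[OF jl] using jl p_not_dvd_order by simp
  finally show "(dual_table * char_table) $$ (j,l) = 1\<^sub>m m $$ (j,l)" .
qed (auto simp: dual_table_def char_table_def)

lemma table_mult_dual: "char_table * dual_table = 1\<^sub>m m"
  using mat_mult_left_right_inverse[OF _ _ dual_table_mult] by simp

lemma col_char_table: "j < m \<Longrightarrow> col char_table j = w (irr j)"
  by (intro eq_vecI) (auto simp: char_table_def)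

lemma M_mult_char_table: assumes k: "k < m" shows "M k * char_table = char_table * eigenvalue_mat k"
proof (rule eq_matI)
  fix i j assume "i < dim_row (char_table * eigenvalue_mat k)" "j < dim_col (char_table * eigenvalue_mat k)"
  then have ij: "i < m" "j < m" by (auto simp: char_table_def eigenvalue_mat_def)
  have "(M k * char_table) $$ (i,j) = (M k *\<^sub>v w (irr j)) $ i"
    using ij col_char_table[OF ij(2)] by (simp add: char_table_def)
  also have "\<dots> = irr_eigenvalue j k * \<theta> (irr j (c0 i))" using eigen_equation_irr[OF ij(2) k] ij by simp
  also have "\<dots> = (\<Sum>l<m. if l = j then irr_eigenvalue j k * \<theta> (irr j (c0 i)) else 0)" using ij by (simp add: sum.delta)
  also have "\<dots> = (\<Sum>l<m. char_table $$ (i,l) * eigenvalue_mat k $$ (l,j))"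
    using ij by (intro sum.cong) (auto simp: char_table_def eigenvalue_mat_def)
  also have "\<dots> = (char_table * eigenvalue_mat k) $$ (i,j)"
    using ij carrier_matD[OF basis_carrier(1)] carrier_matD[OF basis_carrier(3)[of k]] by (simp add: scalar_prod_def atLeast0LessThan)
  finally show "(M k * char_table) $$ (i,j) = (char_table * eigenvalue_mat k) $$ (i,j)" .
qed (auto simp: char_table_def eigenvalue_mat_def)

lemma M_diagonalised: assumes k: "k < m" shows "M k = char_table * eigenvalue_mat k * dual_table"
proof -
  have "M k * char_table * dual_table = M k * (char_table * dual_table)" by (simp add: assoc_mult_mat[of _ m m _ m _ m])
  then show ?thesis unfolding M_mult_char_table[OF k, symmetric] table_mult_dual by simp
qed

lemma M_jointly_diagonalisable: "jointly_diagonalisable (M ` {..<m})"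
  unfolding jointly_diagonalisable_def
proof (rule exI[of _ char_table], rule exI[of _ dual_table], rule ballI)
  fix A assume "A \<in> M ` {..<m}"
  then obtain k where k: "k < m" "A = M k" by auto
  have "similar_mat_wit A (eigenvalue_mat k) char_table dual_table"
    unfolding k(2) using M_diagonalised[OF k(1)] by (rule similar_mat_witI[OF table_mult_dual dual_table_mult]) simp_all
  moreover have "diagonal_mat (eigenvalue_mat k)" by (simp add: diagonal_mat_def eigenvalue_mat_def)
  ultimately show "\<exists>Dg. diagonal_mat Dg \<and> similar_mat_wit A Dg char_table dual_table" by blast
qed

lemma eigenvalue_mat_vec:
  assumes "x \<in> carrier_vec m" "j < m"
  shows "(eigenvalue_mat k *\<^sub>v x) $ j = irr_eigenvalue j k * x $ j"
proof -
  have "(eigenvalue_mat k *\<^sub>v x) $ j = (\<Sum>l<m. (if j = l then irr_eigenvalue l k else 0) * x $ l)"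
    using assms by (simp add: eigenvalue_mat_def scalar_prod_def atLeast0LessThan)
  also have "\<dots> = (\<Sum>l<m. if l = j then irr_eigenvalue j k * x $ j else 0)" by (intro sum.cong) auto
  finally show ?thesis using assms(2) by (simp add: sum.delta)
qed

lemma eigen_coordinates:
  assumes v: "v \<in> carrier_vec m" and k: "k < m" and "M k *\<^sub>v v = \<kappa> \<cdot>\<^sub>v v" and j: "j < m"
  shows "irr_eigenvalue j k * (dual_table *\<^sub>v v) $ j = \<kappa> * (dual_table *\<^sub>v v) $ j"
proof -
  have Dv: "dual_table *\<^sub>v v \<in> carrier_vec m" by (rule mult_mat_vec_carrier[OF basis_carrier(2) v])
  have "dual_table * M k = dual_table * (char_table * (eigenvalue_mat k * dual_table))"
    using M_diagonalised[OF k] assoc_mult_mat[OF basis_carrier(1) basis_carrier(3) basis_carrier(2)] by simp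
  also have "\<dots> = dual_table * char_table * (eigenvalue_mat k * dual_table)"
    by (simp add: assoc_mult_mat[of _ m m _ m _ m] mult_carrier_mat[of _ m m _ m])
  also have "\<dots> = eigenvalue_mat k * dual_table" unfolding dual_table_mult
    by (rule left_mult_one_mat[of _ m m]) (simp add: mult_carrier_mat[of _ m m _ m])
  finally have DM: "dual_table * M k = eigenvalue_mat k * dual_table" .
  have "eigenvalue_mat k *\<^sub>v (dual_table *\<^sub>v v) = (eigenvalue_mat k * dual_table) *\<^sub>v v"
    by (rule assoc_mult_mat_vec[OF basis_carrier(3) basis_carrier(2) v, symmetric])
  also have "\<dots> = dual_table *\<^sub>v (M k *\<^sub>v v)"
    unfolding DM[symmetric] by (rule assoc_mult_mat_vec[OF basis_carrier(2) M_carrier v])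
  also have "\<dots> = \<kappa> \<cdot>\<^sub>v (dual_table *\<^sub>v v)" unfolding assms(3) by (rule mult_mat_vec[OF basis_carrier(2) v])
  finally have "(eigenvalue_mat k *\<^sub>v (dual_table *\<^sub>v v)) $ j = (\<kappa> \<cdot>\<^sub>v (dual_table *\<^sub>v v)) $ j" by simp
  then show ?thesis using j Dv eigenvalue_mat_vec[OF Dv j] by simp
qed

text \<open>Pairing the eigenvalues of \<open>\<chi>\<close> with the dual of \<open>\<psi>\<close> gives, up to the degree, the inner product of \<open>\<chi>\<close> and
\<open>\<psi>\<close>, which is nonzero exactly for \<open>\<chi> = \<psi>\<close>.\<close>

lemma irr_eigenvalue_distinct:
  assumes jl: "j < m" "l < m" and eq: "\<And>k. k < m \<Longrightarrow> irr_eigenvalue j k = irr_eigenvalue l k"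
  shows "j = l"
proof (rule ccontr)
  assume "j \<noteq> l"
  have s: "(\<Sum>k<m. irr_eigenvalue i k * \<theta> (dual (irr l) (c0 k))) = (if l = i then of_nat (card (carrier G)) else 0) / of_nat (deg (irr i))"
    if "i < m" for i
    unfolding theta_orthogonality[OF jl(2) that, symmetric] sum_divide_distrib
    by (intro sum.cong) (auto simp: irr_eigenvalue_def class_eigenvalue_def divide_inverse mult_ac)
  have "(\<Sum>k<m. irr_eigenvalue j k * \<theta> (dual (irr l) (c0 k))) = (\<Sum>k<m. irr_eigenvalue l k * \<theta> (dual (irr l) (c0 k)))"
    using eq by (intro sum.cong) auto
  then show False using s[OF jl(1)] s[OF jl(2)] \<open>j \<noteq> l\<close> p_not_dvd_order deg_nonzero[OF jl(2)] by auto
qed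

text \<open>A coordinate of a joint eigenvector can only be nonzero where the eigenvalues agree, and distinct
basis vectors have distinct systems of eigenvalues.\<close>

lemma joint_eigenspace:
  assumes v: "v \<in> carrier_vec m" and j: "j < m" and class_eigenvalue: "\<And>k. k < m \<Longrightarrow> M k *\<^sub>v v = irr_eigenvalue j k \<cdot>\<^sub>v v"
  shows "v = (dual_table *\<^sub>v v) $ j \<cdot>\<^sub>v w (irr j)"
proof -
  have Dv: "dual_table *\<^sub>v v \<in> carrier_vec m" by (rule mult_mat_vec_carrier[OF basis_carrier(2) v])
  have z: "(dual_table *\<^sub>v v) $ l = 0" if l: "l < m" "l \<noteq> j" for l
  proof (rule ccontr)
    assume "(dual_table *\<^sub>v v) $ l \<noteq> 0"
    then have "irr_eigenvalue l k = irr_eigenvalue j k" if "k < m" for k using eigen_coordinates[OF v that class_eigenvalue[OF that] l(1)] by simp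
    then show False using irr_eigenvalue_distinct[OF l(1) j] l(2) by blast
  qed
  have "v = char_table *\<^sub>v (dual_table *\<^sub>v v)" using assoc_mult_mat_vec[OF basis_carrier(1) basis_carrier(2) v] table_mult_dual v by simp
  also have "\<dots> = (dual_table *\<^sub>v v) $ j \<cdot>\<^sub>v w (irr j)"
  proof (rule eq_vecI)
    fix i assume "i < dim_vec ((dual_table *\<^sub>v v) $ j \<cdot>\<^sub>v w (irr j))"
    then have i: "i < m" by simp
    have "(char_table *\<^sub>v (dual_table *\<^sub>v v)) $ i = (\<Sum>l<m. char_table $$ (i,l) * (dual_table *\<^sub>v v) $ l)"
      using i Dv by (simp add: char_table_def scalar_prod_def atLeast0LessThan)
    also have "\<dots> = (\<Sum>l<m. if l = j then (dual_table *\<^sub>v v) $ j * \<theta> (irr j (c0 i)) else 0)"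
      using i z by (intro sum.cong) (auto simp: char_table_def)
    finally show "(char_table *\<^sub>v (dual_table *\<^sub>v v)) $ i = ((dual_table *\<^sub>v v) $ j \<cdot>\<^sub>v w (irr j)) $ i" using i j by (simp add: sum.delta)
  qed (simp add: char_table_def)
  finally show ?thesis .
qed

lemma dual_table_w: "j < m \<Longrightarrow> l < m \<Longrightarrow> (dual_table *\<^sub>v w (irr j)) $ l = (if l = j then 1 else 0)"
proof -
  assume jl: "j < m" "l < m"
  have "(dual_table *\<^sub>v w (irr j)) $ l = (dual_table * char_table) $$ (l,j)" using jl col_char_table[OF jl(1)] by (simp add: dual_table_def char_table_def)
  then show ?thesis using dual_table_mult jl by simp
qed

lemma w_nonzero: "j < m \<Longrightarrow> w (irr j) \<noteq> 0\<^sub>v m"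
proof
  assume j: "j < m" and "w (irr j) = 0\<^sub>v m"
  then have "(dual_table *\<^sub>v w (irr j)) $ j = 0" using mult_mat_zero_vec[OF basis_carrier(2)] by simp
  then show False using dual_table_w[OF j j] by simp
qed

lemma w_joint_eigenvector: "j < m \<Longrightarrow> joint_eigenvector (M ` {..<m}) (w (irr j))"
  using eigen_equation_irr w_nonzero by (auto simp: joint_eigenvector_def eigenvector_def)

lemma joint_eigenvector_unique_character:
  assumes "joint_eigenvector (M ` {..<m}) v"
  shows "\<exists>!\<chi>. \<chi> \<in> irreducible_characters G \<alpha> \<and> (\<exists>c. c \<noteq> 0 \<and> v = c \<cdot>\<^sub>v w \<chi>)"
proof -
  have "\<forall>k. \<exists>\<kappa>. k < m \<longrightarrow> eigenvector (M k) v \<kappa>" using assms by (auto simp: joint_eigenvector_def)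
  then obtain \<kappa> where \<kappa>: "\<And>k. k < m \<Longrightarrow> eigenvector (M k) v (\<kappa> k)" by metis
  then have v: "v \<in> carrier_vec m" "v \<noteq> 0\<^sub>v m" using m_pos by (auto simp: eigenvector_def)
  have Dv: "dual_table *\<^sub>v v \<in> carrier_vec m" by (rule mult_mat_vec_carrier[OF basis_carrier(2) v(1)])
  have "v = char_table *\<^sub>v (dual_table *\<^sub>v v)" using assoc_mult_mat_vec[OF basis_carrier(1) basis_carrier(2) v(1)] table_mult_dual v by simp
  then have "dual_table *\<^sub>v v \<noteq> 0\<^sub>v m" using v(2) mult_mat_zero_vec[OF basis_carrier(1)] by auto
  then obtain j where j: "j < m" "(dual_table *\<^sub>v v) $ j \<noteq> 0" using Dv by (metis carrier_vecD eq_vecI index_zero_vec)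
  have "M k *\<^sub>v v = irr_eigenvalue j k \<cdot>\<^sub>v v" if "k < m" for k
  proof -
    have e: "M k *\<^sub>v v = \<kappa> k \<cdot>\<^sub>v v" using \<kappa>[OF that] by (simp add: eigenvector_def)
    then show ?thesis using eigen_coordinates[OF v(1) that e j(1)] j(2) by simp
  qed
  then have vj: "v = (dual_table *\<^sub>v v) $ j \<cdot>\<^sub>v w (irr j)" using joint_eigenspace[OF v(1) j(1)] by blast
  show ?thesis
  proof (rule ex1I[of _ "irr j"])
    show "irr j \<in> irreducible_characters G \<alpha> \<and> (\<exists>c. c \<noteq> 0 \<and> v = c \<cdot>\<^sub>v w (irr j))"
      using irr_mem[OF j(1)] vj j(2) by blast
    fix \<psi> assume \<psi>: "\<psi> \<in> irreducible_characters G \<alpha> \<and> (\<exists>c. c \<noteq> 0 \<and> v = c \<cdot>\<^sub>v w \<psi>)"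
    then obtain c where c: "v = c \<cdot>\<^sub>v w \<psi>" by blast
    obtain l where l: "l < m" "\<psi> = irr l" using irr_cases \<psi> by blast
    have "dual_table *\<^sub>v v = c \<cdot>\<^sub>v (dual_table *\<^sub>v w \<psi>)" unfolding c by (rule mult_mat_vec[OF basis_carrier(2) w_carrier])
    moreover have "dual_table *\<^sub>v w \<psi> \<in> carrier_vec m" by (rule mult_mat_vec_carrier[OF basis_carrier(2) w_carrier])
    ultimately have "(dual_table *\<^sub>v v) $ j = c * (if j = l then 1 else 0)" using dual_table_w[OF l(1) j(1)] j(1) l(2) by simp
    then have "j = l" using j(2) by (auto split: if_splits)
    then show "\<psi> = irr j" using l by simp
  qed
qed

lemma eigenspace_iff:
  assumes A: "irreducible_rep G \<alpha> d \<pi>" and v: "v \<in> carrier_vec m"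
  shows "(\<forall>k<m. M k *\<^sub>v v = class_eigenvalue d (proj_character G \<pi>) k \<cdot>\<^sub>v v) \<longleftrightarrow> (\<exists>c. v = c \<cdot>\<^sub>v w (proj_character G \<pi>))"
proof -
  obtain j where j: "j < m" "proj_character G \<pi> = irr j" using irr_cases[OF irreducible_characters_memI[OF A]] .
  have e: "class_eigenvalue d (proj_character G \<pi>) k = irr_eigenvalue j k" for k using deg_eq[OF A] by (simp add: irr_eigenvalue_def j(2))
  show ?thesis unfolding e
  proof
    assume "\<forall>k<m. M k *\<^sub>v v = irr_eigenvalue j k \<cdot>\<^sub>v v"
    then show "\<exists>c. v = c \<cdot>\<^sub>v w (proj_character G \<pi>)" using joint_eigenspace[OF v j(1)] unfolding j(2) by blast
  next
    assume "\<exists>c. v = c \<cdot>\<^sub>v w (proj_character G \<pi>)"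
    then obtain c where c: "v = c \<cdot>\<^sub>v w (irr j)" unfolding j(2) by blast
    show "\<forall>k<m. M k *\<^sub>v v = irr_eigenvalue j k \<cdot>\<^sub>v v"
    proof (intro allI impI)
      fix k assume k: "k < m"
      show "M k *\<^sub>v v = irr_eigenvalue j k \<cdot>\<^sub>v v"
        unfolding c mult_mat_vec[OF M_carrier w_carrier] eigen_equation_irr[OF j(1) k]
        by (simp add: smult_smult_assoc mult.commute)
    qed
  qed
qed

end

section \<open>Characters from joint eigenvectors\<close>

theorem theorem2:
  fixes G :: "('g, 'more) monoid_scheme"
    and \<alpha> :: "'g \<Rightarrow> 'g \<Rightarrow> complex"
    and e :: nat
    and \<zeta> :: complex
    and z :: "'p :: prime_card mod_ring"
  assumes "group G"
    and "finite (carrier G)"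
    and "unitary_multiplier G \<alpha>"
    and "e = multiplier_exponent G \<alpha>"
    and "primitive_root_of_unity e \<zeta>"
  shows
   "\<comment> \<open>such p and z exist\<close>
    (\<exists>p::nat. prime p \<and> real p > 2 * sqrt (real (card (carrier G))) \<and> e dvd p - 1) \<and>
    (\<forall>p::nat. prime p \<and> real p > 2 * sqrt (real (card (carrier G))) \<and> e dvd p - 1 \<longrightarrow>
       (\<exists>x::int. [x ^ e = 1] (mod int p) \<and> (\<forall>n. 0 < n \<and> n < e \<longrightarrow> \<not> [x ^ n = 1] (mod int p)))) \<and>
    \<comment> \<open>p is the cardinality of the type parameter\<close>
    (real CARD('p) > 2 * sqrt (real (card (carrier G))) \<and> e dvd CARD('p) - 1 \<and>
     primitive_root_of_unity e z \<longrightarrow>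
     (let \<theta> = theta \<zeta> z in
      (of_nat e :: 'p mod_ring) \<noteq> 0 \<and>

      \<comment> \<open>(1)\<close>
      (\<forall>f g. eval_int_poly f \<zeta> = eval_int_poly g \<zeta> \<longrightarrow> eval_int_poly f z = eval_int_poly g z) \<and>
      (\<forall>f. \<theta> (eval_int_poly f \<zeta>) = eval_int_poly f z) \<and>
      \<theta> \<in> Ring.ring_hom (ring_of_type_algebra\<lparr>carrier := int_adjoin \<zeta>\<rparr>) ring_of_type_algebra \<and>

      \<comment> \<open>(2)\<close>
      (\<forall>d \<pi>. proj_rep G \<alpha> d \<pi> \<longrightarrow>
         (\<forall>g\<in>carrier G. (\<forall>x. eigenvalue (\<pi> g) x \<longrightarrow> x ^ e = 1) \<and>
                        proj_character G \<pi> g \<in> int_adjoin \<zeta>)) \<and>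

      (\<forall>m C c0. bij_betw C {..<m} (regular_classes G \<alpha>) \<and> (\<forall>i<m. c0 i \<in> C i) \<longrightarrow>
        (let M = class_matrix G \<alpha> \<theta> m C c0;
             w = character_vec \<theta> m c0
         in
         \<comment> \<open>(3)\<close>
         (\<forall>d \<pi>. irreducible_proj_rep G \<alpha> d \<pi> \<longrightarrow>
            (let \<chi> = proj_character G \<pi> in
             (of_nat d :: 'p mod_ring) \<noteq> 0 \<and>
             (\<forall>k<m. M k *\<^sub>v w \<chi> =
                (of_nat (card (C k)) * \<theta> (\<chi> (c0 k)) * inverse (of_nat d)) \<cdot>\<^sub>v w \<chi>) \<and>
             joint_eigenvector (M ` {..<m}) (w \<chi>))) \<and>

         \<comment> \<open>(4)\<close>
         jointly_diagonalisable (M ` {..<m}) \<and>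
         finite (irreducible_characters G \<alpha>) \<and> card (irreducible_characters G \<alpha>) = m \<and>
         (\<forall>v. joint_eigenvector (M ` {..<m}) v \<longrightarrow>
            (\<exists>!\<chi>. \<chi> \<in> irreducible_characters G \<alpha> \<and> (\<exists>c. c \<noteq> 0 \<and> v = c \<cdot>\<^sub>v w \<chi>))) \<and>
         (\<forall>d \<pi>. irreducible_proj_rep G \<alpha> d \<pi> \<longrightarrow>
            (let \<chi> = proj_character G \<pi> in
             \<forall>v\<in>carrier_vec m.
               (\<forall>k<m. M k *\<^sub>v v =
                  (of_nat (card (C k)) * \<theta> (\<chi> (c0 k)) * inverse (of_nat d)) \<cdot>\<^sub>v v) \<longleftrightarrow>
               (\<exists>c. v = c \<cdot>\<^sub>v w \<chi>))))) \<and>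

      \<comment> \<open>(5), using \<open>\<pi>(g)\<^sup>n = [\<Prod>\<alpha>(g\<^sup>i,g)] \<pi>(g\<^sup>n)\<close>, so the product is inverted in (a) and not in (b)\<close>
      (\<forall>d \<pi>. proj_rep G \<alpha> d \<pi> \<longrightarrow>
         (let \<chi> = proj_character G \<pi>;
              \<mu> = (\<lambda>k g. eigenvalue_multiplicity (\<pi> g) (\<zeta> ^ k));
              rhs = (\<lambda>k g. inverse (of_nat e) *
                (\<Sum>n<e. inverse z ^ (n * k) * \<theta> (\<chi> (g [^]\<^bsub>G\<^esub> n)) *
                   (\<Prod>i=1..<n. \<theta> (\<alpha> (g [^]\<^bsub>G\<^esub> i) g))))
          in
          (\<forall>g\<in>carrier G. \<forall>n.
             \<chi> (g [^]\<^bsub>G\<^esub> n) =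
               inverse (\<Prod>i=1..<n. \<alpha> (g [^]\<^bsub>G\<^esub> i) g) * (\<Sum>k<e. of_nat (\<mu> k g) * \<zeta> ^ (k * n))) \<and>
          (\<forall>g\<in>carrier G. \<forall>k<e. of_nat (\<mu> k g) = rhs k g) \<and>
          (irreducible_proj_rep G \<alpha> d \<pi> \<longrightarrow>
             (\<forall>g\<in>carrier G. \<forall>k<e. \<mu> k g = (LEAST l. of_nat l = rhs k g)))))))"
proof (intro conjI impI, goal_cases)
  case 1
  interpret twisted_group G \<alpha> using assms by (intro twisted_group.intro twisted_group_axioms.intro)
  have e_pos: "e > 0" using exponent_pos assms(4) by simp
  obtain \<mu> where "root_of_unity_min_poly e \<zeta> \<mu>" using root_of_unity_min_poly_exists[OF e_pos assms(5)] .
  then interpret mp: root_of_unity_min_poly e \<zeta> \<mu> .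
  obtain p where p: "p > 2 * card (carrier G)" "prime p" "e dvd p - 1" using mp.exists_prime_cong_1 by blast
  have "1 \<le> card (carrier G)" using card_carrier_pos by linarith
  then have "1 \<le> real (card (carrier G))" by linarith
  then have "sqrt (real (card (carrier G))) \<le> real (card (carrier G))"
    by (intro real_le_lsqrt) (auto simp: power2_eq_square)
  then have "2 * sqrt (real (card (carrier G))) < real p" using p(1) by linarith
  then show ?case using p by blast
next
  case 2
  show ?case using prime_cong_1_has_element_of_order by blast
next
  case 3
  interpret dixon G \<alpha> e \<zeta> z
    using assms 3 by (intro dixon.intro dixon_axioms.intro twisted_group.intro twisted_group_axioms.intro) auto
  note th = \<theta>_def[symmetric]
  have rep: "projective_rep G \<alpha> d \<pi>" if "proj_rep G \<alpha> d \<pi>" for d \<pi>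
    using that twisted_group_axioms by (intro projective_rep.intro projective_rep_axioms.intro)
  show ?case unfolding Let_def th
  proof (intro conjI, goal_cases)
    case 1
    show ?case by (rule of_nat_e_nonzero)
  next
    case 2
    show ?case using well_defined by blast
  next
    case 3
    show ?case using theta_eval by blast
  next
    case 4
    show ?case by (rule theta_ring_hom)
  next
    case 5
    show ?case
    proof (intro allI impI ballI conjI)
      fix d \<pi> g assume R: "proj_rep G \<alpha> d \<pi>" and g: "g \<in> carrier G"
      interpret projective_rep G \<alpha> d \<pi> using R by (rule rep)
      show "x ^ e = 1" if "eigenvalue (\<pi> g) x" for x using eigenvalue_root_of_unity[OF g that] by (simp add: e_def)
      show "proj_character G \<pi> g \<in> int_adjoin \<zeta>" using char_integral[OF projective_rep_axioms g] g by simp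
    qed
  next
    case 6
    show ?case
    proof (intro allI impI, goal_cases)
      case (1 m C c0)
      interpret dixon_classes G \<alpha> e \<zeta> z m C c0
        using 1 twisted_group_axioms dixon_axioms
        by (intro dixon_classes.intro class_enum.intro class_enum_axioms.intro) auto
      show ?case unfolding M_def[symmetric] w_def[symmetric]
      proof (intro conjI, goal_cases)
        case 1
        show ?case
        proof (intro allI impI)
          fix d \<pi> assume "irreducible_proj_rep G \<alpha> d \<pi>"
          then have A: "irreducible_rep G \<alpha> d \<pi>" by (rule irreducible_repI)
          obtain j where j: "j < m" "proj_character G \<pi> = irr j" using irr_cases[OF irreducible_characters_memI[OF A]] .
          show "(of_nat d :: 'p mod_ring) \<noteq> 0 \<and>
             (\<forall>k<m. M k *\<^sub>v w (proj_character G \<pi>) =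
                (of_nat (card (C k)) * \<theta> (proj_character G \<pi> (c0 k)) * inverse (of_nat d)) \<cdot>\<^sub>v w (proj_character G \<pi>)) \<and>
             joint_eigenvector (M ` {..<m}) (w (proj_character G \<pi>))"
            using degree_less_p(2)[OF A] eigen_equation[OF A] w_joint_eigenvector[OF j(1)] unfolding j(2) class_eigenvalue_def by blast
        qed
      next
        case 2
        show ?case by (rule M_jointly_diagonalisable)
      next
        case 3
        show ?case by (rule finite_irreducible_characters)
      next
        case 4
        show ?case by (rule card_irreducible_characters)
      next
        case 5
        show ?case using joint_eigenvector_unique_character by blast
      next
        case 6
        show ?case
        proof (intro allI impI ballI)
          fix d \<pi> and v :: "'p mod_ring vec"
          assume "irreducible_proj_rep G \<alpha> d \<pi>" and v: "v \<in> carrier_vec m"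
          then have A: "irreducible_rep G \<alpha> d \<pi>" by (intro irreducible_repI)
          show "(\<forall>k<m. M k *\<^sub>v v =
                  (of_nat (card (C k)) * \<theta> (proj_character G \<pi> (c0 k)) * inverse (of_nat d)) \<cdot>\<^sub>v v) \<longleftrightarrow>
               (\<exists>c. v = c \<cdot>\<^sub>v w (proj_character G \<pi>))"
            using eigenspace_iff[OF A v] unfolding class_eigenvalue_def .
        qed
      qed
    qed
  next
    case 7
    show ?case
    proof (intro allI impI, goal_cases)
      case (1 d \<pi>)
      interpret projective_rep G \<alpha> d \<pi> using 1 by (rule rep)
      have formula: "of_nat (eigenvalue_multiplicity (\<pi> g) (\<zeta> ^ k)) = inverse (of_nat e) *
          (\<Sum>n<e. inverse z ^ (n * k) * \<theta> (proj_character G \<pi> (g [^]\<^bsub>G\<^esub> n)) * (\<Prod>i=1..<n. \<theta> (\<alpha> (g [^]\<^bsub>G\<^esub> i) g)))"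
        if "g \<in> carrier G" "k < e" for g k
        using multiplicity_formula[OF projective_rep_axioms that] that(1) by simp
      show ?case
      proof (intro conjI, goal_cases)
        case 1
        show ?case
        proof (intro ballI allI)
          fix g and n :: nat assume g: "g \<in> carrier G"
          have "(\<Prod>i=1..<n. \<alpha> (g [^]\<^bsub>G\<^esub> i) g) \<noteq> 0" using g by simp
          then show "proj_character G \<pi> (g [^]\<^bsub>G\<^esub> n) = inverse (\<Prod>i=1..<n. \<alpha> (g [^]\<^bsub>G\<^esub> i) g) *
              (\<Sum>k<e. of_nat (eigenvalue_multiplicity (\<pi> g) (\<zeta> ^ k)) * \<zeta> ^ (k * n))"
            using power_trace_multiplicities(1)[of \<zeta> g n] \<zeta> g unfolding e_def by (simp add: field_simps)
        qed
      next
        case 2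
        show ?case using formula by blast
      next
        case 3
        show ?case
        proof (intro impI ballI allI)
          fix g k assume irr: "irreducible_proj_rep G \<alpha> d \<pi>" and g: "g \<in> carrier G" and k: "k < e"
          let ?\<mu> = "eigenvalue_multiplicity (\<pi> g) (\<zeta> ^ k)"
          have small: "?\<mu> < CARD('p)"
            using power_trace_multiplicities(2)[OF _ g] \<zeta> degree_less_p(1)[OF irreducible_repI[OF irr]] unfolding e_def
            by (meson le_less_trans)
          show "?\<mu> = (LEAST l. of_nat l = inverse (of_nat e) *
            (\<Sum>n<e. inverse z ^ (n * k) * \<theta> (proj_character G \<pi> (g [^]\<^bsub>G\<^esub> n)) * (\<Prod>i=1..<n. \<theta> (\<alpha> (g [^]\<^bsub>G\<^esub> i) g))))"
            unfolding formula[OF g k, symmetric]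
          proof (rule Least_equality[symmetric])
            fix l assume eq: "of_nat l = (of_nat ?\<mu> :: 'p mod_ring)"
            show "?\<mu> \<le> l"
            proof (rule ccontr)
              assume "\<not> ?\<mu> \<le> l"
              then have l: "l < ?\<mu>" by simp
              then have "of_nat (?\<mu> - l) = (0 :: 'p mod_ring)" using eq by (simp add: of_nat_diff)
              then have "CARD('p) dvd ?\<mu> - l" by (simp only: of_nat_eq_0_iff_p)
              then show False using l small by (auto dest!: dvd_imp_le)
            qed
          qed simp
        qed
      qed
    qed
  qed
qed

end
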